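(* Let $X$ be an infinite uniformly locally finite metric space. Let $\mathcal{M}\subseteq\mathcal{B}(\ell_2(X))$ be a $\mathrm{C}^*$-subalgebra closed in the weak operator topology. (1) If $\mathcal{M}\subseteq\mathrm{C}^*_{ql}(X)$, then the unit ball of $\mathcal{M}$ is equi-quasi-local. (2) If $\mathcal{M}\subseteq\mathrm{C}^*_u(X)$, then the unit ball of $\mathcal{M}$ is equi-approximable.
   Context: A metric space $X$ is uniformly locally finite if for each $r>0$ one has $\sup_{x\in X}|B_r(x)|<\infty$, where $B_r(x)$ is the closed ball of radius $r$. The subalgebra $\mathcal{M}$ need not contain the identity of $\mathcal{B}(\ell_2(X))$. $\ell_2(X)$ is the complex Hilbert space of square-summable functions on $X$ with orthonormal basis $(\delta_x)_{x\in X}$; for $A\subseteq X$, $\chi_A$ is the orthogonal projection onto $\ell_2(A)$; $d(A,B)=\inf\{d(x,y): x\in A, y\in B\}$. The propagation of $a\in\mathcal{B}(\ell_2(X))$ is $\mathrm{prop}(a)=\sup\{d(x,z): \langle a\delta_x,\delta_z\rangle\ne 0\}$. The uniform Roe algebra $\mathrm{C}^*_u(X)$ is the norm closure of the $*$-algebra of operators in $\mathcal{B}(\ell_2(X))$ of finite propagation. For $\varepsilon,r>0$, $a$ is $\varepsilon$-$r$-quasi-local if $\|\chi_Aa\chi_B\|\le\varepsilon$ for all $A,B\subseteq X$ with $d(A,B)>r$; $a$ is $\varepsilon$-$r$-approximable if there is $b\in\mathcal{B}(\ell_2(X))$ with $\mathrm{prop}(b)\le r$ and $\|a-b\|\le\varepsilon$.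 The quasi-local algebra $\mathrm{C}^*_{ql}(X)$ consists of all $a\in\mathcal{B}(\ell_2(X))$ such that for every $\varepsilon>0$ there is $r>0$ for which $a$ is $\varepsilon$-$r$-quasi-local. A set $S\subseteq\mathcal{B}(\ell_2(X))$ is equi-quasi-local (respectively equi-approximable) if for all $\varepsilon>0$ there is $r>0$ such that every contraction $a\in S$ is $\varepsilon$-$r$-quasi-local (respectively $\varepsilon$-$r$-approximable). *)

theory Defs
  imports "HOL-Analysis.Analysis"
begin

section \<open>The complex Hilbert space of square-summable functions\<close>

typedef 'a ell2 = "{f :: 'a \<Rightarrow> complex. (\<lambda>x. (cmod (f x))\<^sup>2) summable_on UNIV}"
  morphisms ell2_apply Abs_ell2
  by (rule exI[of _ "\<lambda>_. 0"]) simp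

setup_lifting type_definition_ell2

lemma ell2_eqI: "(\<And>x. ell2_apply f x = ell2_apply g x) \<Longrightarrow> f = g"
  by (simp add: ell2_apply_inject[symmetric] fun_eq_iff)

lemma ell2_summable: "(\<lambda>x. (cmod (ell2_apply f x))\<^sup>2) summable_on UNIV"
  using ell2_apply[of f] by simp

lemma square_summable_add:
  fixes f g :: "'a \<Rightarrow> complex"
  assumes "(\<lambda>x. (cmod (f x))\<^sup>2) summable_on UNIV" "(\<lambda>x. (cmod (g x))\<^sup>2) summable_on UNIV"
  shows "(\<lambda>x. (cmod (f x + g x))\<^sup>2) summable_on UNIV"
proof (rule summable_on_comparison_test)
  show "(\<lambda>x. 2 * (cmod (f x))\<^sup>2 + 2 * (cmod (g x))\<^sup>2) summable_on UNIV"
    by (intro summable_on_add summable_on_cmult_right assms)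
  show "(cmod (f x + g x))\<^sup>2 \<le> 2 * (cmod (f x))\<^sup>2 + 2 * (cmod (g x))\<^sup>2" for x
  proof -
    have "(cmod (f x + g x))\<^sup>2 \<le> (cmod (f x) + cmod (g x))\<^sup>2"
      by (intro power_mono norm_triangle_ineq norm_ge_zero)
    also have "\<dots> \<le> 2 * (cmod (f x))\<^sup>2 + 2 * (cmod (g x))\<^sup>2"
      using zero_le_power2[of "cmod (f x) - cmod (g x)"]
      by (simp add: power2_eq_square algebra_simps)
    finally show ?thesis .
  qed
qed auto

lemma square_summable_scale:
  fixes f :: "'a \<Rightarrow> complex"
  assumes "(\<lambda>x. (cmod (f x))\<^sup>2) summable_on UNIV"
  shows "(\<lambda>x. (cmod (c * f x))\<^sup>2) summable_on UNIV"
  unfolding norm_mult power_mult_distrib by (intro summable_on_cmult_right assms)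

lemma ell2_product_summable:
  "(\<lambda>x. ell2_apply f x * cnj (ell2_apply g x)) summable_on UNIV"
unfolding summable_on_iff_abs_summable_on_complex
proof (rule Infinite_Sum.abs_summable_on_comparison_test')
  show "(\<lambda>x. (cmod (ell2_apply f x))\<^sup>2 + (cmod (ell2_apply g x))\<^sup>2) summable_on UNIV"
    by (intro summable_on_add ell2_summable)
  show "cmod (ell2_apply f x * cnj (ell2_apply g x))
      \<le> (cmod (ell2_apply f x))\<^sup>2 + (cmod (ell2_apply g x))\<^sup>2" for x
  proof -
    have "2 * (cmod (ell2_apply f x) * cmod (ell2_apply g x))
        \<le> (cmod (ell2_apply f x))\<^sup>2 + (cmod (ell2_apply g x))\<^sup>2"
      using zero_le_power2[of "cmod (ell2_apply f x) - cmod (ell2_apply g x)"]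
      by (simp add: power2_eq_square algebra_simps)
    moreover have "0 \<le> cmod (ell2_apply f x) * cmod (ell2_apply g x)" by simp
    ultimately show ?thesis unfolding norm_mult complex_mod_cnj by linarith
  qed
qed

text \<open>The inner product is linear in the first argument, so the inner product of
  \<open>a \<delta>\<^sub>x\<close> with \<open>\<delta>\<^sub>z\<close> is the value of \<open>a \<delta>\<^sub>x\<close> at \<open>z\<close>.\<close>

definition cinner :: "'a ell2 \<Rightarrow> 'a ell2 \<Rightarrow> complex" where
  "cinner f g = (\<Sum>\<^sub>\<infinity>x. ell2_apply f x * cnj (ell2_apply g x))"

lift_definition cscale :: "complex \<Rightarrow> 'a ell2 \<Rightarrow> 'a ell2" is "\<lambda>c f x. c * f x"
  using square_summable_scale by auto

text \<open>The real inner product is the real part of \<^const>\<open>cinner\<close>; it induces the Hilbert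
  space norm, so that \<^typ>\<open>'a ell2 \<Rightarrow>\<^sub>L 'a ell2\<close> carries the usual operator norm.\<close>

instantiation ell2 :: (type) real_inner
begin

lift_definition zero_ell2 :: "'a ell2" is "\<lambda>_. 0" by simp

lift_definition plus_ell2 :: "'a ell2 \<Rightarrow> 'a ell2 \<Rightarrow> 'a ell2" is "\<lambda>f g x. f x + g x"
  using square_summable_add by auto

lift_definition uminus_ell2 :: "'a ell2 \<Rightarrow> 'a ell2" is "\<lambda>f x. - f x" by simp

lift_definition minus_ell2 :: "'a ell2 \<Rightarrow> 'a ell2 \<Rightarrow> 'a ell2" is "\<lambda>f g x. f x - g x"
proof -
  fix f g :: "'a \<Rightarrow> complex"
  assume "(\<lambda>x. (cmod (f x))\<^sup>2) summable_on UNIV" "(\<lambda>x. (cmod (g x))\<^sup>2) summable_on UNIV"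
  then show "(\<lambda>x. (cmod (f x - g x))\<^sup>2) summable_on UNIV"
    using square_summable_add[of f "\<lambda>x. - g x"] by simp
qed

lift_definition scaleR_ell2 :: "real \<Rightarrow> 'a ell2 \<Rightarrow> 'a ell2" is
  "\<lambda>r f x. complex_of_real r * f x"
  using square_summable_scale by auto

definition inner_ell2 :: "'a ell2 \<Rightarrow> 'a ell2 \<Rightarrow> real" where
  "inner_ell2 f g = Re (cinner f g)"

definition norm_ell2 :: "'a ell2 \<Rightarrow> real" where
  "norm_ell2 f = sqrt (inner f f)"

definition dist_ell2 :: "'a ell2 \<Rightarrow> 'a ell2 \<Rightarrow> real" where
  "dist_ell2 f g = norm (f - g)"

definition sgn_ell2 :: "'a ell2 \<Rightarrow> 'a ell2" where
  "sgn_ell2 f = inverse (norm f) *\<^sub>R f"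

definition uniformity_ell2 :: "('a ell2 \<times> 'a ell2) filter" where
  "uniformity_ell2 = (INF e\<in>{0 <..}. principal {(f, g). dist f g < e})"

definition open_ell2 :: "'a ell2 set \<Rightarrow> bool" where
  "open_ell2 U \<longleftrightarrow> (\<forall>f\<in>U. eventually (\<lambda>(f', g). f' = f \<longrightarrow> g \<in> U) uniformity)"

lemma inner_ell2_self: "inner f f = (\<Sum>\<^sub>\<infinity>x. (cmod (ell2_apply f x))\<^sup>2)"
  unfolding inner_ell2_def cinner_def infsum_Re[OF ell2_product_summable, symmetric]
  by (simp add: complex_mult_cnj cmod_power2)

instance
proof
  fix f g h :: "'a ell2" and r s :: real
  show "f + g + h = f + (g + h)" by transfer (simp add: add.assoc)
  show "f + g = g + f" by transfer (simp add: add.commute)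
  show "0 + f = f" by transfer simp
  show "- f + f = 0" by transfer simp
  show "f - g = f + - g" by transfer simp
  show "r *\<^sub>R (f + g) = r *\<^sub>R f + r *\<^sub>R g" by transfer (simp add: distrib_left)
  show "(r + s) *\<^sub>R f = r *\<^sub>R f + s *\<^sub>R f" by transfer (simp add: distrib_right)
  show "r *\<^sub>R s *\<^sub>R f = (r * s) *\<^sub>R f" by transfer (simp add: mult.assoc)
  show "1 *\<^sub>R f = f" by transfer simp
  show "dist f g = norm (f - g)" by (rule dist_ell2_def)
  show "sgn f = inverse (norm f) *\<^sub>R f" by (rule sgn_ell2_def)
  show "uniformity = (INF e\<in>{0 <..}. principal {(f :: 'a ell2, g). dist f g < e})"
    by (rule uniformity_ell2_def)
  show "open U \<longleftrightarrow> (\<forall>f\<in>U. eventually (\<lambda>(f', g). f' = f \<longrightarrow> g \<in> U) uniformity)"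
    for U :: "'a ell2 set" by (rule open_ell2_def)
  have "cinner g f = cnj (cinner f g)"
    unfolding cinner_def infsum_cnj[symmetric] by (simp add: mult.commute)
  then show "inner f g = inner g f" by (simp add: inner_ell2_def)
  have "cinner (f + g) h = cinner f h + cinner g h"
    unfolding cinner_def
    by (simp add: plus_ell2.rep_eq distrib_right infsum_add ell2_product_summable)
  then show "inner (f + g) h = inner f h + inner g h" by (simp add: inner_ell2_def)
  have "cinner (r *\<^sub>R f) g = complex_of_real r * cinner f g"
    unfolding cinner_def by (simp add: scaleR_ell2.rep_eq mult.assoc infsum_cmult_right')
  then show "inner (r *\<^sub>R f) g = r * inner f g" by (simp add: inner_ell2_def)
  show "0 \<le> inner f f" unfolding inner_ell2_self by (intro infsum_nonneg) simp
  show "inner f f = 0 \<longleftrightarrow> f = 0"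
  proof
    assume "inner f f = 0"
    then have "(cmod (ell2_apply f x))\<^sup>2 = 0" for x
      by (intro nonneg_infsum_le_0D[OF _ ell2_summable]) (auto simp: inner_ell2_self)
    then show "f = 0" by (intro ell2_eqI) (simp add: zero_ell2.rep_eq)
  qed (simp add: inner_ell2_self zero_ell2.rep_eq)
  show "norm f = sqrt (inner f f)" by (rule norm_ell2_def)
qed

end

lift_definition delta :: "'a \<Rightarrow> 'a ell2" is "\<lambda>x y. if y = x then 1 else 0"
proof -
  fix x :: 'a
  have "(\<lambda>y. (cmod (if y = x then 1 else 0))\<^sup>2) summable_on UNIV
      \<longleftrightarrow> (\<lambda>y. 1 :: real) summable_on {x}"
    by (rule summable_on_cong_neutral) auto
  then show "(\<lambda>y. (cmod (if y = x then 1 else 0))\<^sup>2) summable_on UNIV"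
    by simp
qed

section \<open>Bounded operators\<close>

text \<open>\<^typ>\<open>'a ell2 \<Rightarrow>\<^sub>L 'a ell2\<close> is the type of bounded real-linear maps; the elements of
  \<open>\<B>(\<ell>\<^sub>2(X))\<close> are the complex-linear ones.\<close>

definition bounded_ops :: "('a ell2 \<Rightarrow>\<^sub>L 'a ell2) set" where
  "bounded_ops = {a. \<forall>c \<xi>. blinfun_apply a (cscale c \<xi>) = cscale c (blinfun_apply a \<xi>)}"

definition is_adjoint :: "('a ell2 \<Rightarrow>\<^sub>L 'a ell2) \<Rightarrow> ('a ell2 \<Rightarrow>\<^sub>L 'a ell2) \<Rightarrow> bool" where
  "is_adjoint a b \<longleftrightarrow>
    (\<forall>\<xi> \<eta>. cinner (blinfun_apply a \<xi>) \<eta> = cinner \<xi> (blinfun_apply b \<eta>))"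

lemma bounded_linear_cscale: "bounded_linear (cscale c)"
proof (rule bounded_linear_intro[where K = "cmod c"])
  fix f g :: "'a ell2" and r :: real
  show "cscale c (f + g) = cscale c f + cscale c g" by transfer (simp add: distrib_left)
  show "cscale c (r *\<^sub>R f) = r *\<^sub>R cscale c f" by transfer (simp add: mult_ac)
  have "inner (cscale c f) (cscale c f) = (cmod c)\<^sup>2 * inner f f"
    by (simp add: inner_ell2_self cscale.rep_eq norm_mult power_mult_distrib infsum_cmult_right')
  then show "norm (cscale c f) \<le> norm f * cmod c"
    by (simp add: norm_eq_sqrt_inner real_sqrt_mult)
qed

lift_definition scalar_op :: "complex \<Rightarrow> ('a ell2 \<Rightarrow>\<^sub>L 'a ell2)" is cscale
  by (rule bounded_linear_cscale)

lift_definition restrict_ell2 :: "'a set \<Rightarrow> 'a ell2 \<Rightarrow> 'a ell2" is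
  "\<lambda>A f x. if x \<in> A then f x else 0"
proof -
  fix A and f :: "'a \<Rightarrow> complex"
  assume "(\<lambda>x. (cmod (f x))\<^sup>2) summable_on UNIV"
  then show "(\<lambda>x. (cmod (if x \<in> A then f x else 0))\<^sup>2) summable_on UNIV"
    by (rule summable_on_comparison_test) auto
qed

lift_definition chi :: "'a set \<Rightarrow> ('a ell2 \<Rightarrow>\<^sub>L 'a ell2)" is restrict_ell2
proof -
  fix A :: "'a set"
  show "bounded_linear (restrict_ell2 A)"
  proof (rule bounded_linear_intro[where K = 1])
    fix f g :: "'a ell2" and r :: real
    show "restrict_ell2 A (f + g) = restrict_ell2 A f + restrict_ell2 A g"
      by transfer (simp add: fun_eq_iff)
    show "restrict_ell2 A (r *\<^sub>R f) = r *\<^sub>R restrict_ell2 A f"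
      by transfer (simp add: fun_eq_iff)
    have "inner (restrict_ell2 A f) (restrict_ell2 A f) \<le> inner f f"
      unfolding inner_ell2_self
      by (rule infsum_mono[OF ell2_summable ell2_summable]) (simp add: restrict_ell2.rep_eq)
    then show "norm (restrict_ell2 A f) \<le> norm f * 1"
      by (simp add: norm_eq_sqrt_inner)
  qed
qed

text \<open>The coarsest topology on \<^const>\<open>bounded_ops\<close> making every matrix coefficient
  continuous; the codomain carries the product topology. Compare
  \<^const>\<open>strong_operator_topology\<close>.\<close>

definition weak_operator_topology :: "('a ell2 \<Rightarrow>\<^sub>L 'a ell2) topology" where
  "weak_operator_topology =
    pullback_topology bounded_ops (\<lambda>a (\<xi>, \<eta>). cinner (blinfun_apply a \<xi>) \<eta>) euclidean"

text \<open>Not required to be unital.\<close>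

definition cstar_subalgebra :: "('a ell2 \<Rightarrow>\<^sub>L 'a ell2) set \<Rightarrow> bool" where
  "cstar_subalgebra M \<longleftrightarrow>
    M \<subseteq> bounded_ops \<and> 0 \<in> M \<and>
    (\<forall>a\<in>M. \<forall>b\<in>M. a + b \<in> M) \<and>
    (\<forall>c. \<forall>a\<in>M. scalar_op c o\<^sub>L a \<in> M) \<and>
    (\<forall>a\<in>M. \<forall>b\<in>M. a o\<^sub>L b \<in> M) \<and>
    (\<forall>a\<in>M. \<exists>b\<in>M. is_adjoint a b) \<and>
    closed M"

section \<open>Uniform Roe algebras and quasi-local algebras\<close>

definition uniformly_locally_finite :: "'a::metric_space set \<Rightarrow> bool" where
  "uniformly_locally_finite X \<longleftrightarrow>
    (\<forall>r>0. \<exists>N. \<forall>x\<in>X. finite (cball x r \<inter> X) \<and> card (cball x r \<inter> X) \<le> N)"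

text \<open>The supremum is taken in \<open>[0, \<infinity>]\<close>; in particular the zero operator has propagation 0.\<close>

definition propagation :: "('a::metric_space ell2 \<Rightarrow>\<^sub>L 'a ell2) \<Rightarrow> ennreal" where
  "propagation a =
    (SUP (x, z) \<in> {(x, z). cinner (blinfun_apply a (delta x)) (delta z) \<noteq> 0}. ennreal (dist x z))"

text \<open>\<^const>\<open>setdist\<close> is 0, not infinite, if one of the sets is empty; this is harmless
  here because then \<open>chi A o\<^sub>L a o\<^sub>L chi B = 0\<close>.\<close>

definition quasi_local :: "real \<Rightarrow> real \<Rightarrow> ('a::metric_space ell2 \<Rightarrow>\<^sub>L 'a ell2) \<Rightarrow> bool" where
  "quasi_local \<epsilon> r a \<longleftrightarrow> (\<forall>A B. setdist A B > r \<longrightarrow> norm (chi A o\<^sub>L a o\<^sub>L chi B) \<le> \<epsilon>)"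

definition approximable :: "real \<Rightarrow> real \<Rightarrow> ('a::metric_space ell2 \<Rightarrow>\<^sub>L 'a ell2) \<Rightarrow> bool" where
  "approximable \<epsilon> r a \<longleftrightarrow>
    (\<exists>b\<in>bounded_ops. propagation b \<le> ennreal r \<and> norm (a - b) \<le> \<epsilon>)"

definition uniform_roe_algebra :: "('a::metric_space ell2 \<Rightarrow>\<^sub>L 'a ell2) set" where
  "uniform_roe_algebra = closure {a \<in> bounded_ops. propagation a < \<infinity>}"

definition quasi_local_algebra :: "('a::metric_space ell2 \<Rightarrow>\<^sub>L 'a ell2) set" where
  "quasi_local_algebra = {a \<in> bounded_ops. \<forall>\<epsilon>>0. \<exists>r>0. quasi_local \<epsilon> r a}"

definition equi_quasi_local :: "('a::metric_space ell2 \<Rightarrow>\<^sub>L 'a ell2) set \<Rightarrow> bool" where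
  "equi_quasi_local S \<longleftrightarrow>
    (\<forall>\<epsilon>>0. \<exists>r>0. \<forall>a\<in>S. norm a \<le> 1 \<longrightarrow> quasi_local \<epsilon> r a)"

definition equi_approximable :: "('a::metric_space ell2 \<Rightarrow>\<^sub>L 'a ell2) set \<Rightarrow> bool" where
  "equi_approximable S \<longleftrightarrow>
    (\<forall>\<epsilon>>0. \<exists>r>0. \<forall>a\<in>S. norm a \<le> 1 \<longrightarrow> approximable \<epsilon> r a)"

end

theory Submission
  imports Defs
begin

text \<open>
  Write \<open>M\<^sub>1\<close> for the unit ball of \<open>M\<close>; it is sequentially compact for the weak operator topology.
  Call \<open>M\<close> compact if weakly null sequences in \<open>M\<^sub>1\<close> are strongly null.

  \<^item> \<open>M\<close> is compact. Baire's theorem, applied to the cover of \<open>M\<^sub>1\<close> by the weakly closed sets of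
    \<open>\<epsilon>\<close>-\<open>n\<close>-quasi-local operators, shows that for projections \<open>e\<close> (with \<open>e\<close> or \<open>1 - e\<close> in \<open>M\<close>)
    that are small in the strong topology the unit ball of \<open>e M e\<close> is uniformly \<open>2\<epsilon>\<close>-quasi-local. No unitary orbit of a
    vector under \<open>1 + e M e\<close> can then escape to infinity, and this forces \<open>e M e\<close> to be compact.
    If \<open>M\<close> were not compact, there would be a minimal projection with non-compact corner;
    but such a projection could be split further, because a corner without proper subprojections is
    \<open>\<complex> e\<close> or \<open>0\<close>.

  \<^item> The unitaries of the form \<open>1 + m\<close> with \<open>m\<close> in \<open>M\<close> are then a weakly compact group.
    Baire's theorem gives uniform quasi-locality (approximability) near one unitary, translation
    carries it to a neighbourhood of any other, and compactness makes it global. Finally every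
    contraction is a combination of four unitaries.
\<close>

section \<open>Weak and strong operator convergence of sequences\<close>

text \<open>The obstacle is that multiplication is only separately continuous for the weak operator
  topology. A weak limit of unitaries need not be unitary, so the unitary group of a general weakly
  closed algebra is not weakly compact, and Baire's theorem on the unit ball alone gives uniformity
  near one point with no group to spread it. Hence compactness of \<open>M\<close> must come first.
  This is where finiteness of balls enters: a uniformly quasi-local unitary keeps most of a vector
  near its support, on a finite set of points, and compression to a finite set turns weak into norm
  convergence. Sequences suffice throughout because \<open>X\<close> is countable, so that countably
  many matrix entries describe weak convergence on bounded sets of operators. The abstract part
  lives on a real inner product space, with an operator \<open>J\<close> for multiplication by the
  imaginary unit and without completeness; square roots and range projections are therefore obtained
  as limits of explicit iterations through weak compactness, not from a functional calculus.\<close>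

definition wconv :: "(nat \<Rightarrow> 'h::real_inner \<Rightarrow>\<^sub>L 'h) \<Rightarrow> ('h \<Rightarrow>\<^sub>L 'h) \<Rightarrow> bool" where
  "wconv s a \<longleftrightarrow> (\<forall>x y. (\<lambda>n. inner (s n x) y) \<longlonglongrightarrow> inner (a x) y)"

definition sconv :: "(nat \<Rightarrow> 'h::real_inner \<Rightarrow>\<^sub>L 'h) \<Rightarrow> ('h \<Rightarrow>\<^sub>L 'h) \<Rightarrow> bool" where
  "sconv s a \<longleftrightarrow> (\<forall>x. (\<lambda>n. s n x) \<longlonglongrightarrow> a x)"

text \<open>A relation and not an operation: the space is not assumed complete, so an adjoint need
  not exist. Algebras provide one through the axiom \<open>adjoint_mem\<close>.\<close>

definition adjoint_pair :: "('h::real_inner \<Rightarrow>\<^sub>L 'h) \<Rightarrow> ('h \<Rightarrow>\<^sub>L 'h) \<Rightarrow> bool" where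
  "adjoint_pair a b \<longleftrightarrow> (\<forall>x y. inner (a x) y = inner x (b y))"

abbreviation self_adjoint :: "('h::real_inner \<Rightarrow>\<^sub>L 'h) \<Rightarrow> bool" where
  "self_adjoint a \<equiv> adjoint_pair a a"

definition positive_op :: "('h::real_inner \<Rightarrow>\<^sub>L 'h) \<Rightarrow> bool" where
  "positive_op a \<longleftrightarrow> self_adjoint a \<and> (\<forall>x. 0 \<le> inner (a x) x)"

definition projection :: "('h::real_inner \<Rightarrow>\<^sub>L 'h) \<Rightarrow> bool" where
  "projection e \<longleftrightarrow> self_adjoint e \<and> e o\<^sub>L e = e"

lemmas op_simps = blinfun.add_left blinfun.add_right blinfun.diff_left blinfun.diff_right blinfun.minus_left
  blinfun.minus_right blinfun.scaleR_left blinfun.scaleR_right inner_add_left inner_add_right inner_diff_left inner_diff_right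

section \<open>Adjoints as a relation\<close>

lemma adjoint_pairD: "adjoint_pair a b \<Longrightarrow> inner (a x) y = inner x (b y)"
  by (simp add: adjoint_pair_def)

lemma adjoint_pair_sym: "adjoint_pair a b \<Longrightarrow> adjoint_pair b a"
  by (metis adjoint_pair_def inner_commute)

lemma adjoint_pair_compose:
  "adjoint_pair a a' \<Longrightarrow> adjoint_pair b b' \<Longrightarrow> adjoint_pair (a o\<^sub>L b) (b' o\<^sub>L a')"
  by (simp add: adjoint_pair_def)

lemma adjoint_pair_add:
  "adjoint_pair a a' \<Longrightarrow> adjoint_pair b b' \<Longrightarrow> adjoint_pair (a + b) (a' + b')"
  by (simp add: adjoint_pair_def op_simps)

lemma adjoint_pair_diff:
  "adjoint_pair a a' \<Longrightarrow> adjoint_pair b b' \<Longrightarrow> adjoint_pair (a - b) (a' - b')"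
  by (simp add: adjoint_pair_def op_simps)

lemma adjoint_pair_scaleR:
  "adjoint_pair a a' \<Longrightarrow> adjoint_pair (r *\<^sub>R a) (r *\<^sub>R a')"
  by (simp add: adjoint_pair_def op_simps)

lemma adjoint_pair_id: "self_adjoint id_blinfun"
  by (simp add: adjoint_pair_def)

lemma adjoint_pair_zero: "self_adjoint 0"
  by (simp add: adjoint_pair_def op_simps)

lemma eqI_inner:
  fixes x y :: "'h::real_inner"
  assumes "\<And>z. inner x z = inner y z"
  shows "x = y"
  by (metis assms inner_commute vector_eq_rdot)

lemma adjoint_pair_unique: "adjoint_pair a b \<Longrightarrow> adjoint_pair a c \<Longrightarrow> b = c"
  by (rule blinfun_eqI, rule eqI_inner) (metis adjoint_pairD adjoint_pair_sym)

lemma adjoint_pair_norm_le: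
  assumes "adjoint_pair a b"
  shows "norm b \<le> norm a"
proof (rule norm_blinfun_bound)
  fix x
  have "norm (b x) * norm (b x) = inner (a (b x)) x"
    using adjoint_pairD[OF assms, of "b x" x] by (simp add: dot_square_norm power2_eq_square)
  also have "\<dots> \<le> norm (a (b x)) * norm x" by (rule norm_cauchy_schwarz)
  also have "\<dots> \<le> (norm a * norm (b x)) * norm x"
    by (intro mult_right_mono norm_blinfun) auto
  finally have "norm (b x) * norm (b x) \<le> norm (b x) * (norm a * norm x)" by (simp add: mult_ac)
  then show "norm (b x) \<le> norm a * norm x"
    by (cases "norm (b x) = 0") auto
qed auto

lemma contraction_le: "norm (a :: 'h::real_normed_vector \<Rightarrow>\<^sub>L 'h) \<le> 1 \<Longrightarrow> norm (a x) \<le> norm x"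
  using norm_blinfun[of a x] mult_right_mono[of "norm a" 1 "norm x"] by simp

lemma norm_compose_le_1:
  fixes a b :: "'h::real_normed_vector \<Rightarrow>\<^sub>L 'h"
  assumes "norm a \<le> 1" "norm b \<le> 1"
  shows "norm (a o\<^sub>L b) \<le> 1"
  using norm_blinfun_compose[of a b] mult_mono[of "norm a" 1 "norm b" 1] assms by simp

section \<open>Calculus of weak operator convergence\<close>

lemma wconvD: "wconv s a \<Longrightarrow> (\<lambda>n. inner (s n x) y) \<longlonglongrightarrow> inner (a x) y"
  by (simp add: wconv_def)

lemma wconvD': "wconv s a \<Longrightarrow> (\<lambda>n. inner x (s n y)) \<longlonglongrightarrow> inner x (a y)"
  by (subst (1 2) inner_commute) (rule wconvD)

lemma wconv_const: "wconv (\<lambda>n. a) a"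
  by (simp add: wconv_def)

lemma wconv_add: "wconv s a \<Longrightarrow> wconv t b \<Longrightarrow> wconv (\<lambda>n. s n + t n) (a + b)"
  by (auto simp: wconv_def op_simps intro!: tendsto_add)

lemma wconv_diff: "wconv s a \<Longrightarrow> wconv t b \<Longrightarrow> wconv (\<lambda>n. s n - t n) (a - b)"
  by (auto simp: wconv_def op_simps intro!: tendsto_diff)

lemma wconv_scaleR: "wconv s a \<Longrightarrow> wconv (\<lambda>n. r *\<^sub>R s n) (r *\<^sub>R a)"
  by (auto simp: wconv_def op_simps intro!: tendsto_mult)

lemma wconv_compose_right: "wconv s a \<Longrightarrow> wconv (\<lambda>n. s n o\<^sub>L b) (a o\<^sub>L b)"
  by (simp add: wconv_def)

lemma wconv_compose_left:
  "adjoint_pair c c' \<Longrightarrow> wconv s a \<Longrightarrow> wconv (\<lambda>n. c o\<^sub>L s n) (c o\<^sub>L a)"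
  by (simp add: wconv_def adjoint_pair_def)

lemma wconv_subseq: "wconv s a \<Longrightarrow> strict_mono \<phi> \<Longrightarrow> wconv (\<lambda>n. s (\<phi> n)) a"
  unfolding wconv_def using LIMSEQ_subseq_LIMSEQ by (fastforce simp: comp_def)

lemma wconv_unique: "wconv s a \<Longrightarrow> wconv s b \<Longrightarrow> a = b"
  by (rule blinfun_eqI, rule eqI_inner) (blast intro: LIMSEQ_unique dest: wconvD)

text \<open>Lower semicontinuity of the norm: the coefficient of \<open>s n x\<close> against
  \<open>a x\<close> tends to the squared norm of \<open>a x\<close>.\<close>

lemma wconv_norm_le:
  assumes "wconv s a" "\<And>n. norm (s n) \<le> C"
  shows "norm a \<le> C"
proof (rule norm_blinfun_bound)
  show "0 \<le> C" using assms(2)[of 0] norm_ge_zero order_trans by blast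
  fix x
  have "inner (a x) (a x) \<le> C * norm x * norm (a x)"
  proof (rule LIMSEQ_le_const2[OF wconvD[OF assms(1)]], intro exI allI impI)
    fix n
    have "inner (s n x) (a x) \<le> norm (s n x) * norm (a x)" by (rule norm_cauchy_schwarz)
    also have "\<dots> \<le> (norm (s n) * norm x) * norm (a x)"
      by (intro mult_right_mono norm_blinfun) auto
    also have "\<dots> \<le> C * norm x * norm (a x)"
      by (intro mult_right_mono assms) auto
    finally show "inner (s n x) (a x) \<le> C * norm x * norm (a x)" .
  qed
  then have "norm (a x) * norm (a x) \<le> C * norm x * norm (a x)"
    by (simp add: dot_square_norm power2_eq_square)
  then show "norm (a x) \<le> C * norm x"
    using \<open>0 \<le> C\<close> by (cases "norm (a x) = 0") auto
qed

text \<open>Taking adjoints is weakly, though in general not strongly, continuous; weak limits of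
  unitaries thus come with weak limits of their inverses.\<close>

lemma wconv_adjoint:
  assumes "wconv s a" "\<And>n. adjoint_pair (s n) (t n)" "adjoint_pair a b"
  shows "wconv t b"
  unfolding wconv_def
proof (intro allI)
  fix x y
  have "(\<lambda>n. inner x (s n y)) \<longlonglongrightarrow> inner x (a y)" by (rule wconvD'[OF assms(1)])
  then show "(\<lambda>n. inner (t n x) y) \<longlonglongrightarrow> inner (b x) y"
    using adjoint_pairD[OF adjoint_pair_sym[OF assms(2)]]
      adjoint_pairD[OF adjoint_pair_sym[OF assms(3)]] by simp
qed

lemma wconv_self_adjoint:
  assumes "wconv s a" "\<And>n. self_adjoint (s n)"
  shows "self_adjoint a"
  unfolding adjoint_pair_def
proof (intro allI)
  fix x y
  have "(\<lambda>n. inner (s n x) y) \<longlonglongrightarrow> inner x (a y)"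
    using wconvD'[OF assms(1), of x y] adjoint_pairD[OF assms(2)] by simp
  then show "inner (a x) y = inner x (a y)"
    using wconvD[OF assms(1)] LIMSEQ_unique by blast
qed

lemma wconv_positive:
  assumes "wconv s a" "\<And>n. positive_op (s n)"
  shows "positive_op a"
  unfolding positive_op_def
proof (intro conjI allI)
  show "self_adjoint a" using wconv_self_adjoint assms unfolding positive_op_def by blast
  show "0 \<le> inner (a x) x" for x
    by (rule LIMSEQ_le_const[OF wconvD[OF assms(1)]]) (use assms(2) positive_op_def in blast)
qed

section \<open>Calculus of strong operator convergence\<close>

lemma sconvD: "sconv s a \<Longrightarrow> (\<lambda>n. s n x) \<longlonglongrightarrow> a x"
  by (simp add: sconv_def)

lemma sconv_imp_wconv: "sconv s a \<Longrightarrow> wconv s a"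
  by (auto simp: wconv_def sconv_def intro!: tendsto_inner)

lemma sconv_const: "sconv (\<lambda>n. a) a"
  by (simp add: sconv_def)

lemma sconv_add: "sconv s a \<Longrightarrow> sconv t b \<Longrightarrow> sconv (\<lambda>n. s n + t n) (a + b)"
  by (auto simp: sconv_def op_simps intro!: tendsto_add)

lemma sconv_diff: "sconv s a \<Longrightarrow> sconv t b \<Longrightarrow> sconv (\<lambda>n. s n - t n) (a - b)"
  by (auto simp: sconv_def op_simps intro!: tendsto_diff)

lemma sconv_scaleR: "sconv s a \<Longrightarrow> sconv (\<lambda>n. r *\<^sub>R s n) (r *\<^sub>R a)"
  by (auto simp: sconv_def op_simps intro!: tendsto_scaleR)

lemma sconv_compose_left: "sconv s a \<Longrightarrow> sconv (\<lambda>n. c o\<^sub>L s n) (c o\<^sub>L a)"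
  by (auto simp: sconv_def intro!: bounded_linear.tendsto[OF blinfun.bounded_linear_right])

lemma sconv_subseq: "sconv s a \<Longrightarrow> strict_mono \<phi> \<Longrightarrow> sconv (\<lambda>n. s (\<phi> n)) a"
  unfolding sconv_def using LIMSEQ_subseq_LIMSEQ by (fastforce simp: comp_def)

lemma bounded_apply_tendsto_0:
  fixes s :: "nat \<Rightarrow> 'h::real_normed_vector \<Rightarrow>\<^sub>L 'h"
  assumes "\<And>n. norm (s n) \<le> C" "x \<longlonglongrightarrow> 0"
  shows "(\<lambda>n. s n (x n)) \<longlonglongrightarrow> 0"
proof (rule Lim_null_comparison)
  show "(\<lambda>n. C * norm (x n)) \<longlonglongrightarrow> 0"
    using tendsto_mult_right_zero[OF tendsto_norm_zero[OF assms(2)]] by simp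
  show "\<forall>\<^sub>F n in sequentially. norm (s n (x n)) \<le> C * norm (x n)"
    by (rule always_eventually)
      (metis assms(1) mult_right_mono norm_blinfun norm_ge_zero order_trans)
qed

text \<open>Split \<open>t n x\<close> at its limit \<open>b x\<close>; the uniform bound on
  \<open>s n\<close> controls the error. This joint continuity is what weak convergence
  lacks.\<close>

lemma sconv_compose:
  assumes "sconv s a" "sconv t b" "\<And>n. norm (s n) \<le> C"
  shows "sconv (\<lambda>n. s n o\<^sub>L t n) (a o\<^sub>L b)"
  unfolding sconv_def
proof
  fix x
  have "(\<lambda>n. t n x - b x) \<longlonglongrightarrow> 0" using sconvD[OF assms(2), of x] LIM_zero by blast
  then have "(\<lambda>n. s n (t n x - b x) + s n (b x)) \<longlonglongrightarrow> 0 + a (b x)"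
    by (intro tendsto_add bounded_apply_tendsto_0[OF assms(3)] sconvD[OF assms(1)])
  then show "(\<lambda>n. (s n o\<^sub>L t n) x) \<longlonglongrightarrow> (a o\<^sub>L b) x"
    by (simp add: op_simps)
qed

text \<open>Weak convergence without loss of norm is strong: in the expanded square, the norms of
  \<open>s n x\<close> and \<open>a x\<close> are at most that of \<open>x\<close>, and the cross
  term tends to the squared norm of \<open>a x\<close>.\<close>

lemma wconv_isometry_imp_sconv:
  assumes "wconv s a" "\<And>n. norm (s n) \<le> 1" "\<And>x. norm (a x) = norm x"
  shows "sconv s a"
  unfolding sconv_def
proof
  fix x
  have "(\<lambda>n. (norm (s n x - a x))\<^sup>2) \<longlonglongrightarrow> 0"
  proof (rule tendsto_sandwich[OF _ _ tendsto_const])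
    show "\<forall>\<^sub>F n in sequentially. 0 \<le> (norm (s n x - a x))\<^sup>2" by simp
    show "\<forall>\<^sub>F n in sequentially. (norm (s n x - a x))\<^sup>2 \<le> 2 * (norm x)\<^sup>2 - 2 * inner (s n x) (a x)"
    proof (rule always_eventually, rule allI)
      fix n
      have "(norm (s n x))\<^sup>2 \<le> (norm x)\<^sup>2" by (intro power_mono contraction_le assms) auto
      moreover have "(norm (s n x - a x))\<^sup>2 = (norm (s n x))\<^sup>2 + (norm (a x))\<^sup>2 - 2 * inner (s n x) (a x)"
        by (simp add: power2_norm_eq_inner inner_simps inner_commute)
      ultimately show "(norm (s n x - a x))\<^sup>2 \<le> 2 * (norm x)\<^sup>2 - 2 * inner (s n x) (a x)"
        using assms(3)[of x] by simp
    qed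
    have "(\<lambda>n. 2 * (norm x)\<^sup>2 - 2 * inner (s n x) (a x)) \<longlonglongrightarrow> 2 * (norm x)\<^sup>2 - 2 * inner (a x) (a x)"
      by (intro tendsto_diff tendsto_mult tendsto_const wconvD assms)
    then show "(\<lambda>n. 2 * (norm x)\<^sup>2 - 2 * inner (s n x) (a x)) \<longlonglongrightarrow> 0"
      by (simp add: dot_square_norm assms(3))
  qed
  then have "(\<lambda>n. norm (s n x - a x)) \<longlonglongrightarrow> 0" by simp
  then show "(\<lambda>n. s n x) \<longlonglongrightarrow> a x" using LIM_zero_cancel tendsto_norm_zero_iff by blast
qed

section \<open>Positive operators and projections\<close>

lemma positive_op_add: "positive_op a \<Longrightarrow> positive_op b \<Longrightarrow> positive_op (a + b)"
  by (simp add: positive_op_def adjoint_pair_add op_simps)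

lemma positive_op_scaleR: "positive_op a \<Longrightarrow> 0 \<le> r \<Longrightarrow> positive_op (r *\<^sub>R a)"
  by (simp add: positive_op_def adjoint_pair_scaleR op_simps)

lemma positive_op_square:
  "adjoint_pair a b \<Longrightarrow> positive_op (b o\<^sub>L a)"
  unfolding positive_op_def
  by (metis adjoint_pairD adjoint_pair_compose adjoint_pair_sym blinfun_apply_blinfun_compose
      inner_ge_zero)

text \<open>The operator inequality c^2 \<le> C c, without a square root: evaluate the form of
  \<open>c\<close> at C x - c x.\<close>

lemma positive_op_norm_square_le:
  assumes "positive_op c" "norm c \<le> C"
  shows "(norm (c x))\<^sup>2 \<le> C * inner (c x) x"
proof (cases "C = 0")
  case True
  then show ?thesis using assms(2) by (simp add: op_simps)
next
  case False
  then have C: "C > 0" using assms(2) norm_ge_zero[of c] by linarith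
  have sa: "inner (c y) z = inner y (c z)" for y z
    using assms(1) by (simp add: positive_op_def adjoint_pairD)
  have "0 \<le> inner (c (C *\<^sub>R x - c x)) (C *\<^sub>R x - c x)"
    using assms(1) by (simp add: positive_op_def)
  also have "\<dots> = C * C * inner (c x) x - 2 * C * (norm (c x))\<^sup>2 + inner (c (c x)) (c x)"
    using sa[of "c x" x] by (simp add: op_simps power2_norm_eq_inner algebra_simps inner_commute)
  also have "inner (c (c x)) (c x) \<le> norm (c (c x)) * norm (c x)" by (rule norm_cauchy_schwarz)
  also have "\<dots> \<le> (C * norm (c x)) * norm (c x)"
    by (intro mult_right_mono order_trans[OF norm_blinfun] assms) auto
  finally have "0 \<le> C * (C * inner (c x) x - (norm (c x))\<^sup>2)"
    by (simp add: power2_eq_square algebra_simps)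
  then show ?thesis using C by (simp add: zero_le_mult_iff)
qed

lemma positive_op_eq_0:
  "positive_op c \<Longrightarrow> inner (c x) x = 0 \<Longrightarrow> c x = 0"
  using positive_op_norm_square_le[of c "norm c" x] by simp

lemma self_adjoint_eq_0:
  assumes "self_adjoint c" "\<And>x. inner (c x) x = 0"
  shows "c = 0"
  by (intro blinfun_eqI) (use assms positive_op_eq_0 in \<open>force simp: positive_op_def\<close>)

lemma projectionD:
  assumes "projection e"
  shows "self_adjoint e" "e o\<^sub>L e = e" "e (e x) = e x"
  using assms unfolding projection_def by (auto simp flip: blinfun_apply_blinfun_compose)

lemma projection_norm_square: "projection e \<Longrightarrow> (norm (e x))\<^sup>2 = inner (e x) x"
  by (metis projectionD(1,3) adjoint_pairD power2_norm_eq_inner)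

lemma projection_norm_le: "projection e \<Longrightarrow> norm e \<le> 1"
proof (rule norm_blinfun_bound)
  fix x assume e: "projection e"
  have "norm (e x) * norm (e x) \<le> norm (e x) * norm x"
    using projection_norm_square[OF e, of x] norm_cauchy_schwarz[of "e x" x]
    by (simp add: power2_eq_square)
  then show "norm (e x) \<le> 1 * norm x" by (cases "norm (e x) = 0") auto
qed auto

lemma projection_id: "projection id_blinfun"
  by (auto simp: projection_def adjoint_pair_id intro!: blinfun_eqI)

lemma projection_compl:
  assumes "projection e"
  shows "projection (id_blinfun - e)"
  unfolding projection_def
proof
  show "self_adjoint (id_blinfun - e)"
    by (intro adjoint_pair_diff adjoint_pair_id projectionD(1) assms)
  show "(id_blinfun - e) o\<^sub>L (id_blinfun - e) = id_blinfun - e"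
    by (intro blinfun_eqI) (simp add: op_simps projectionD(3)[OF assms])
qed

lemma projection_diff:
  assumes "projection e" "projection f" "e o\<^sub>L f = f"
  shows "projection (e - f)" "f o\<^sub>L e = f"
proof -
  have "adjoint_pair (e o\<^sub>L f) (f o\<^sub>L e)"
    by (intro adjoint_pair_compose projectionD(1) assms)
  then show fe: "f o\<^sub>L e = f"
    using projectionD(1)[OF assms(2)] adjoint_pair_unique unfolding assms(3) by blast
  have "(e - f) ((e - f) x) = (e - f) x" for x
    using arg_cong[OF fe, of "\<lambda>a. a x"] arg_cong[OF assms(3), of "\<lambda>a. a x"]
    by (simp add: op_simps projectionD(3)[OF assms(1)] projectionD(3)[OF assms(2)])
  then have "(e - f) o\<^sub>L (e - f) = e - f" by (intro blinfun_eqI) simp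
  then show "projection (e - f)"
    unfolding projection_def by (intro conjI adjoint_pair_diff projectionD(1) assms)
qed

section \<open>Algebras with weakly sequentially compact balls\<close>

text \<open>\<open>J\<close> plays multiplication by the imaginary unit, so real scalars and
  \<open>J\<close> together give complex scalars. Weak closedness is replaced by sequential
  compactness of balls, a form that passes to corners. No unit is assumed; unital constructions take
  place in 1 + N.\<close>

locale vn_algebra =
  fixes N :: "('h::real_inner \<Rightarrow>\<^sub>L 'h) set" and J :: "'h \<Rightarrow>\<^sub>L 'h"
  assumes zero_mem: "0 \<in> N"
    and add_mem: "a \<in> N \<Longrightarrow> b \<in> N \<Longrightarrow> a + b \<in> N"
    and scaleR_mem: "a \<in> N \<Longrightarrow> r *\<^sub>R a \<in> N"
    and compose_mem: "a \<in> N \<Longrightarrow> b \<in> N \<Longrightarrow> a o\<^sub>L b \<in> N"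
    and J_mem: "a \<in> N \<Longrightarrow> J o\<^sub>L a \<in> N"
    and J_commute: "a \<in> N \<Longrightarrow> a (J x) = J (a x)"
    and J_square: "J (J x) = - x"
    and J_skew: "adjoint_pair J (- J)"
    and adjoint_mem: "a \<in> N \<Longrightarrow> \<exists>b\<in>N. adjoint_pair a b"
    and compactness: "(\<And>n. s n \<in> N) \<Longrightarrow> (\<And>n. norm (s n) \<le> C) \<Longrightarrow>
      \<exists>\<phi> a. strict_mono (\<phi> :: nat \<Rightarrow> nat) \<and> a \<in> N \<and> wconv (\<lambda>n. s (\<phi> n)) a"

text \<open>Together with \<open>compactness\<close> this makes the unit ball sequentially compact
  in the strong operator topology. The algebra of all operators on an infinite-dimensional Hilbert
  space violates it: partial isometries taking a fixed unit vector to the members of an orthonormal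
  sequence are weakly but not strongly null.\<close>

definition sot_compact :: "('h::real_inner \<Rightarrow>\<^sub>L 'h) set \<Rightarrow> bool" where
  "sot_compact N \<longleftrightarrow>
    (\<forall>c. (\<forall>n. c n \<in> N) \<longrightarrow> (\<forall>n. norm (c n) \<le> 1) \<longrightarrow> wconv c 0 \<longrightarrow> sconv c 0)"

lemma sot_compactD:
  fixes C :: real
  assumes "sot_compact N" "\<And>r a. a \<in> N \<Longrightarrow> r *\<^sub>R a \<in> N"
    and "\<And>n. c n \<in> N" "\<And>n. norm (c n) \<le> C" "wconv c 0"
  shows "sconv c 0"
proof -
  define D where "D = max C 1"
  have D: "D > 0" "C \<le> D" by (auto simp: D_def)
  have "sconv (\<lambda>n. (1 / D) *\<^sub>R c n) 0"
    using assms(1)[unfolded sot_compact_def, rule_format, of "\<lambda>n. (1 / D) *\<^sub>R c n"]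
      wconv_scaleR[OF assms(5), of "1 / D"] assms(2,3) assms(4) D order_trans
    by (fastforce simp: divide_simps)
  from sconv_scaleR[OF this, of D] show ?thesis using D by simp
qed

context vn_algebra
begin

lemma uminus_mem: "a \<in> N \<Longrightarrow> - a \<in> N"
  using scaleR_mem[of a "-1"] by simp

lemma diff_mem: "a \<in> N \<Longrightarrow> b \<in> N \<Longrightarrow> a - b \<in> N"
  using add_mem[OF _ uminus_mem] by fastforce

lemma norm_J: "norm (J x) = norm x"
  using adjoint_pairD[OF J_skew, of x "J x"] by (simp add: norm_eq_sqrt_inner op_simps J_square)

lemma wconv_mem:
  assumes "\<And>n. s n \<in> N" "\<And>n. norm (s n) \<le> C" "wconv s a"
  shows "a \<in> N"
  using compactness[of s C] assms wconv_unique wconv_subseq by metis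

lemma sot_compact_sconv:
  assumes "sot_compact N" "\<And>n. s n \<in> N" "\<And>n. norm (s n) \<le> C" "wconv s a"
  shows "sconv s a"
proof -
  have a: "a \<in> N" by (rule wconv_mem[OF assms(2-4)])
  have "sconv (\<lambda>n. s n - a) 0"
  proof (rule sot_compactD[OF assms(1) scaleR_mem])
    show "s n - a \<in> N" for n by (intro diff_mem assms a)
    show "norm (s n - a) \<le> C + norm a" for n
      using norm_triangle_ineq4[of "s n" a] assms(3)[of n] by linarith
    show "wconv (\<lambda>n. s n - a) 0" using wconv_diff[OF assms(4) wconv_const[of a]] by simp
  qed auto
  from sconv_add[OF this sconv_const[of a]] show ?thesis by simp
qed

end

section \<open>Powers and square roots\<close>

primrec op_power :: "('h::real_normed_vector \<Rightarrow>\<^sub>L 'h) \<Rightarrow> nat \<Rightarrow> 'h \<Rightarrow>\<^sub>L 'h" where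
  "op_power a 0 = id_blinfun"
| "op_power a (Suc k) = a o\<^sub>L op_power a k"

lemma op_power_add: "op_power a (j + k) x = op_power a j (op_power a k x)"
  by (induction j) auto

lemma op_power_norm_le: "norm a \<le> 1 \<Longrightarrow> norm (op_power a k) \<le> 1"
  by (induction k) (auto simp: norm_blinfun_id_le norm_compose_le_1)

lemma op_power_self_adjoint:
  assumes "self_adjoint a"
  shows "self_adjoint (op_power a k)"
proof (induction k)
  case (Suc k)
  have "op_power a k (a x) = a (op_power a k x)" for x
    using op_power_add[of a 1 k x] op_power_add[of a k 1 x] by (simp add: add.commute)
  then show ?case
    using adjoint_pairD[OF assms] adjoint_pairD[OF Suc] by (simp add: adjoint_pair_def)
qed (simp add: adjoint_pair_id)

lemma op_power_commute:
  fixes z a :: "'h::real_normed_vector \<Rightarrow>\<^sub>L 'h"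
  shows "(\<And>x. z (a x) = a (z x)) \<Longrightarrow> z (op_power a k x) = op_power a k (z x)"
  by (induction k) auto

text \<open>Halve the exponent: the form at \<open>x\<close> becomes the form of the identity or of
  \<open>a\<close> at the vector obtained from \<open>x\<close> by the power k div 2.\<close>

lemma op_power_positive:
  assumes "positive_op a"
  shows "positive_op (op_power a k)"
  unfolding positive_op_def
proof (intro conjI allI)
  have sa: "self_adjoint a" using assms by (simp add: positive_op_def)
  show "self_adjoint (op_power a k)" by (rule op_power_self_adjoint[OF sa])
  fix x
  define j where "j = k div 2"
  have sj: "inner (op_power a j y) z = inner y (op_power a j z)" for y z
    using op_power_self_adjoint[OF sa] by (simp add: adjoint_pairD)
  show "0 \<le> inner (op_power a k x) x"
  proof (cases "even k")
    case True
    then have "k = j + j" by (auto simp: j_def)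
    then show ?thesis
      using inner_ge_zero[of "op_power a j x"] by (simp only: op_power_add sj)
  next
    case False
    then have "k = j + Suc j" by (auto simp: j_def elim!: oddE)
    then show ?thesis using assms by (simp add: op_power_add sj positive_op_def del: add_Suc_right)
  qed
qed

text \<open>Membership in this cone certifies that an operator commutes with the commutant of \<open>x\<close>
  and, if \<open>x\<close> is positive, that it is positive; products of such operators are
  then positive without any appeal to square roots.\<close>

inductive_set nonneg_polys :: "('h::real_normed_vector \<Rightarrow>\<^sub>L 'h) \<Rightarrow> ('h \<Rightarrow>\<^sub>L 'h) set"
  for x where
  zero: "0 \<in> nonneg_polys x"
| power: "op_power x (Suc k) \<in> nonneg_polys x"
| add: "a \<in> nonneg_polys x \<Longrightarrow> b \<in> nonneg_polys x \<Longrightarrow> a + b \<in> nonneg_polys x"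
| scale: "a \<in> nonneg_polys x \<Longrightarrow> 0 \<le> r \<Longrightarrow> r *\<^sub>R a \<in> nonneg_polys x"

lemma nonneg_polys_compose:
  assumes "a \<in> nonneg_polys x" "b \<in> nonneg_polys x"
  shows "a o\<^sub>L b \<in> nonneg_polys x"
  using assms(1)
proof induction
  case (power k)
  show ?case using assms(2)
  proof induction
    case (power j)
    have "op_power x (Suc k) o\<^sub>L op_power x (Suc j) = op_power x (Suc (k + Suc j))"
      by (intro blinfun_eqI) (simp add: op_power_add del: add_Suc_right)
    then show ?case using nonneg_polys.power by metis
  next
    case (add a b)
    then show ?case
      by (simp add: bounded_bilinear.add_right[OF bounded_bilinear_blinfun_compose] nonneg_polys.add)
  next
    case (scale a r)
    then show ?case
      by (simp add: bounded_bilinear.scaleR_right[OF bounded_bilinear_blinfun_compose] nonneg_polys.scale)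
  qed (simp add: nonneg_polys.zero)
next
  case (add a b)
  then show ?case
    by (simp add: bounded_bilinear.add_left[OF bounded_bilinear_blinfun_compose] nonneg_polys.add)
next
  case (scale a r)
  then show ?case
    by (simp add: bounded_bilinear.scaleR_left[OF bounded_bilinear_blinfun_compose] nonneg_polys.scale)
qed (simp add: nonneg_polys.zero)

lemma nonneg_polys_commute:
  fixes z x :: "'h::real_normed_vector \<Rightarrow>\<^sub>L 'h"
  assumes "a \<in> nonneg_polys x" "\<And>y. z (x y) = x (z y)"
  shows "z (a y) = a (z y)"
  using assms(1)
proof (induction arbitrary: y)
  case (power k)
  show ?case using op_power_commute[of z x, OF assms(2)] .
qed (auto simp: op_simps)

lemma nonneg_polys_positive:
  "a \<in> nonneg_polys x \<Longrightarrow> positive_op x \<Longrightarrow> positive_op a"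
  by (induction rule: nonneg_polys.induct)
    (simp_all add: positive_op_add positive_op_scaleR op_power_positive del: op_power.simps,
      simp add: positive_op_def adjoint_pair_zero)

text \<open>A fixed point satisfies (1 - y)^2 = 1 - x. Iterating for \<open>y\<close> and not for
  the root itself avoids constant terms, so the sequence stays inside a non-unital algebra.\<close>

primrec sqrt_seq :: "('h::real_normed_vector \<Rightarrow>\<^sub>L 'h) \<Rightarrow> nat \<Rightarrow> 'h \<Rightarrow>\<^sub>L 'h" where
  "sqrt_seq x 0 = 0"
| "sqrt_seq x (Suc n) = (1/2) *\<^sub>R (x + (sqrt_seq x n o\<^sub>L sqrt_seq x n))"

lemma nonneg_polys_self: "x \<in> nonneg_polys x"
  using nonneg_polys.power[of x 0] by (metis blinfun_apply_blinfun_compose blinfun_apply_id_blinfun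
      blinfun_eqI op_power.simps)

lemma sqrt_seq_nonneg_polys: "sqrt_seq x n \<in> nonneg_polys x"
  by (induction n) (auto intro!: nonneg_polys.intros(1,3,4) nonneg_polys_compose nonneg_polys_self)

text \<open>A difference of squares factors because the terms commute with one another, and both
  factors lie in the cone, which is closed under products.\<close>

lemma sqrt_seq_Suc_diff: "sqrt_seq x (Suc n) - sqrt_seq x n \<in> nonneg_polys x"
proof (induction n)
  case 0
  then show ?case using nonneg_polys.scale[OF nonneg_polys_self[of x], of "1/2"] by simp
next
  case (Suc n)
  define p where "p = sqrt_seq x (Suc n)"
  define q where "q = sqrt_seq x n"
  have pq: "p (q y) = q (p y)" for y
  proof -
    have "p (x y) = x (p y)" for y
      using nonneg_polys_commute[of p x x] sqrt_seq_nonneg_polys p_def by metis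
    then show ?thesis using nonneg_polys_commute[of q x p] sqrt_seq_nonneg_polys q_def by metis
  qed
  have "sqrt_seq x (Suc (Suc n)) - sqrt_seq x (Suc n) = (1/2) *\<^sub>R (p o\<^sub>L p) - (1/2) *\<^sub>R (q o\<^sub>L q)"
    unfolding p_def[symmetric] sqrt_seq.simps(2)[of x "Suc n"]
    by (simp add: p_def q_def algebra_simps)
  also have "\<dots> = (1/2) *\<^sub>R ((p - q) o\<^sub>L (p + q))"
    by (intro blinfun_eqI) (simp add: op_simps pq algebra_simps)
  also have "\<dots> \<in> nonneg_polys x"
    using Suc by (intro nonneg_polys.scale nonneg_polys_compose nonneg_polys.add)
      (auto simp: p_def q_def sqrt_seq_nonneg_polys simp del: sqrt_seq.simps)
  finally show ?case .
qed

lemma sqrt_seq_diff: "m \<le> n \<Longrightarrow> sqrt_seq x n - sqrt_seq x m \<in> nonneg_polys x"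
proof (induction n rule: dec_induct)
  case (step n)
  from nonneg_polys.add[OF step.IH sqrt_seq_Suc_diff[of x n]] show ?case
    by (simp del: sqrt_seq.simps)
qed (simp add: nonneg_polys.zero)

lemma sqrt_seq_norm_le: "norm x \<le> 1 \<Longrightarrow> norm (sqrt_seq x n) \<le> 1"
proof (induction n)
  case (Suc n)
  have "norm (x + (sqrt_seq x n o\<^sub>L sqrt_seq x n)) \<le> 1 + 1"
    using Suc by (intro order_trans[OF norm_triangle_ineq] add_mono norm_compose_le_1) auto
  then show ?case by simp
qed simp

text \<open>A positive operator \<open>c\<close> of norm at most \<open>C\<close> obeys c^2 \<le> C
  c, so convergence of quadratic forms forces strong convergence.\<close>

lemma positive_sconvI:
  fixes a :: "'h::real_inner \<Rightarrow>\<^sub>L 'h"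
  assumes "\<And>n. positive_op (a - s n)" "\<And>n. norm (a - s n) \<le> C"
    and "\<And>x. (\<lambda>n. inner ((a - s n) x) x) \<longlonglongrightarrow> 0"
  shows "sconv s a"
  unfolding sconv_def
proof
  fix x
  have "(\<lambda>n. (norm ((a - s n) x))\<^sup>2) \<longlonglongrightarrow> 0"
  proof (rule tendsto_sandwich[OF _ _ tendsto_const])
    show "\<forall>\<^sub>F n in sequentially. 0 \<le> (norm ((a - s n) x))\<^sup>2" by simp
    show "\<forall>\<^sub>F n in sequentially. (norm ((a - s n) x))\<^sup>2 \<le> C * inner ((a - s n) x) x"
      by (intro always_eventually allI positive_op_norm_square_le assms)
    show "(\<lambda>n. C * inner ((a - s n) x) x) \<longlonglongrightarrow> 0"
      using tendsto_mult_right_zero[OF assms(3)] .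
  qed
  then have "(\<lambda>n. norm (a x - s n x)) \<longlonglongrightarrow> 0" by (simp add: op_simps)
  then have "(\<lambda>n. norm (s n x - a x)) \<longlonglongrightarrow> 0" by (simp add: norm_minus_commute)
  then show "(\<lambda>n. s n x) \<longlonglongrightarrow> a x" using LIM_zero_cancel tendsto_norm_zero_iff by blast
qed

context vn_algebra
begin

lemma sqrt_seq_mem: "x \<in> N \<Longrightarrow> sqrt_seq x n \<in> N"
  by (induction n) (auto intro!: zero_mem add_mem scaleR_mem compose_mem)

text \<open>The operator \<open>1 - y\<close> is the positive square root of \<open>1 - x\<close>.\<close>

lemma sqrt_exists:
  assumes x: "x \<in> N" "positive_op x" "norm x \<le> 1"
  obtains y where "y \<in> N" "self_adjoint y" "norm y \<le> 1"
    and "y = (1/2) *\<^sub>R (x + (y o\<^sub>L y))"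
    and "\<And>(z :: 'h \<Rightarrow>\<^sub>L 'h) v. (\<And>u. z (x u) = x (z u)) \<Longrightarrow> z (y v) = y (z v)"
proof -
  let ?y = "sqrt_seq x"
  have ny: "norm (?y n) \<le> 1" for n by (rule sqrt_seq_norm_le[OF x(3)])
  obtain \<phi> y where \<phi>: "strict_mono \<phi>" and y: "y \<in> N" and lim: "wconv (\<lambda>n. ?y (\<phi> n)) y"
    using compactness[of ?y 1] sqrt_seq_mem[OF x(1)] ny by blast
  have norm_y: "norm y \<le> 1" by (rule wconv_norm_le[OF lim ny])
  \<comment> \<open>The shifted subsequence has indices at least \<open>n\<close>, so its terms
    dominate \<open>?y n\<close>; positivity passes to the weak limit.\<close>
  have pos: "positive_op (y - ?y n)" for n
  proof (rule wconv_positive)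
    have "wconv (\<lambda>m. ?y (\<phi> (m + n))) y"
      using wconv_subseq[OF lim, of "\<lambda>m. m + n"] by (simp add: strict_mono_def)
    then show "wconv (\<lambda>m. ?y (\<phi> (m + n)) - ?y n) (y - ?y n)" by (intro wconv_diff wconv_const)
    have "n \<le> \<phi> (m + n)" for m
      using seq_suble[OF \<phi>, of "m + n"] by simp
    then show "positive_op (?y (\<phi> (m + n)) - ?y n)" for m
      by (intro nonneg_polys_positive[OF sqrt_seq_diff x(2)])
  qed
  have nd: "norm (y - ?y n) \<le> 2" for n
    using norm_triangle_ineq4[of y "?y n"] norm_y ny[of n] by linarith
  have lim0: "(\<lambda>n. inner ((y - ?y (\<phi> n)) v) v) \<longlonglongrightarrow> 0" for v
    using wconvD[OF wconv_diff[OF wconv_const lim], of y v v] by (simp add: op_simps)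
  have s0: "sconv (\<lambda>n. ?y (\<phi> n)) y"
    by (rule positive_sconvI[OF pos nd lim0])
  \<comment> \<open>The recursion links consecutive terms, which the subsequence need not contain;
    monotonicity squeezes the successors to the same limit.\<close>
  have s1: "sconv (\<lambda>n. ?y (Suc (\<phi> n))) y"
  proof (rule positive_sconvI[OF pos nd])
    fix v
    show "(\<lambda>n. inner ((y - ?y (Suc (\<phi> n))) v) v) \<longlonglongrightarrow> 0"
    proof (rule tendsto_sandwich[OF _ _ tendsto_const lim0[of v]]; intro always_eventually allI)
      fix n
      show "0 \<le> inner ((y - ?y (Suc (\<phi> n))) v) v"
        using pos[of "Suc (\<phi> n)"] by (simp add: positive_op_def del: sqrt_seq.simps)
      have "positive_op (?y (Suc (\<phi> n)) - ?y (\<phi> n))"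
        by (rule nonneg_polys_positive[OF sqrt_seq_Suc_diff x(2)])
      then show "inner ((y - ?y (Suc (\<phi> n))) v) v \<le> inner ((y - ?y (\<phi> n)) v) v"
        by (simp add: positive_op_def op_simps del: sqrt_seq.simps)
    qed
  qed
  have "sconv (\<lambda>n. ?y (Suc (\<phi> n))) ((1/2) *\<^sub>R (x + (y o\<^sub>L y)))"
    unfolding sqrt_seq.simps by (intro sconv_scaleR sconv_add sconv_const sconv_compose[OF s0 s0 ny])
  then have eq: "y = (1/2) *\<^sub>R (x + (y o\<^sub>L y))"
    using wconv_unique sconv_imp_wconv s1 by blast
  have sa: "self_adjoint y"
    by (rule wconv_self_adjoint[OF lim])
      (use nonneg_polys_positive[OF sqrt_seq_nonneg_polys x(2)] positive_op_def in blast)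
  show thesis
  proof (rule that[OF y sa norm_y eq])
    fix z :: "'h \<Rightarrow>\<^sub>L 'h" and v assume z: "\<And>u. z (x u) = x (z u)"
    have "(\<lambda>n. z (?y (\<phi> n) v)) \<longlonglongrightarrow> z (y v)"
      by (intro bounded_linear.tendsto[OF blinfun.bounded_linear_right] sconvD[OF s0])
    moreover have "z (?y (\<phi> n) v) = ?y (\<phi> n) (z v)" for n
      by (rule nonneg_polys_commute[OF sqrt_seq_nonneg_polys z])
    ultimately show "z (y v) = y (z v)"
      using sconvD[OF s0, of "z v"] LIMSEQ_unique by auto
  qed
qed

end

text \<open>\<open>q\<close> is the projection onto the vectors fixed by the square of
  \<open>b\<close>. The squared norms of b^k x decrease, and by self-adjointness the squared norm of
  b^k x - b^(k+2) x is their second difference, which tends to 0. Even powers avoid the oscillation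
  at the eigenvalue -1.\<close>

lemma op_power_limit:
  fixes b :: "'h::real_inner \<Rightarrow>\<^sub>L 'h"
  assumes b: "self_adjoint b" "norm b \<le> 1"
    and \<phi>: "strict_mono \<phi>" and lim: "wconv (\<lambda>n. op_power b (2 * \<phi> n)) q"
  shows "projection q" "b (b (q x)) = q x" "b x = x \<Longrightarrow> q x = x"
proof -
  let ?p = "op_power b"
  have pq: "inner (?p (2 * k) x) x = (norm (?p k x))\<^sup>2" for k x
    using op_power_add[of b k k x] adjoint_pairD[OF op_power_self_adjoint[OF b(1)]]
    by (simp add: mult_2 power2_norm_eq_inner)
  have "decseq (\<lambda>k. (norm (?p k x))\<^sup>2)" for x
    by (rule decseq_SucI) (auto intro!: power_mono contraction_le[OF b(2)])
  then have conv: "\<exists>l. (\<lambda>k. (norm (?p k x))\<^sup>2) \<longlonglongrightarrow> l" for x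
    using decseq_convergent[of "\<lambda>k. (norm (?p k x))\<^sup>2" 0] by (metis zero_le_power2)
  have "(\<lambda>k. ?p k x - ?p (2 + k) x) \<longlonglongrightarrow> 0" for x
  proof -
    obtain l where l: "(\<lambda>k. (norm (?p k x))\<^sup>2) \<longlonglongrightarrow> l" using conv by blast
    have "(norm (?p k x - ?p (2 + k) x))\<^sup>2
        = (norm (?p k x))\<^sup>2 - 2 * (norm (?p (k + 1) x))\<^sup>2 + (norm (?p (k + 2) x))\<^sup>2" for k
      using adjoint_pairD[OF b(1), of "?p k x" "b (?p k x)"]
      by (simp add: power2_norm_eq_inner op_simps inner_commute)
    moreover have "(\<lambda>k. (norm (?p k x))\<^sup>2 - 2 * (norm (?p (k + 1) x))\<^sup>2 + (norm (?p (k + 2) x))\<^sup>2)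
        \<longlonglongrightarrow> l - 2 * l + l"
      by (intro tendsto_intros l LIMSEQ_ignore_initial_segment[OF l])
    ultimately have "(\<lambda>k. (norm (?p k x - ?p (2 + k) x))\<^sup>2) \<longlonglongrightarrow> 0" by simp
    then show ?thesis by (simp add: tendsto_norm_zero_iff)
  qed
  then have d0: "(\<lambda>n. ?p (2 * \<phi> n) x - ?p (2 + 2 * \<phi> n) x) \<longlonglongrightarrow> 0" for x
    using LIMSEQ_subseq_LIMSEQ[of _ _ "\<lambda>n. 2 * \<phi> n"] \<phi>
    by (fastforce simp: comp_def strict_mono_def)
  have bbq: "b (b (q x)) = q x" for x
  proof (rule eqI_inner)
    fix y
    have "(\<lambda>n. inner (?p (2 * \<phi> n) x - ?p (2 + 2 * \<phi> n) x) y) \<longlonglongrightarrow> inner 0 y"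
      by (intro tendsto_inner d0 tendsto_const)
    moreover have "inner (?p (2 + 2 * \<phi> n) x) y = inner (?p (2 * \<phi> n) x) (b (b y))" for n
      using adjoint_pairD[OF b(1)] by (simp add: eval_nat_numeral)
    then have "(\<lambda>n. inner (?p (2 * \<phi> n) x - ?p (2 + 2 * \<phi> n) x) y) \<longlonglongrightarrow>
        inner (q x) y - inner (q x) (b (b y))"
      by (simp add: op_simps del: op_power.simps) (intro tendsto_diff wconvD[OF lim])
    ultimately have "inner (q x) y - inner (q x) (b (b y)) = 0"
      using LIMSEQ_unique by fastforce
    then show "inner (b (b (q x))) y = inner (q x) y"
      using adjoint_pairD[OF b(1)] by simp
  qed
  then show "b (b (q x)) = q x" .
  have fix_even: "?p (2 * k) y = y" if "b (b y) = y" for k y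
    by (induction k) (auto simp: that)
  have q_fix: "q y = y" if "b (b y) = y" for y
  proof (rule eqI_inner)
    show "inner (q y) z = inner y z" for z
      using wconvD[OF lim, of y z] by (simp add: fix_even[OF that] LIMSEQ_const_iff)
  qed
  then show "b x = x \<Longrightarrow> q x = x" by simp
  show "projection q"
    unfolding projection_def
    using wconv_self_adjoint[OF lim op_power_self_adjoint[OF b(1)]] q_fix[OF bbq]
    by (auto intro: blinfun_eqI)
qed

section \<open>Unitaries and range projections\<close>

lemma LIMSEQ_subseq_principle:
  fixes f :: "nat \<Rightarrow> 'a::metric_space"
  assumes "\<And>\<psi> :: nat \<Rightarrow> nat. strict_mono \<psi> \<Longrightarrow> \<exists>\<phi>. strict_mono (\<phi> :: nat \<Rightarrow> nat) \<and> (\<lambda>n. f (\<psi> (\<phi> n))) \<longlonglongrightarrow> l"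
  shows "f \<longlonglongrightarrow> l"
proof (rule ccontr)
  assume "\<not> f \<longlonglongrightarrow> l"
  then obtain e where e: "e > 0" "\<exists>\<^sub>\<infinity> n. dist (f n) l \<ge> e"
    by (auto simp: tendsto_iff eventually_sequentially INFM_nat_le not_less)
  obtain \<psi> where \<psi>: "strict_mono (\<psi> :: nat \<Rightarrow> nat)" "\<And>n. dist (f (\<psi> n)) l \<ge> e"
    using e(2) infinite_enumerate[of "{n. dist (f n) l \<ge> e}"]
    unfolding INFM_iff_infinite by auto
  obtain \<phi> where "(\<lambda>n. f (\<psi> (\<phi> n))) \<longlonglongrightarrow> l" using assms[OF \<psi>(1)] by blast
  then have "(\<lambda>n. dist (f (\<psi> (\<phi> n))) l) \<longlonglongrightarrow> 0" by (rule iffD1[OF tendsto_dist_iff])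
  then have "e \<le> 0" by (rule LIMSEQ_le_const) (use \<psi> in auto)
  with e show False by simp
qed

context vn_algebra
begin

text \<open>\<open>N\<close> may lack a unit, hence 1 + N. In the case of a corner these unitaries
  act as the identity on the complementary subspace.\<close>

definition unitaries :: "('h \<Rightarrow>\<^sub>L 'h) set" where
  "unitaries = {u. u - id_blinfun \<in> N \<and>
    (\<exists>v. v - id_blinfun \<in> N \<and> adjoint_pair u v \<and> u o\<^sub>L v = id_blinfun \<and> v o\<^sub>L u = id_blinfun)}"

lemma unitaries_adjoint:
  assumes "u \<in> unitaries"
  obtains v where "v \<in> unitaries" "adjoint_pair u v" "\<And>x. u (v x) = x" "\<And>x. v (u x) = x"
proof -
  obtain v where v: "v - id_blinfun \<in> N" "adjoint_pair u v" "u o\<^sub>L v = id_blinfun"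
    "v o\<^sub>L u = id_blinfun" and u: "u - id_blinfun \<in> N"
    using assms unfolding unitaries_def by blast
  have "v \<in> unitaries" using u v adjoint_pair_sym unfolding unitaries_def by blast
  moreover have "u (v x) = x" "v (u x) = x" for x
    using arg_cong[OF v(3), of "\<lambda>a. a x"] arg_cong[OF v(4), of "\<lambda>a. a x"] by auto
  ultimately show ?thesis using that v(2) by blast
qed

lemma unitaries_norm: "u \<in> unitaries \<Longrightarrow> norm (u x) = norm x"
proof -
  assume "u \<in> unitaries"
  then obtain v where "adjoint_pair u v" "\<And>x. v (u x) = x" using unitaries_adjoint by metis
  then show ?thesis by (simp add: norm_eq_sqrt_inner adjoint_pairD)
qed

lemma unitaries_norm_le: "u \<in> unitaries \<Longrightarrow> norm u \<le> 1"
  by (rule norm_blinfun_bound) (auto simp: unitaries_norm)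

lemma mem_one_plus_compose:
  assumes "a - id_blinfun \<in> N" "b - id_blinfun \<in> N"
  shows "(a o\<^sub>L b) - id_blinfun \<in> N"
proof -
  have "(a o\<^sub>L b) - id_blinfun
      = ((a - id_blinfun) o\<^sub>L (b - id_blinfun)) + ((a - id_blinfun) + (b - id_blinfun))"
    by (intro blinfun_eqI) (simp add: op_simps)
  also have "\<dots> \<in> N" by (intro add_mem compose_mem assms)
  finally show ?thesis .
qed

lemma unitaries_compose:
  assumes "u \<in> unitaries" "u' \<in> unitaries"
  shows "u o\<^sub>L u' \<in> unitaries"
proof -
  obtain v where v: "v \<in> unitaries" "adjoint_pair u v" "\<And>x. u (v x) = x" "\<And>x. v (u x) = x"
    using unitaries_adjoint assms by metis
  obtain v' where v': "v' \<in> unitaries" "adjoint_pair u' v'" "\<And>x. u' (v' x) = x" "\<And>x. v' (u' x) = x"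
    using unitaries_adjoint assms by metis
  have "(u o\<^sub>L u') - id_blinfun \<in> N" "(v' o\<^sub>L v) - id_blinfun \<in> N"
    using mem_one_plus_compose assms v(1) v'(1) unfolding unitaries_def by blast+
  moreover have "(u o\<^sub>L u') o\<^sub>L (v' o\<^sub>L v) = id_blinfun" "(v' o\<^sub>L v) o\<^sub>L (u o\<^sub>L u') = id_blinfun"
    by (auto intro!: blinfun_eqI simp: v v')
  ultimately show ?thesis
    using adjoint_pair_compose[OF v(2) v'(2)] unfolding unitaries_def by blast
qed

lemma id_unitary: "id_blinfun \<in> unitaries"
  unfolding unitaries_def by (auto intro!: exI[of _ id_blinfun] zero_mem adjoint_pair_id blinfun_eqI)

lemma one_plus_adjoint:
  assumes "a - id_blinfun \<in> N"
  obtains b where "b - id_blinfun \<in> N" "adjoint_pair a b"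
proof -
  obtain c where c: "c \<in> N" "adjoint_pair (a - id_blinfun) c" using adjoint_mem assms by blast
  have "adjoint_pair a (c + id_blinfun)"
    using adjoint_pair_add[OF c(2) adjoint_pair_id] by simp
  then show ?thesis using that[of "c + id_blinfun"] c by simp
qed

lemma one_plus_wconv:
  assumes "\<And>n. s n - id_blinfun \<in> N" "\<And>n. norm (s n) \<le> 1" "wconv s a"
  shows "a - id_blinfun \<in> N"
proof (rule wconv_mem)
  show "wconv (\<lambda>n. s n - id_blinfun) (a - id_blinfun)" by (intro wconv_diff wconv_const assms)
  show "norm (s n - id_blinfun) \<le> 2" for n
    using norm_triangle_ineq4[of "s n" id_blinfun] assms(2)[of n] norm_blinfun_id_le[where 'a='h]
    by linarith
qed (rule assms)

lemma one_plus_compactness: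
  assumes "\<And>n. s n - id_blinfun \<in> N" "\<And>n. norm (s n) \<le> 1"
  obtains \<phi> a where "strict_mono (\<phi> :: nat \<Rightarrow> nat)" "a - id_blinfun \<in> N" "wconv (\<lambda>n. s (\<phi> n)) a"
proof -
  have "norm (s n - id_blinfun) \<le> 2" for n
    using norm_triangle_ineq4[of "s n" id_blinfun] assms(2)[of n] norm_blinfun_id_le[where 'a='h]
    by linarith
  then obtain \<phi> b where \<phi>: "strict_mono (\<phi> :: nat \<Rightarrow> nat)" "b \<in> N"
    and "wconv (\<lambda>n. s (\<phi> n) - id_blinfun) b"
    using compactness[of "\<lambda>n. s n - id_blinfun" 2] assms(1) by blast
  from wconv_add[OF this(3) wconv_const[of id_blinfun]]
  show ?thesis using that[of \<phi> "b + id_blinfun"] \<phi> by simp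
qed

text \<open>\<open>i\<close> is (a - b)/(2i), since the inverse of \<open>J\<close> is
  \<open>- J\<close>. It is self-adjoint because \<open>J\<close> is skew and commutes with
  \<open>N\<close>.\<close>

lemma cartesian_decomposition:
  assumes a: "a \<in> N" "norm a \<le> 1" and b: "b \<in> N" "adjoint_pair a b"
  defines "r \<equiv> (1/2) *\<^sub>R (a + b)" and "i \<equiv> (-1/2) *\<^sub>R (J o\<^sub>L (a - b))"
  shows "r \<in> N" "self_adjoint r" "norm r \<le> 1" "i \<in> N" "self_adjoint i" "norm i \<le> 1"
    and "r + (J o\<^sub>L i) = a"
proof -
  have nb: "norm b \<le> 1" using adjoint_pair_norm_le[OF b(2)] a by linarith
  show "r \<in> N" "i \<in> N"
    unfolding r_def i_def using a b by (auto intro!: uminus_mem scaleR_mem add_mem J_mem diff_mem)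
  show "self_adjoint r"
    using adjoint_pair_add[OF b(2) adjoint_pair_sym[OF b(2)]]
    by (simp add: r_def add.commute adjoint_pair_scaleR)
  have "adjoint_pair (J o\<^sub>L (a - b)) ((b - a) o\<^sub>L - J)"
    by (intro adjoint_pair_compose J_skew adjoint_pair_diff adjoint_pair_sym[OF b(2)] b(2))
  moreover have "(b - a) o\<^sub>L - J = J o\<^sub>L (a - b)"
    by (intro blinfun_eqI) (simp add: op_simps J_commute a b)
  ultimately show "self_adjoint i" unfolding i_def by (metis adjoint_pair_scaleR)
  have "norm (r x) \<le> norm x" "norm (i x) \<le> norm x" for x
  proof -
    have "norm (a x + b x) \<le> norm x + norm x" "norm (a x - b x) \<le> norm x + norm x"
      using norm_triangle_ineq[of "a x" "b x"] norm_triangle_ineq4[of "a x" "b x"]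
        contraction_le[OF a(2), of x] contraction_le[OF nb, of x] by linarith+
    then show "norm (r x) \<le> norm x" "norm (i x) \<le> norm x"
      using norm_J[of "a x - b x"] by (simp_all add: r_def i_def op_simps)
  qed
  then show "norm r \<le> 1" "norm i \<le> 1" by (auto intro: norm_blinfun_bound)
  show "r + (J o\<^sub>L i) = a"
  proof (rule blinfun_eqI)
    fix x
    have "(r + (J o\<^sub>L i)) x = (1/2) *\<^sub>R (a x + b x) + (1/2) *\<^sub>R (a x - b x)"
      by (simp add: r_def i_def op_simps J_square scaleR_right_diff_distrib)
    also have "\<dots> = a x"
      by (simp add: scaleR_right_diff_distrib scaleR_right_distrib flip: scaleR_add_left)
    finally show "(r + (J o\<^sub>L i)) x = a x" .
  qed
qed

text \<open>Every self-adjoint contraction \<open>w\<close> is the imaginary part of the unitary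
  \<open>sqrt (1 - w\<^sup>2) + i w\<close>.\<close>

lemma unitary_of_self_adjoint:
  assumes w: "w \<in> N" "self_adjoint w" "norm w \<le> 1"
  obtains u v where "u \<in> unitaries" "v \<in> unitaries" "adjoint_pair u v" "u - v = 2 *\<^sub>R (J o\<^sub>L w)"
proof -
  have ww: "w o\<^sub>L w \<in> N" "positive_op (w o\<^sub>L w)" "norm (w o\<^sub>L w) \<le> 1"
    using w by (auto intro: compose_mem positive_op_square norm_compose_le_1)
  obtain y where y: "y \<in> N" "self_adjoint y" "norm y \<le> 1"
    and eq: "y = (1/2) *\<^sub>R ((w o\<^sub>L w) + (y o\<^sub>L y))"
    and comm: "\<And>(z :: 'h \<Rightarrow>\<^sub>L 'h) v. (\<And>u. z ((w o\<^sub>L w) u) = (w o\<^sub>L w) (z u)) \<Longrightarrow> z (y v) = y (z v)"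
    using sqrt_exists[OF ww] by blast
  have wy: "w (y x) = y (w x)" for x by (rule comm) simp
  have eq': "w (w x) + y (y x) = 2 *\<^sub>R y x" for x
    using arg_cong[OF eq, of "\<lambda>a. 2 *\<^sub>R a x"] by (simp add: op_simps)
  define u where "u = id_blinfun - y + (J o\<^sub>L w)"
  define v where "v = id_blinfun - y - (J o\<^sub>L w)"
  have uN: "u - id_blinfun \<in> N" and vN: "v - id_blinfun \<in> N"
  proof -
    have "u - id_blinfun = (J o\<^sub>L w) - y" "v - id_blinfun = - ((J o\<^sub>L w) + y)"
      by (auto simp: u_def v_def)
    then show "u - id_blinfun \<in> N" "v - id_blinfun \<in> N"
      using J_mem w y by (auto intro!: diff_mem uminus_mem add_mem)
  qed
  have "adjoint_pair (J o\<^sub>L w) (w o\<^sub>L - J)"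
    by (rule adjoint_pair_compose[OF J_skew w(2)])
  moreover have "w o\<^sub>L - J = - (J o\<^sub>L w)"
    by (intro blinfun_eqI) (simp add: op_simps J_commute[OF w(1)])
  ultimately have "adjoint_pair (J o\<^sub>L w) (- (J o\<^sub>L w))" by simp
  then have uv: "adjoint_pair u v"
    unfolding u_def v_def
    using adjoint_pair_add[OF adjoint_pair_diff[OF adjoint_pair_id y(2)]] by fastforce
  \<comment> \<open>This is (1 - y)^2 + w^2 = 1, the relation behind unitarity.\<close>
  have rel: "w (w x) = 2 *\<^sub>R y x - y (y x)" for x using eq'[of x] by (simp add: algebra_simps)
  have "u (v x) = x" "v (u x) = x" for x
    by (simp_all add: u_def v_def op_simps J_commute[OF w(1)] J_commute[OF y(1)] J_square rel wy
        scaleR_2 algebra_simps)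
  then have "u o\<^sub>L v = id_blinfun" "v o\<^sub>L u = id_blinfun" by (auto intro: blinfun_eqI)
  then have "u \<in> unitaries" "v \<in> unitaries"
    using uv adjoint_pair_sym uN vN unfolding unitaries_def by blast+
  moreover have "u - v = 2 *\<^sub>R (J o\<^sub>L w)" by (simp add: u_def v_def scaleR_2)
  ultimately show ?thesis using that uv by blast
qed

text \<open>Even powers of 1 - c have as weak limit the projection \<open>q\<close> onto the kernel
  of \<open>c\<close>. They differ from 1 by elements of \<open>N\<close>, so 1 - q lies in
  \<open>N\<close> even without a unit.\<close>

lemma range_projection:
  assumes c: "c \<in> N" "positive_op c" "norm c \<le> 1"
  obtains m where "m \<in> N" "projection m" "c o\<^sub>L m = c" "m o\<^sub>L c = c" "\<And>x. c x = 0 \<Longrightarrow> m x = 0"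
proof -
  define b where "b = id_blinfun - c"
  have sac: "self_adjoint c" and pos: "0 \<le> inner (c x) x" for x
    using c(2) by (simp_all add: positive_op_def)
  have sa: "self_adjoint b"
    unfolding b_def by (intro adjoint_pair_diff adjoint_pair_id sac)
  have nb: "norm b \<le> 1"
  proof (rule norm_blinfun_bound)
    fix x
    have "(norm (b x))\<^sup>2 = (norm x)\<^sup>2 - 2 * inner (c x) x + (norm (c x))\<^sup>2"
      by (simp add: b_def op_simps power2_norm_eq_inner inner_commute)
    also have "\<dots> \<le> (norm x)\<^sup>2"
      using positive_op_norm_square_le[OF c(2,3), of x] pos[of x] by simp
    finally show "norm (b x) \<le> 1 * norm x"
      unfolding mult_1 by (rule power2_le_imp_le) simp
  qed auto
  have bN: "op_power b k - id_blinfun \<in> N" for k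
  proof (induction k)
    case (Suc k)
    show ?case unfolding op_power.simps
      by (rule mem_one_plus_compose[OF _ Suc]) (use c uminus_mem in \<open>auto simp: b_def\<close>)
  qed (simp add: zero_mem)
  obtain \<phi> q where \<phi>: "strict_mono (\<phi> :: nat \<Rightarrow> nat)" and q: "q - id_blinfun \<in> N"
    and lim: "wconv (\<lambda>n. op_power b (2 * \<phi> n)) q"
    using one_plus_compactness[of "\<lambda>n. op_power b (2 * n)"] bN op_power_norm_le[OF nb] by metis
  note ql = op_power_limit[OF sa nb \<phi> lim]
  define m where "m = id_blinfun - q"
  have "m \<in> N" using uminus_mem[OF q] by (simp add: m_def)
  moreover have pm: "projection m" unfolding m_def by (rule projection_compl[OF ql(1)])
  moreover have cq: "c (q x) = 0" for x
  proof (rule positive_op_eq_0[OF c(2)])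
    let ?y = "q x"
    have "inner (b (b ?y)) ?y = inner ?y ?y" by (simp add: ql(2))
    \<comment> \<open>The squared norm of \<open>c ?y\<close> is also at most
      \<open>inner (c ?y) ?y\<close>, and the two relations leave only the value 0.\<close>
    then have "2 * inner (c ?y) ?y = (norm (c ?y))\<^sup>2"
      using adjoint_pairD[OF sac, of "c ?y" ?y]
      by (simp add: b_def op_simps power2_norm_eq_inner)
    then show "inner (c ?y) ?y = 0"
      using positive_op_norm_square_le[OF c(2,3), of ?y] pos[of ?y] by simp
  qed
  moreover have cm: "c o\<^sub>L m = c"
    by (intro blinfun_eqI) (simp add: m_def op_simps cq)
  moreover have "m o\<^sub>L c = c"
    using adjoint_pair_compose[OF sac projectionD(1)[OF pm]] adjoint_pair_unique[OF sac]
    unfolding cm by metis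
  moreover have "m x = 0" if "c x = 0" for x
    using ql(3)[of x] that by (simp add: m_def b_def op_simps)
  ultimately show ?thesis using that by blast
qed

section \<open>Groups of unitaries with tight orbits\<close>

text \<open>Iterated sequential limits in place of a topological closure: products are weakly
  continuous only in each factor separately, and induction over the limits matches this.\<close>

inductive_set wclosure :: "('h \<Rightarrow>\<^sub>L 'h) set" where
  base: "u \<in> unitaries \<Longrightarrow> u \<in> wclosure"
| lim: "(\<And>n. s n \<in> wclosure) \<Longrightarrow> wconv s a \<Longrightarrow> a \<in> wclosure"

lemma wclosure_norm_le: "a \<in> wclosure \<Longrightarrow> norm a \<le> 1"
  by (induction rule: wclosure.induct) (auto intro: unitaries_norm_le wconv_norm_le)

lemma wclosure_one_plus: "a \<in> wclosure \<Longrightarrow> a - id_blinfun \<in> N"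
proof (induction rule: wclosure.induct)
  case (lim s a)
  then show ?case using one_plus_wconv wclosure_norm_le by blast
qed (simp add: unitaries_def)

lemma wclosure_adjoint:
  assumes "a \<in> wclosure" "adjoint_pair a b"
  shows "b \<in> wclosure"
  using assms
proof (induction arbitrary: b rule: wclosure.induct)
  case (base u)
  then show ?case using unitaries_adjoint wclosure.base adjoint_pair_unique by metis
next
  case (lim s a)
  have "\<exists>t. adjoint_pair (s n) t" for n
    using one_plus_adjoint[OF wclosure_one_plus[OF lim(1)]] by metis
  then obtain t where t: "\<And>n. adjoint_pair (s n) (t n)" by metis
  then have "t n \<in> wclosure" for n using lim by blast
  then show ?case using wclosure.lim wconv_adjoint[OF lim(2) t lim.prems] by blast
qed

text \<open>Limits move one factor at a time: first the right factor, with a unitary on the left,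
  then the left one.\<close>

lemma wclosure_compose:
  assumes "a \<in> wclosure" "b \<in> wclosure"
  shows "a o\<^sub>L b \<in> wclosure"
proof -
  have ub: "u o\<^sub>L b \<in> wclosure" if "u \<in> unitaries" for u
    using assms(2)
  proof (induction rule: wclosure.induct)
    case (base v)
    then show ?case by (intro wclosure.base unitaries_compose that)
  next
    case (lim s a)
    obtain v where "adjoint_pair u v" by (rule unitaries_adjoint[OF \<open>u \<in> unitaries\<close>])
    from wclosure.lim[OF lim.IH wconv_compose_left[OF this lim(2)]] show ?case .
  qed
  show ?thesis
    using assms(1)
  proof (induction rule: wclosure.induct)
    case (lim s a)
    from wclosure.lim[OF lim.IH wconv_compose_right[OF lim(2)]] show ?case .
  qed (rule ub)
qed

text \<open>The hypothesis says that no orbit of a nonzero vector under the unitary group escapes to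
  infinity. The weak closure of the group is then a semigroup whose elements are injective, so
  the projection obtained from the powers of \<open>a\<^sup>* a\<close> is the identity and every
  weak limit \<open>a\<close> is an isometry.\<close>

lemma sot_compact_of_tight:
  assumes tight: "\<And>x. x \<noteq> 0 \<Longrightarrow> \<exists>P :: 'h \<Rightarrow>\<^sub>L 'h. (\<forall>s a. wconv s a \<longrightarrow> (\<lambda>n. P (s n x)) \<longlonglongrightarrow> P (a x)) \<and>
      (\<exists>c>0. \<forall>u\<in>unitaries. c \<le> norm (P (u x)))"
  shows "sot_compact N"
proof -
  have inj: "a x \<noteq> 0" if a: "a \<in> wclosure" and x: "x \<noteq> 0" for a x
  proof -
    obtain P :: "'h \<Rightarrow>\<^sub>L 'h" and c where P: "\<And>s a. wconv s a \<Longrightarrow> (\<lambda>n. P (s n x)) \<longlonglongrightarrow> P (a x)"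
      and c: "c > 0" "\<And>u. u \<in> unitaries \<Longrightarrow> c \<le> norm (P (u x))"
      using tight[OF x] by blast
    \<comment> \<open>\<open>P\<close> turns weak into norm convergence at \<open>x\<close>, so the
      lower bound on the group survives every further limit.\<close>
    have "c \<le> norm (P (a x))" using a
    proof (induction rule: wclosure.induct)
      case (lim s a)
      show ?case
        by (rule LIMSEQ_le_const[OF tendsto_norm[OF P[OF lim(2)]]]) (use lim.IH in auto)
    qed (rule c)
    then show ?thesis using c(1) by (auto simp: op_simps)
  qed
  have iso: "norm (a x) = norm x" if a: "a \<in> wclosure" for a x
  proof -
    obtain a' where a': "adjoint_pair a a'"
      using one_plus_adjoint[OF wclosure_one_plus[OF a]] by blast
    define b where "b = a' o\<^sub>L a"
    have bw: "b \<in> wclosure"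
      unfolding b_def using wclosure_compose wclosure_adjoint a a' by blast
    have sa: "self_adjoint b"
      unfolding b_def using positive_op_square[OF a'] by (simp add: positive_op_def)
    have nb: "norm b \<le> 1" by (rule wclosure_norm_le[OF bw])
    have pw: "op_power b k \<in> wclosure" for k
      by (induction k) (auto intro: wclosure_compose bw wclosure.base id_unitary)
    obtain \<phi> q where \<phi>: "strict_mono (\<phi> :: nat \<Rightarrow> nat)"
      and lim: "wconv (\<lambda>n. op_power b (2 * \<phi> n)) q"
      using one_plus_compactness[of "\<lambda>n. op_power b (2 * n)"] wclosure_one_plus[OF pw]
        op_power_norm_le[OF nb] by metis
    note ql = op_power_limit[OF sa nb \<phi> lim]
    have qw: "q \<in> wclosure" by (rule wclosure.lim[OF pw lim])
    \<comment> \<open>An injective projection is the identity. So \<open>b\<close> is an involution,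
      and \<open>x\<close> is recovered from \<open>a x\<close> by contractions only.\<close>
    have "q (x - q x) = 0" by (simp add: op_simps projectionD(3)[OF ql(1)])
    then have "q x = x" using inj[OF qw, of "x - q x"] by (metis eq_iff_diff_eq_0)
    then have "norm x = norm (a' (a (b x)))" using ql(2)[of x] by (simp add: b_def)
    also have "\<dots> \<le> norm (a (b x))"
      by (intro contraction_le wclosure_norm_le wclosure_adjoint[OF a a'])
    also have "\<dots> \<le> norm (b x)" by (intro contraction_le wclosure_norm_le a)
    also have "\<dots> \<le> norm (a x)"
      unfolding b_def blinfun_apply_blinfun_compose
      by (intro contraction_le wclosure_norm_le wclosure_adjoint[OF a a'])
    finally show ?thesis using contraction_le[OF wclosure_norm_le[OF a]] by (simp add: antisym)
  qed
  \<comment> \<open>Realise \<open>w n\<close> as imaginary parts of unitaries. Along a subsequence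
    these and their adjoints have weak limits, which are isometries, so the convergence is strong.
    The same holds for the differences, and their limit must be the weak limit 0.\<close>
  have sub: "\<exists>\<phi>. strict_mono (\<phi> :: nat \<Rightarrow> nat) \<and> sconv (\<lambda>n. w (\<phi> n)) 0"
    if w: "\<And>n. w n \<in> N" "\<And>n. self_adjoint (w n)" "\<And>n. norm (w n) \<le> 1" "wconv w 0" for w
  proof -
    have "\<exists>u v. u \<in> unitaries \<and> v \<in> unitaries \<and> adjoint_pair u v \<and> u - v = 2 *\<^sub>R (J o\<^sub>L w n)" for n
      using unitary_of_self_adjoint[OF w(1-3)] by metis
    then obtain u v where uv: "\<And>n. u n \<in> unitaries" "\<And>n. v n \<in> unitaries"
      "\<And>n. adjoint_pair (u n) (v n)" "\<And>n. u n - v n = 2 *\<^sub>R (J o\<^sub>L w n)"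
      by metis
    obtain \<phi> a where \<phi>: "strict_mono (\<phi> :: nat \<Rightarrow> nat)" and a: "a - id_blinfun \<in> N"
      and lim: "wconv (\<lambda>n. u (\<phi> n)) a"
      using one_plus_compactness[of u] uv(1) unitaries_norm_le unfolding unitaries_def by auto
    obtain b where ab: "adjoint_pair a b" using one_plus_adjoint[OF a] by blast
    have lim': "wconv (\<lambda>n. v (\<phi> n)) b" by (rule wconv_adjoint[OF lim uv(3) ab])
    have "a \<in> wclosure" "b \<in> wclosure"
      by (rule wclosure.lim[OF wclosure.base[OF uv(1)] lim], rule wclosure.lim[OF wclosure.base[OF uv(2)] lim'])
    then have "sconv (\<lambda>n. u (\<phi> n)) a" "sconv (\<lambda>n. v (\<phi> n)) b"
      using wconv_isometry_imp_sconv[OF lim unitaries_norm_le[OF uv(1)] iso]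
        wconv_isometry_imp_sconv[OF lim' unitaries_norm_le[OF uv(2)] iso] by auto
    then have s: "sconv (\<lambda>n. 2 *\<^sub>R (J o\<^sub>L w (\<phi> n))) (a - b)"
      using sconv_diff[of "\<lambda>n. u (\<phi> n)" a "\<lambda>n. v (\<phi> n)" b] uv(4) by simp
    moreover have "wconv (\<lambda>n. 2 *\<^sub>R (J o\<^sub>L w (\<phi> n))) (2 *\<^sub>R (J o\<^sub>L 0))"
      by (intro wconv_scaleR wconv_compose_left[OF J_skew] wconv_subseq[OF w(4) \<phi>])
    ultimately have "a - b = 2 *\<^sub>R (J o\<^sub>L 0)" by (rule wconv_unique[OF sconv_imp_wconv])
    then have "a - b = 0" by simp
    with s have "sconv (\<lambda>n. 2 *\<^sub>R (J o\<^sub>L w (\<phi> n))) 0" by simp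
    from sconv_scaleR[OF this, of "1/2"] have "sconv (\<lambda>n. J o\<^sub>L w (\<phi> n)) 0" by simp
    then have "(\<lambda>n. norm (J (w (\<phi> n) x))) \<longlonglongrightarrow> 0" for x
      using tendsto_norm_zero sconvD by fastforce
    then have "sconv (\<lambda>n. w (\<phi> n)) 0"
      unfolding sconv_def norm_J by (simp add: tendsto_norm_zero_iff)
    with \<phi> show ?thesis by blast
  qed
  have sac: "sconv w 0"
    if w: "\<And>n. w n \<in> N" "\<And>n. self_adjoint (w n)" "\<And>n. norm (w n) \<le> 1" "wconv w 0" for w
    unfolding sconv_def
  proof (intro allI LIMSEQ_subseq_principle)
    fix x and \<psi> :: "nat \<Rightarrow> nat" assume "strict_mono \<psi>"
    then obtain \<phi> where "strict_mono (\<phi> :: nat \<Rightarrow> nat)" "sconv (\<lambda>n. w (\<psi> (\<phi> n))) 0"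
      using sub[of "\<lambda>n. w (\<psi> n)"] w wconv_subseq[OF w(4)] by blast
    then show "\<exists>\<phi>. strict_mono (\<phi> :: nat \<Rightarrow> nat) \<and> (\<lambda>n. w (\<psi> (\<phi> n)) x) \<longlonglongrightarrow> blinfun_apply 0 x"
      using sconvD by blast
  qed
  show ?thesis
    unfolding sot_compact_def
  proof (intro allI impI)
    fix c assume c: "\<forall>n. c n \<in> N" "\<forall>n. norm (c n) \<le> 1" "wconv c 0"
    have "\<exists>d. d \<in> N \<and> adjoint_pair (c n) d" for n using adjoint_mem c by blast
    then obtain d where d: "\<And>n. d n \<in> N" "\<And>n. adjoint_pair (c n) (d n)" by metis
    have d0: "wconv d 0" by (rule wconv_adjoint[OF c(3) d(2) adjoint_pair_zero])
    define r where "r = (\<lambda>n. (1/2) *\<^sub>R (c n + d n))"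
    define i where "i = (\<lambda>n. (-1/2) *\<^sub>R (J o\<^sub>L (c n - d n)))"
    have cart: "r n \<in> N" "self_adjoint (r n)" "norm (r n) \<le> 1" "i n \<in> N" "self_adjoint (i n)"
      "norm (i n) \<le> 1" "r n + (J o\<^sub>L i n) = c n" for n
      using cartesian_decomposition[of "c n" "d n"] c d by (auto simp: r_def i_def)
    have "wconv r 0"
      using wconv_scaleR[OF wconv_add[OF c(3) d0], of "1/2"] by (simp add: r_def)
    then have "sconv r 0" by (rule sac[OF cart(1-3)])
    moreover have "wconv i 0"
      using wconv_scaleR[OF wconv_compose_left[OF J_skew wconv_diff[OF c(3) d0]], of "-1/2"]
      by (simp add: i_def)
    then have "sconv i 0" by (rule sac[OF cart(4-6)])
    ultimately have "sconv (\<lambda>n. r n + (J o\<^sub>L i n)) (0 + (J o\<^sub>L 0))"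
      by (intro sconv_add sconv_compose_left)
    then show "sconv c 0" by (simp add: cart)
  qed
qed

end

section \<open>Corners\<close>

definition corner :: "('h::real_inner \<Rightarrow>\<^sub>L 'h) \<Rightarrow> ('h \<Rightarrow>\<^sub>L 'h) set \<Rightarrow> ('h \<Rightarrow>\<^sub>L 'h) set" where
  "corner e N = {a \<in> N. e o\<^sub>L a = a \<and> a o\<^sub>L e = a}"

lemma cornerD:
  assumes "a \<in> corner e N"
  shows "a \<in> N" "e o\<^sub>L a = a" "a o\<^sub>L e = a" "e (a x) = a x" "a (e x) = a x"
proof -
  show h: "a \<in> N" "e o\<^sub>L a = a" "a o\<^sub>L e = a" using assms by (auto simp: corner_def)
  show "e (a x) = a x" "a (e x) = a x"
    using arg_cong[OF h(2), of "\<lambda>b. b x"] arg_cong[OF h(3), of "\<lambda>b. b x"] by auto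
qed

text \<open>The form bound and c^2 \<le> (norm c) c give
  \<open>norm c \<le> sqrt (norm c)\<close>.\<close>

lemma positive_op_norm_le_1:
  assumes "positive_op c" "\<And>x. inner (c x) x \<le> (norm x)\<^sup>2"
  shows "norm c \<le> 1"
proof -
  have "norm c \<le> sqrt (norm c)"
  proof (rule norm_blinfun_bound)
    fix x
    have "(norm (c x))\<^sup>2 \<le> norm c * inner (c x) x"
      by (rule positive_op_norm_square_le[OF assms(1)]) simp
    also have "\<dots> \<le> norm c * (norm x)\<^sup>2" by (intro mult_left_mono assms) simp
    finally show "norm (c x) \<le> sqrt (norm c) * norm x"
      by (metis norm_ge_zero real_sqrt_le_iff real_sqrt_mult real_sqrt_pow2_iff real_sqrt_unique)
  qed simp
  then have "norm c * norm c \<le> norm c * 1"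
    using mult_mono[of "norm c" "sqrt (norm c)" "norm c" "sqrt (norm c)"] by simp
  then show ?thesis by (cases "norm c = 0") (auto simp: mult_le_cancel_left_pos)
qed

context vn_algebra
begin

text \<open>Since \<open>N\<close> need not be unital, complements of projections in \<open>N\<close> are admitted as well.\<close>

definition multiplier_proj :: "('h \<Rightarrow>\<^sub>L 'h) \<Rightarrow> bool" where
  "multiplier_proj e \<longleftrightarrow> projection e \<and> (e \<in> N \<or> id_blinfun - e \<in> N)"

lemma multiplier_projD:
  assumes "multiplier_proj e"
  shows "projection e" "a \<in> N \<Longrightarrow> e o\<^sub>L a \<in> N" "a \<in> N \<Longrightarrow> a o\<^sub>L e \<in> N" "e (J x) = J (e x)"
proof -
  show e: "projection e" using assms by (simp add: multiplier_proj_def)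
  consider "e \<in> N" | "id_blinfun - e \<in> N" using assms unfolding multiplier_proj_def by blast
  note cases = this
  show "e o\<^sub>L a \<in> N" "a o\<^sub>L e \<in> N" if a: "a \<in> N"
  proof -
    have eq: "e o\<^sub>L a = a - ((id_blinfun - e) o\<^sub>L a)" "a o\<^sub>L e = a - (a o\<^sub>L (id_blinfun - e))"
      by (intro blinfun_eqI; simp add: op_simps)+
    show "e o\<^sub>L a \<in> N" by (cases rule: cases) (use a eq in \<open>metis compose_mem diff_mem\<close>)+
    show "a o\<^sub>L e \<in> N" by (cases rule: cases) (use a eq in \<open>metis compose_mem diff_mem\<close>)+
  qed
  show "e (J x) = J (e x)"
  proof (cases rule: cases)
    case 2
    from J_commute[OF this, of x] show ?thesis by (simp add: op_simps)
  qed (simp add: J_commute)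
qed

text \<open>Makes every result on algebras available for corners. The compression equations survive
  weak limits because multiplication by \<open>e\<close> on either side is weakly
  continuous.\<close>

lemma vn_algebra_corner:
  assumes e: "multiplier_proj e"
  shows "vn_algebra (corner e N) J"
proof
  fix a b assume a: "a \<in> corner e N" and b: "b \<in> corner e N"
  show "a + b \<in> corner e N" "a o\<^sub>L b \<in> corner e N"
    using cornerD[OF a] cornerD[OF b]
    by (auto simp: corner_def op_simps intro!: add_mem compose_mem blinfun_eqI)
next
  fix a assume a: "a \<in> corner e N"
  note a' = cornerD[OF a]
  show "r *\<^sub>R a \<in> corner e N" for r
    using a' by (auto simp: corner_def op_simps intro!: scaleR_mem blinfun_eqI)
  show "J o\<^sub>L a \<in> corner e N"
    using a' multiplier_projD(4)[OF e]
    by (auto simp: corner_def op_simps intro!: J_mem blinfun_eqI)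
  show "a (J x) = J (a x)" for x by (rule J_commute[OF a'(1)])
  obtain b where b: "b \<in> N" "adjoint_pair a b" using adjoint_mem a' by blast
  have "adjoint_pair (e o\<^sub>L a) (b o\<^sub>L e)" "adjoint_pair (a o\<^sub>L e) (e o\<^sub>L b)"
    by (intro adjoint_pair_compose b projectionD(1) multiplier_projD(1)[OF e])+
  then have "b o\<^sub>L e = b" "e o\<^sub>L b = b"
    unfolding a'(2,3) using adjoint_pair_unique b(2) by blast+
  then show "\<exists>b\<in>corner e N. adjoint_pair a b" using b by (auto simp: corner_def)
next
  fix s :: "nat \<Rightarrow> 'h \<Rightarrow>\<^sub>L 'h" and C
  assume s: "\<And>n. s n \<in> corner e N" "\<And>n. norm (s n) \<le> C"
  obtain \<phi> a where \<phi>: "strict_mono (\<phi> :: nat \<Rightarrow> nat)" and a: "a \<in> N" "wconv (\<lambda>n. s (\<phi> n)) a"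
    using compactness[of s C] s cornerD(1) by blast
  have "wconv (\<lambda>n. e o\<^sub>L s (\<phi> n)) (e o\<^sub>L a)" "wconv (\<lambda>n. s (\<phi> n) o\<^sub>L e) (a o\<^sub>L e)"
    by (intro wconv_compose_left[OF projectionD(1)[OF multiplier_projD(1)[OF e]]]
        wconv_compose_right a)+
  then have "e o\<^sub>L a = a" "a o\<^sub>L e = a"
    unfolding cornerD[OF s(1)] using wconv_unique a(2) by blast+
  with \<phi> a show "\<exists>\<phi> a. strict_mono (\<phi> :: nat \<Rightarrow> nat) \<and> a \<in> corner e N \<and> wconv (\<lambda>n. s (\<phi> n)) a"
    unfolding corner_def by blast
qed (auto simp: corner_def zero_mem J_square J_skew)

lemma corner_id: "corner id_blinfun N = N"
  unfolding corner_def by (auto intro!: blinfun_eqI)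

text \<open>Weak limits \<open>k\<close> of \<open>z\<^sub>n\<^sup>* z\<^sub>n\<close> are annihilated by all \<open>z\<^sub>m\<close> and hence vanish.\<close>

lemma sconv_adjoint_of_products:
  assumes x: "\<And>n. x n \<in> N" "\<And>n. norm (x n) \<le> 1" and z: "\<And>n. adjoint_pair (x n) (z n)"
    and prod: "\<And>m. sconv (\<lambda>n. z n o\<^sub>L x m) 0"
  shows "sconv z 0"
  unfolding sconv_def
proof (intro allI LIMSEQ_subseq_principle)
  fix v and \<psi> :: "nat \<Rightarrow> nat" assume \<psi>: "strict_mono \<psi>"
  have zN: "z n \<in> N" for n using adjoint_mem[OF x(1)] adjoint_pair_unique[OF z] by metis
  have nz: "norm (z n) \<le> 1" for n using adjoint_pair_norm_le[OF z] x(2) order_trans by blast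
  obtain \<phi> k where \<phi>: "strict_mono (\<phi> :: nat \<Rightarrow> nat)"
    and lim: "wconv (\<lambda>n. x (\<psi> (\<phi> n)) o\<^sub>L z (\<psi> (\<phi> n))) k"
    using compactness[of "\<lambda>n. x (\<psi> n) o\<^sub>L z (\<psi> n)" 1] compose_mem x zN norm_compose_le_1[OF x(2) nz]
    by blast
  have xz: "inner (x n y) w = inner y (z n w)" for n y w by (rule adjoint_pairD[OF z])
  have orth: "inner (k y) (x m w) = 0" for y m w
  proof -
    have "strict_mono (\<lambda>n. \<psi> (\<phi> n))" using \<psi> \<phi> by (simp add: strict_mono_def)
    then have "(\<lambda>n. z (\<psi> (\<phi> n)) (x m w)) \<longlonglongrightarrow> 0"
      using sconvD[OF sconv_subseq[OF prod[of m]], of "\<lambda>n. \<psi> (\<phi> n)" w] by simp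
    then have "(\<lambda>n. norm y * norm (z (\<psi> (\<phi> n)) (x m w))) \<longlonglongrightarrow> norm y * 0"
      by (intro tendsto_mult tendsto_const tendsto_norm_zero)
    then have "(\<lambda>n. inner ((x (\<psi> (\<phi> n)) o\<^sub>L z (\<psi> (\<phi> n))) y) (x m w)) \<longlonglongrightarrow> 0"
    proof (rule Lim_null_comparison[rotated, OF tendsto_eq_rhs])
      show "\<forall>\<^sub>F n in sequentially. norm (inner ((x (\<psi> (\<phi> n)) o\<^sub>L z (\<psi> (\<phi> n))) y) (x m w))
          \<le> norm y * norm (z (\<psi> (\<phi> n)) (x m w))"
      proof (intro always_eventually allI)
        fix n
        have "norm (inner (z (\<psi> (\<phi> n)) y) (z (\<psi> (\<phi> n)) (x m w)))
            \<le> norm (z (\<psi> (\<phi> n)) y) * norm (z (\<psi> (\<phi> n)) (x m w))"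
          by (simp add: Cauchy_Schwarz_ineq2)
        also have "\<dots> \<le> norm y * norm (z (\<psi> (\<phi> n)) (x m w))"
          by (intro mult_right_mono contraction_le nz) auto
        finally show "norm (inner ((x (\<psi> (\<phi> n)) o\<^sub>L z (\<psi> (\<phi> n))) y) (x m w))
          \<le> norm y * norm (z (\<psi> (\<phi> n)) (x m w))" by (simp add: xz)
      qed
    qed simp
    then show ?thesis using wconvD[OF lim] LIMSEQ_unique by blast
  qed
  have "inner (k y) (k y) = 0" for y
    using wconvD'[OF lim, of "k y" y] by (simp add: orth LIMSEQ_const_iff)
  then have k0: "k y = 0" for y by simp
  have "(\<lambda>n. (norm (z (\<psi> (\<phi> n)) v))\<^sup>2) \<longlonglongrightarrow> 0"
    using wconvD[OF lim, of v v] by (simp add: k0 xz power2_norm_eq_inner)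
  then have "(\<lambda>n. z (\<psi> (\<phi> n)) v) \<longlonglongrightarrow> 0" by (simp add: tendsto_norm_zero_iff)
  with \<phi> show "\<exists>\<phi>. strict_mono (\<phi> :: nat \<Rightarrow> nat) \<and> (\<lambda>n. z (\<psi> (\<phi> n)) v) \<longlonglongrightarrow> blinfun_apply 0 v"
    by auto
qed

text \<open>Extends compactness from the corner e N e to the row e N: products of \<open>x n\<close>
  with adjoints of \<open>x m\<close> lie in the corner and are strongly null, and
  \<open>sconv_adjoint_of_products\<close> applies to the adjoints.\<close>

lemma row_sconv:
  assumes e: "multiplier_proj e" "sot_compact (corner e N)"
    and x: "\<And>n. x n \<in> N" "\<And>n. norm (x n) \<le> 1" "\<And>n. e o\<^sub>L x n = x n" "wconv x 0"
  shows "sconv x 0"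
proof -
  obtain z where z: "\<And>n. z n \<in> N" "\<And>n. adjoint_pair (x n) (z n)"
    using adjoint_mem[OF x(1)] by metis
  have nz: "norm (z n) \<le> 1" for n using adjoint_pair_norm_le[OF z(2)] x(2) order_trans by blast
  have "adjoint_pair (e o\<^sub>L x n) (z n o\<^sub>L e)" for n
    by (intro adjoint_pair_compose z projectionD(1) multiplier_projD(1)[OF e(1)])
  then have ze: "z n o\<^sub>L e = z n" for n
    unfolding x(3) using adjoint_pair_unique z(2) by blast
  show ?thesis
  proof (rule sconv_adjoint_of_products[OF z(1) nz adjoint_pair_sym[OF z(2)]])
    fix m
    show "sconv (\<lambda>n. x n o\<^sub>L z m) 0"
    proof (rule e(2)[unfolded sot_compact_def, rule_format])
      have "e (x n v) = x n v" "z m (e v) = z m v" for n v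
        using arg_cong[OF x(3), of "\<lambda>a. a v"] arg_cong[OF ze, of "\<lambda>a. a v"] by auto
      then show "x n o\<^sub>L z m \<in> corner e N" for n
        unfolding corner_def by (auto intro!: compose_mem x z blinfun_eqI)
      show "norm (x n o\<^sub>L z m) \<le> 1" for n by (intro norm_compose_le_1 x nz)
      show "wconv (\<lambda>n. x n o\<^sub>L z m) 0" using wconv_compose_right[OF x(4), of "z m"] by simp
    qed
  qed
qed

text \<open>Off-diagonal blocks lie in neither corner, but the rows e N and f N contain them, and
  \<open>c n\<close> is the sum of its two rows.\<close>

lemma sot_compact_corner_add:
  assumes e: "multiplier_proj e" "sot_compact (corner e N)"
    and f: "multiplier_proj f" "sot_compact (corner f N)"
  shows "sot_compact (corner (e + f) N)"
  unfolding sot_compact_def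
proof (intro allI impI)
  fix c assume "\<forall>n. c n \<in> corner (e + f) N" and nc: "\<forall>n. norm (c n) \<le> 1" and c0: "wconv c 0"
  then have c: "c n \<in> N" "e (c n v) + f (c n v) = c n v" for n v
    using cornerD(1,4)[of "c n" "e + f" N] by (auto simp: op_simps)
  have *: "sconv (\<lambda>n. g o\<^sub>L c n) 0" if g: "multiplier_proj g" "sot_compact (corner g N)" for g
  proof (rule row_sconv[OF g])
    show "g o\<^sub>L c n \<in> N" for n by (intro multiplier_projD g c)
    show "norm (g o\<^sub>L c n) \<le> 1" for n
      by (rule norm_compose_le_1[OF projection_norm_le[OF multiplier_projD(1)[OF g(1)]]]) (use nc in blast)
    show "g o\<^sub>L (g o\<^sub>L c n) = g o\<^sub>L c n" for n
      by (intro blinfun_eqI) (simp add: projectionD(3)[OF multiplier_projD(1)[OF g(1)]])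
    show "wconv (\<lambda>n. g o\<^sub>L c n) 0"
      using wconv_compose_left[OF projectionD(1)[OF multiplier_projD(1)[OF g(1)]] c0] by simp
  qed
  have "sconv (\<lambda>n. (e o\<^sub>L c n) + (f o\<^sub>L c n)) (0 + 0)" by (intro sconv_add * e f)
  moreover have "(e o\<^sub>L c n) + (f o\<^sub>L c n) = c n" for n
    by (intro blinfun_eqI) (simp add: op_simps c)
  ultimately show "sconv c 0" by simp
qed

section \<open>Algebras without projections\<close>

lemma nonzero_projection:
  assumes a: "a \<in> N" "a \<noteq> 0"
  obtains m where "m \<in> N" "projection m" "m \<noteq> 0"
proof -
  obtain b where b: "b \<in> N" "adjoint_pair a b" using adjoint_mem a by blast
  define c where "c = (1 / norm (b o\<^sub>L a)) *\<^sub>R (b o\<^sub>L a)"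
  have ba: "b o\<^sub>L a \<noteq> 0"
  proof
    assume ba0: "b o\<^sub>L a = 0"
    have "inner (a x) (a x) = 0" for x
      using adjoint_pairD[OF b(2), of x "a x"] arg_cong[OF ba0, of "\<lambda>a. a x"] by simp
    then have "a = 0" by (intro blinfun_eqI) simp
    with a show False by simp
  qed
  have c: "c \<in> N" "positive_op c" "norm c \<le> 1"
    unfolding c_def using a b by (auto intro!: scaleR_mem compose_mem positive_op_scaleR positive_op_square)
  obtain m where m: "m \<in> N" "projection m" "c o\<^sub>L m = c"
    by (rule range_projection[OF c])
  have "c \<noteq> 0" using ba by (simp add: c_def)
  then have "m \<noteq> 0" using m(3) by force
  with that m show ?thesis by blast
qed

text \<open>With |a| the positive root of the square of \<open>a\<close>, consider the range
  projection of the square of the negative part \<open>h\<close> of \<open>a\<close>. If it is 0,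
  then a = |a|; if it is \<open>e\<close>, then h (|a| + a) = 0 gives a = - |a|.\<close>

lemma definite_without_projections:
  assumes e: "e \<in> N" "projection e" "\<And>a. a \<in> N \<Longrightarrow> e o\<^sub>L a = a"
    and triv: "\<And>m. m \<in> N \<Longrightarrow> projection m \<Longrightarrow> m = 0 \<or> m = e"
    and a: "a \<in> N" "self_adjoint a" "norm a \<le> 1"
  shows "positive_op a \<or> positive_op (- a)"
proof -
  have ea: "e (a' x) = a' x" if "a' \<in> N" for a' x
    using arg_cong[OF e(3)[OF that], of "\<lambda>a. a x"] by simp
  have ae: "a' (e x) = a' x" if a': "a' \<in> N" "self_adjoint a'" for a' x
  proof (rule eqI_inner)
    show "inner (a' (e x)) y = inner (a' x) y" for y
      using adjoint_pairD[OF a'(2)] adjoint_pairD[OF projectionD(1)[OF e(2)]] ea[OF a'(1)] by simp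
  qed
  \<comment> \<open>A solution \<open>y\<close> from \<open>sqrt_exists\<close> then satisfies (e -
    y)^2 = e - x = a^2, so \<open>b = e - y\<close> is the absolute value of
    \<open>a\<close>.\<close>
  define x where "x = e - (a o\<^sub>L a)"
  have xN: "x \<in> N" unfolding x_def by (intro diff_mem compose_mem e a)
  have qx: "inner (x v) v = (norm (e v))\<^sup>2 - (norm (a v))\<^sup>2" for v
    using adjoint_pairD[OF a(2), of "a v" v] projection_norm_square[OF e(2), of v]
    by (simp add: x_def op_simps power2_norm_eq_inner)
  have le_e: "norm (a v) \<le> norm (e v)" for v
    using contraction_le[OF a(3), of "e v"] ae[OF a(1,2)] by simp
  have px: "positive_op x"
    unfolding positive_op_def
  proof (intro conjI allI)
    show "self_adjoint x"
      unfolding x_def by (intro adjoint_pair_diff adjoint_pair_compose projectionD(1) e a)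
    show "0 \<le> inner (x v) v" for v
      using le_e[of v] by (simp add: qx)
  qed
  have nx: "norm x \<le> 1"
  proof (rule positive_op_norm_le_1[OF px])
    fix v
    have "(norm (e v))\<^sup>2 \<le> (norm v)\<^sup>2"
      by (intro power_mono contraction_le projection_norm_le e) auto
    then show "inner (x v) v \<le> (norm v)\<^sup>2"
      unfolding qx using zero_le_power2[of "norm (a v)"] by linarith
  qed
  obtain y where y: "y \<in> N" "self_adjoint y" "norm y \<le> 1"
    and yeq: "y = (1/2) *\<^sub>R (x + (y o\<^sub>L y))"
    and comm: "\<And>(z :: 'h \<Rightarrow>\<^sub>L 'h) v. (\<And>u. z (x u) = x (z u)) \<Longrightarrow> z (y v) = y (z v)"
    using sqrt_exists[OF xN px nx] by blast
  have ay: "a (y v) = y (a v)" for v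
    by (rule comm) (simp add: x_def op_simps ea[OF a(1)] ae[OF a(1,2)])
  define b where "b = e - y"
  have bN: "b \<in> N" unfolding b_def by (intro diff_mem e y)
  have sb: "self_adjoint b" unfolding b_def by (intro adjoint_pair_diff projectionD(1) e y)
  have pb: "positive_op b"
    unfolding positive_op_def
  proof (intro conjI allI sb)
    fix v
    have "inner (y v) v = inner (y (e v)) (e v)"
      using adjoint_pairD[OF projectionD(1)[OF e(2)], of "y v" v] ea[OF y(1)] ae[OF y(1,2)] by simp
    also have "\<dots> \<le> norm (y (e v)) * norm (e v)" by (rule norm_cauchy_schwarz)
    also have "\<dots> \<le> norm (e v) * norm (e v)" by (intro mult_right_mono contraction_le y) auto
    also have "\<dots> = inner (e v) v"
      using projection_norm_square[OF e(2)] by (simp add: power2_eq_square)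
    finally show "0 \<le> inner (b v) v" by (simp add: b_def op_simps)
  qed
  have bb: "b (b v) = a (a v)" for v
  proof -
    have "2 *\<^sub>R y v = e v - a (a v) + y (y v)"
      using arg_cong[OF yeq, of "\<lambda>a. 2 *\<^sub>R a v"] by (simp add: x_def op_simps)
    then show ?thesis
      by (simp add: b_def op_simps projectionD(3)[OF e(2)] ea[OF y(1)] ae[OF y(1,2)] scaleR_2)
        (simp add: algebra_simps)
  qed
  have ab: "a (b v) = b (a v)" for v
    by (simp add: b_def op_simps ay ea[OF a(1)] ae[OF a(1,2)])
  have nb: "norm b \<le> 1"
  proof (rule norm_blinfun_bound)
    fix v
    have "(norm (b v))\<^sup>2 = (norm (a v))\<^sup>2"
      using adjoint_pairD[OF sb, of "b v" v] adjoint_pairD[OF a(2), of "a v" v]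
      by (simp add: power2_norm_eq_inner bb)
    then show "norm (b v) \<le> 1 * norm v" using contraction_le[OF a(3), of v] by simp
  qed simp
  define h where "h = (1/2) *\<^sub>R (b - a)"
  have hN: "h \<in> N" and sh: "self_adjoint h"
    unfolding h_def by (intro scaleR_mem diff_mem bN a adjoint_pair_scaleR adjoint_pair_diff sb)+
  have nh: "norm h \<le> 1" using norm_triangle_ineq4[of b a] nb a(3) by (simp add: h_def)
  have hh: "h o\<^sub>L h \<in> N" "positive_op (h o\<^sub>L h)" "norm (h o\<^sub>L h) \<le> 1"
    by (intro compose_mem hN positive_op_square sh norm_compose_le_1 nh)+
  obtain m where m: "m \<in> N" "projection m" "(h o\<^sub>L h) o\<^sub>L m = h o\<^sub>L h"
    and m0: "\<And>v. (h o\<^sub>L h) v = 0 \<Longrightarrow> m v = 0"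
    using range_projection[OF hh] by blast
  from triv[OF m(1,2)] show ?thesis
  proof
    assume "m = 0"
    then have hh0: "h (h v) = 0" for v using arg_cong[OF m(3), of "\<lambda>a. a v"] by simp
    have "h v = 0" for v
      using adjoint_pairD[OF sh, of v "h v"] hh0[of v] by simp
    then have "b v = a v" for v by (simp add: h_def op_simps)
    then have "b = a" by (rule blinfun_eqI)
    with pb show ?thesis by simp
  next
    assume me: "m = e"
    have "(b - a) ((b + a) v) = 0" for v by (simp add: op_simps bb ab)
    then have h0: "h ((b + a) v) = 0" for v by (simp add: h_def blinfun.scaleR_left)
    have "(h o\<^sub>L h) ((b + a) v) = 0" for v
      unfolding blinfun_apply_blinfun_compose h0 by (simp add: blinfun.zero_right)
    then have "e ((b + a) v) = 0" for v using m0 me by blast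
    then have "b v = (- a) v" for v
      using ea[OF add_mem[OF bN a(1)], of v] by (simp add: op_simps add_eq_0_iff2)
    then have "b = - a" by (rule blinfun_eqI)
    with pb show ?thesis by simp
  qed
qed

text \<open>Definiteness of all self-adjoint elements makes their order total. Subtract the multiple
  of \<open>e\<close> for which the form vanishes at a fixed vector of the range of
  \<open>e\<close>; a definite element with such a zero is 0.\<close>

lemma scalar_without_projections:
  assumes e: "e \<in> N" "projection e" "\<And>a. a \<in> N \<Longrightarrow> e o\<^sub>L a = a"
    and triv: "\<And>m. m \<in> N \<Longrightarrow> projection m \<Longrightarrow> m = 0 \<or> m = e"
    and a: "a \<in> N" "self_adjoint a"
  shows "\<exists>t. a = t *\<^sub>R e"
proof (cases "e = 0")
  case True
  then show ?thesis using e(3)[OF a(1)] by auto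
next
  case False
  have def: "positive_op c \<or> positive_op (- c)" if c: "c \<in> N" "self_adjoint c" for c
  proof (cases "c = 0")
    case True
    then show ?thesis by (simp add: positive_op_def adjoint_pair_zero)
  next
    case False
    have "positive_op ((1 / norm c) *\<^sub>R c) \<or> positive_op (- ((1 / norm c) *\<^sub>R c))"
      by (rule definite_without_projections[OF e triv])
        (use c in \<open>auto intro: scaleR_mem adjoint_pair_scaleR\<close>)
    then show ?thesis
      using positive_op_scaleR[of "(1 / norm c) *\<^sub>R c" "norm c"]
        positive_op_scaleR[of "- ((1 / norm c) *\<^sub>R c)" "norm c"] False by auto
  qed
  obtain w where "e w \<noteq> 0" using False by (metis blinfun_eqI zero_blinfun.rep_eq)
  define v where "v = e w"
  have v: "e v = v" "v \<noteq> 0" using \<open>e w \<noteq> 0\<close> by (auto simp: v_def projectionD(3)[OF e(2)])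
  \<comment> \<open>For s > 0 the element c - s e is negative at \<open>v\<close>, hence negative
    everywhere. So c \<le> s e for every s > 0.\<close>
  have zero: "c = 0" if c: "c \<in> N" "positive_op c" "inner (c v) v = 0" for c
  proof (rule self_adjoint_eq_0)
    show sc: "self_adjoint c" using c by (simp add: positive_op_def)
    fix x
    have "inner (c x) x \<le> s * inner (e x) x" if s: "s > 0" for s
    proof -
      let ?d = "c - s *\<^sub>R e"
      have "inner (?d v) v < 0" using c(3) v s by (simp add: op_simps)
      then have "\<not> positive_op ?d" unfolding positive_op_def using not_le by blast
      moreover have "positive_op ?d \<or> positive_op (- ?d)"
        by (intro def diff_mem scaleR_mem c e adjoint_pair_diff adjoint_pair_scaleR sc projectionD(1))
      ultimately have "positive_op (- ?d)" by blast
      then have "0 \<le> inner ((- ?d) x) x" unfolding positive_op_def by blast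
      then show ?thesis by (simp add: op_simps)
    qed
    moreover have "((\<lambda>s. s * inner (e x) x) \<longlongrightarrow> 0) (at_right 0)"
      by (auto intro!: tendsto_eq_intros)
    ultimately have "inner (c x) x \<le> 0"
      by (intro tendsto_lowerbound[of "\<lambda>s. s * inner (e x) x" 0 "at_right 0"])
        (auto simp: eventually_at_right_less intro: eventually_mono[OF eventually_at_right_less])
    then show "inner (c x) x = 0" using c(2) unfolding positive_op_def by (simp add: antisym)
  qed
  define t where "t = inner (a v) v / inner v v"
  define c where "c = a - t *\<^sub>R e"
  have cN: "c \<in> N" "- c \<in> N" "self_adjoint c"
    unfolding c_def by (intro diff_mem uminus_mem scaleR_mem a e adjoint_pair_diff
        adjoint_pair_scaleR projectionD(1))+
  have "inner (c v) v = 0" using v by (simp add: c_def op_simps t_def)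
  moreover from this have "inner ((- c) v) v = 0" by (simp add: op_simps)
  ultimately have "c = 0" using def[OF cN(1,3)] zero cN by fastforce
  then show ?thesis by (auto simp: c_def)
qed

text \<open>A nonzero \<open>N\<close> contains a nonzero projection, which must be
  \<open>e\<close>. Its elements are then complex multiples of \<open>e\<close>, and for these
  weakly null means that the coefficients tend to 0.\<close>

lemma sot_compact_without_projections:
  assumes e: "\<And>a. a \<in> N \<Longrightarrow> e o\<^sub>L a = a"
    and triv: "\<And>m. m \<in> N \<Longrightarrow> projection m \<Longrightarrow> m = 0 \<or> m = e"
  shows "sot_compact N"
proof (cases "N = {0}")
  case True
  then show ?thesis unfolding sot_compact_def by (auto simp: sconv_def)
next
  case False
  then obtain a where "a \<in> N" "a \<noteq> 0" using zero_mem by blast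
  then obtain m where "m \<in> N" "projection m" "m \<noteq> 0" by (rule nonzero_projection)
  then have eN: "e \<in> N" "projection e" "e \<noteq> 0" using triv by blast+
  obtain w where "e w \<noteq> 0" using eN(3) by (metis blinfun_eqI zero_blinfun.rep_eq)
  define v where "v = e w"
  have v: "e v = v" "v \<noteq> 0" using \<open>e w \<noteq> 0\<close> by (auto simp: v_def projectionD(3)[OF eN(2)])
  \<comment> \<open>\<open>v\<close> and \<open>J v\<close> are orthogonal and equally long, so
    pairing with them reads off both real coordinates of a complex multiple of
    \<open>e\<close>.\<close>
  have Jv: "inner (J v) v = 0" "inner v (J v) = 0" "inner (J v) (J v) = inner v v"
    using adjoint_pairD[OF J_skew, of v v] norm_J[of v]
    by (simp_all add: op_simps inner_commute norm_eq_sqrt_inner)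
  have scalar: "\<exists>s t. \<forall>x. c x = s *\<^sub>R e x + t *\<^sub>R J (e x)" if c: "c \<in> N" "norm c \<le> 1" for c
  proof -
    obtain d where d: "d \<in> N" "adjoint_pair c d" using adjoint_mem c by blast
    note cart = cartesian_decomposition[OF c d]
    obtain s t where st: "(1/2) *\<^sub>R (c + d) = s *\<^sub>R e" "(-1/2) *\<^sub>R (J o\<^sub>L (c - d)) = t *\<^sub>R e"
      using scalar_without_projections[OF eN(1,2) e triv cart(1,2)]
        scalar_without_projections[OF eN(1,2) e triv cart(4,5)] by blast
    have eq: "s *\<^sub>R e + (J o\<^sub>L (t *\<^sub>R e)) = c" using cart(7) unfolding st .
    have "c x = s *\<^sub>R e x + t *\<^sub>R J (e x)" for x
      using arg_cong[OF eq, of "\<lambda>a. a x"] by (simp add: blinfun.bilinear_simps)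
    then show ?thesis by blast
  qed
  show ?thesis
    unfolding sot_compact_def
  proof (intro allI impI)
    fix c assume c: "\<forall>n. c n \<in> N" "\<forall>n. norm (c n) \<le> 1" "wconv c 0"
    have "\<forall>n. \<exists>p. \<forall>x. c n x = fst p *\<^sub>R e x + snd p *\<^sub>R J (e x)" using scalar c by fastforce
    from choice[OF this] obtain p
      where p: "\<And>n x. c n x = fst (p n) *\<^sub>R e x + snd (p n) *\<^sub>R J (e x)" by blast
    define s t where "s n = fst (p n)" and "t n = snd (p n)" for n
    have st: "c n x = s n *\<^sub>R e x + t n *\<^sub>R J (e x)" for n x by (simp add: p s_def t_def)
    have "(\<lambda>n. inner (c n v) v) \<longlonglongrightarrow> 0" "(\<lambda>n. inner (c n v) (J v)) \<longlonglongrightarrow> 0"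
      using wconvD[OF c(3), of v] by (auto simp: op_simps)
    moreover have "inner (c n v) v = s n * inner v v" "inner (c n v) (J v) = t n * inner v v" for n
      unfolding st v(1) by (simp_all add: inner_add_left Jv)
    ultimately have "(\<lambda>n. s n * inner v v) \<longlonglongrightarrow> 0" "(\<lambda>n. t n * inner v v) \<longlonglongrightarrow> 0"
      by simp_all
    then have "s \<longlonglongrightarrow> 0" "t \<longlonglongrightarrow> 0"
      using tendsto_mult_right_iff[of "inner v v" _ 0 sequentially] v(2) by (simp_all add: tendsto_mult_left_iff)
    then have "(\<lambda>n. s n *\<^sub>R e x + t n *\<^sub>R J (e x)) \<longlonglongrightarrow> 0 *\<^sub>R e x + 0 *\<^sub>R J (e x)" for x
      by (intro tendsto_intros)
    then show "sconv c 0" by (simp add: sconv_def st)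
  qed
qed

end

section \<open>Reduction to small projections\<close>

text \<open>A weighted sum of vector functionals that, for a total sequence \<open>v\<close>, is
  strictly monotone on projections; it measures the progress towards a minimal one. The geometric
  factors provide summability.\<close>

definition proj_weight :: "(nat \<Rightarrow> 'h::real_inner) \<Rightarrow> ('h \<Rightarrow>\<^sub>L 'h) \<Rightarrow> real" where
  "proj_weight v e = (\<Sum>i. (1/2)^i * (norm (e (v i)))\<^sup>2)"

lemma proj_weight_summable:
  assumes "projection e" "\<And>i. norm (v i) \<le> 1"
  shows "summable (\<lambda>i. (1/2)^i * (norm (e (v i)))\<^sup>2 :: real)"
proof (rule summable_comparison_test')
  show "summable (\<lambda>i. (1/2::real)^i)" by (rule summable_geometric) simp
  fix i
  have "norm (e (v i)) \<le> 1"
    using contraction_le[OF projection_norm_le[OF assms(1)], of "v i"] assms(2)[of i] by linarith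
  then have "(norm (e (v i)))\<^sup>2 \<le> 1" by (simp add: power_le_one)
  then show "norm ((1/2)^i * (norm (e (v i)))\<^sup>2) \<le> (1/2)^i" by simp
qed

lemma proj_weight_nonneg: "projection e \<Longrightarrow> (\<And>i. norm (v i) \<le> 1) \<Longrightarrow> 0 \<le> proj_weight v e"
  unfolding proj_weight_def by (intro suminf_nonneg proj_weight_summable) auto

lemma proj_weight_diff:
  assumes "projection e" "projection f" "e o\<^sub>L f = f" "\<And>i. norm (v i) \<le> 1"
  shows "proj_weight v e = proj_weight v f + proj_weight v (e - f)"
proof -
  note ef = projection_diff(1)[OF assms(1-3)]
  have "(norm (e x))\<^sup>2 = (norm (f x))\<^sup>2 + (norm ((e - f) x))\<^sup>2" for x
    unfolding projection_norm_square[OF assms(1)] projection_norm_square[OF assms(2)]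
      projection_norm_square[OF ef] by (simp add: op_simps)
  then show ?thesis
    unfolding proj_weight_def
    by (subst suminf_add) (auto simp: distrib_left intro!: proj_weight_summable assms ef)
qed

lemma proj_weight_eq_0:
  assumes "projection e" "\<And>i. norm (v i) \<le> 1" "proj_weight v e \<le> 0"
    and total: "\<And>x. (\<And>i. inner x (v i) = 0) \<Longrightarrow> x = 0"
  shows "e = 0"
proof -
  have "proj_weight v e = 0" using assms(3) proj_weight_nonneg[of e v] assms(1,2) by fastforce
  then have "(1/2)^i * (norm (e (v i)))\<^sup>2 = 0" for i
    using suminf_eq_zero_iff[OF proj_weight_summable[OF assms(1,2)]] unfolding proj_weight_def by auto
  then have "e (v i) = 0" for i by simp
  then have "inner (e x) (v i) = 0" for x i
    using adjoint_pairD[OF projectionD(1)[OF assms(1)]] by simp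
  then have "e x = 0" for x by (rule total)
  then show ?thesis by (intro blinfun_eqI) simp
qed

context vn_algebra
begin

lemma multiplier_proj_diff:
  assumes e: "multiplier_proj e" and f: "multiplier_proj f" and ef: "e o\<^sub>L f = f"
  shows "multiplier_proj (e - f)"
proof -
  have "projection (e - f)" using projection_diff e f ef multiplier_projD(1) by blast
  moreover have "e - f \<in> N \<or> id_blinfun - (e - f) \<in> N"
  proof (cases "e \<in> N")
    case True
    then have "f \<in> N" using multiplier_projD(3)[OF f, of e] ef by simp
    then show ?thesis using diff_mem True by blast
  next
    case False
    then have e': "id_blinfun - e \<in> N" using e multiplier_proj_def by blast
    from f consider "f \<in> N" | "id_blinfun - f \<in> N" unfolding multiplier_proj_def by blast
    then show ?thesis
    proof cases
      case 1
      from add_mem[OF e' this] show ?thesis by (simp add: algebra_simps)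
    next
      case 2
      from diff_mem[OF this e'] show ?thesis by simp
    qed
  qed
  ultimately show ?thesis by (simp add: multiplier_proj_def)
qed

text \<open>Without a proper subprojection \<open>f\<close> the corner would be compact.
  \<open>f\<close> and \<open>e - f\<close> cannot both have compact corners, as compactness would
  pass to their sum \<open>e\<close>.\<close>

lemma split_big_corner:
  assumes e: "multiplier_proj e" "\<not> sot_compact (corner e N)"
  obtains g where "multiplier_proj g" "e o\<^sub>L g = g" "g \<noteq> e" "\<not> sot_compact (corner g N)"
proof -
  obtain f where f: "f \<in> corner e N" "projection f" "f \<noteq> 0" "f \<noteq> e"
    using vn_algebra.sot_compact_without_projections[OF vn_algebra_corner[OF e(1)], of e]
      cornerD(2) e(2) by blast
  have mf: "multiplier_proj f" using f cornerD(1) by (auto simp: multiplier_proj_def)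
  have ef: "e o\<^sub>L f = f" using cornerD(2)[OF f(1)] .
  have mef: "multiplier_proj (e - f)" by (rule multiplier_proj_diff[OF e(1) mf ef])
  show thesis
  proof (cases "sot_compact (corner f N)")
    case False
    then show ?thesis using that mf ef f(4) by blast
  next
    case True
    then have "\<not> sot_compact (corner (e - f) N)"
      using sot_compact_corner_add[OF mf True mef] e(2) by auto
    moreover have "e o\<^sub>L (e - f) = e - f"
      using ef projectionD(2)[OF multiplier_projD(1)[OF e(1)]]
      by (simp add: bounded_bilinear.diff_right[OF bounded_bilinear_blinfun_compose])
    ultimately show ?thesis using that mef f(3) by fastforce
  qed
qed

text \<open>Once one term lies in \<open>N\<close>, all later ones do, being its products with
  multipliers; otherwise all complements lie in \<open>N\<close>. Either way
  \<open>compactness\<close> applies to a tail.\<close>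

lemma decreasing_multiplier_limit:
  assumes e: "\<And>n. multiplier_proj (e n)" and le: "\<And>m n. m \<le> n \<Longrightarrow> e m o\<^sub>L e n = e n"
  obtains \<phi> p where "strict_mono (\<phi> :: nat \<Rightarrow> nat)" "multiplier_proj p" "\<And>n. e n o\<^sub>L p = p"
    "wconv (\<lambda>n. e (\<phi> n)) p"
proof -
  have ne: "norm (e n) \<le> 1" for n by (rule projection_norm_le[OF multiplier_projD(1)[OF e]])
  obtain \<phi> p where \<phi>: "strict_mono (\<phi> :: nat \<Rightarrow> nat)" and lim: "wconv (\<lambda>n. e (\<phi> n)) p"
    and pN: "p \<in> N \<or> id_blinfun - p \<in> N"
  proof (cases "\<exists>k. e k \<in> N")
    case True
    then obtain k where k: "e k \<in> N" by blast
    have "e (n + k) \<in> N" for n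
      using multiplier_projD(3)[OF e, OF k, of "n + k"] le[of k "n + k"] by simp
    then obtain \<phi> p where "strict_mono (\<phi> :: nat \<Rightarrow> nat)" "p \<in> N" "wconv (\<lambda>n. e (\<phi> n + k)) p"
      using compactness[of "\<lambda>n. e (n + k)" 1] ne by blast
    then show ?thesis using that[of "\<lambda>n. \<phi> n + k" p] by (simp add: strict_mono_def)
  next
    case False
    then have "id_blinfun - e n \<in> N" for n using e multiplier_proj_def by blast
    then have "e n - id_blinfun \<in> N" for n using uminus_mem by fastforce
    then obtain \<phi> p where "strict_mono (\<phi> :: nat \<Rightarrow> nat)" "p - id_blinfun \<in> N" "wconv (\<lambda>n. e (\<phi> n)) p"
      using one_plus_compactness[of e] ne by blast
    then show ?thesis using that[of \<phi> p] uminus_mem[of "p - id_blinfun"] by simp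
  qed
  have emp: "e m o\<^sub>L p = p" for m
  proof (rule wconv_unique)
    have shift: "wconv (\<lambda>n. e (\<phi> (n + m))) p"
      using wconv_subseq[OF lim, of "\<lambda>n. n + m"] by (simp add: strict_mono_def)
    show "wconv (\<lambda>n. e m o\<^sub>L e (\<phi> (n + m))) (e m o\<^sub>L p)"
      by (rule wconv_compose_left[OF projectionD(1)[OF multiplier_projD(1)[OF e]] shift])
    have "m \<le> \<phi> (n + m)" for n using seq_suble[OF \<phi>, of "n + m"] by simp
    then show "wconv (\<lambda>n. e m o\<^sub>L e (\<phi> (n + m))) p" using shift by (simp add: le)
  qed
  have "wconv (\<lambda>n. p) (p o\<^sub>L p)" using wconv_compose_right[OF lim, of p] by (simp add: emp)
  then have "p o\<^sub>L p = p" by (rule wconv_unique[OF _ wconv_const])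
  moreover have "self_adjoint p"
    by (rule wconv_self_adjoint[OF lim projectionD(1)[OF multiplier_projD(1)[OF e]]])
  ultimately have "multiplier_proj p" using pN by (simp add: multiplier_proj_def projection_def)
  with \<phi> lim emp show ?thesis using that by blast
qed

text \<open>If \<open>N\<close> is not compact, there is a projection \<open>p\<close> minimal among those with
  non-compact corner: limits of decreasing sequences of such projections are again such, because
  the differences are eventually small. Minimality contradicts \<open>split_big_corner\<close>.\<close>

lemma sot_compact_of_small_corners:
  fixes v :: "nat \<Rightarrow> 'h"
  assumes v: "\<And>i. norm (v i) \<le> 1" "\<And>x. (\<And>i. inner x (v i) = 0) \<Longrightarrow> x = 0"
    and small: "\<And>e. (\<And>n. multiplier_proj (e n)) \<Longrightarrow> sconv e 0 \<Longrightarrow> \<exists>n. sot_compact (corner (e n) N)"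
  shows "sot_compact N"
proof (rule ccontr)
  assume nc: "\<not> sot_compact N"
  define big where "big e \<longleftrightarrow> multiplier_proj e \<and> \<not> sot_compact (corner e N)" for e
  let ?w = "proj_weight v"
  have bigD: "multiplier_proj e" "projection e" if "big e" for e
    using that multiplier_projD(1) by (auto simp: big_def)
  have "multiplier_proj id_blinfun"
    by (simp add: multiplier_proj_def projection_id zero_mem)
  then have b0: "big id_blinfun" using nc by (simp add: big_def corner_id)
  \<comment> \<open>An exact minimiser of the weight need not exist below \<open>e\<close>. A slack
    \<open>d\<close>, later 1/(n+1), is enough because it vanishes in the limit.\<close>
  have step: "\<exists>f. big f \<and> e o\<^sub>L f = f \<and> (\<forall>g. big g \<longrightarrow> e o\<^sub>L g = g \<longrightarrow> ?w f \<le> ?w g + d)"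
    if e: "big e" and d: "d > 0" for e d
  proof -
    let ?S = "?w ` {f. big f \<and> e o\<^sub>L f = f}"
    have "e \<in> {f. big f \<and> e o\<^sub>L f = f}" using e projectionD(2)[OF bigD(2)[OF e]] by simp
    then have ne: "?S \<noteq> {}" by blast
    have bdd: "bdd_below ?S"
      by (rule bdd_belowI[of _ 0]) (auto intro: proj_weight_nonneg bigD v)
    obtain f where "big f" "e o\<^sub>L f = f" "?w f < Inf ?S + d"
      using cInf_lessD[OF ne, of "Inf ?S + d"] d by auto
    moreover have "Inf ?S \<le> ?w g" if "big g" "e o\<^sub>L g = g" for g
      by (rule cInf_lower[OF _ bdd]) (use that in blast)
    ultimately show ?thesis by (smt (verit))
  qed
  have "\<exists>e. \<forall>n. big (e n) \<and> (e n o\<^sub>L e (Suc n) = e (Suc n) \<and>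
      (\<forall>g. big g \<longrightarrow> e n o\<^sub>L g = g \<longrightarrow> ?w (e (Suc n)) \<le> ?w g + 1 / Suc n))"
  proof (rule dependent_nat_choice[of "\<lambda>_. big" "\<lambda>n e f. e o\<^sub>L f = f \<and>
      (\<forall>g. big g \<longrightarrow> e o\<^sub>L g = g \<longrightarrow> ?w f \<le> ?w g + 1 / Suc n)"])
    show "\<exists>f. big f \<and> e o\<^sub>L f = f \<and> (\<forall>g. big g \<longrightarrow> e o\<^sub>L g = g \<longrightarrow> ?w f \<le> ?w g + 1 / Suc n)"
      if "big e" for e n using step[OF that, of "1 / Suc n"] by simp
  qed (use b0 in blast)
  then obtain e where big_e: "\<And>n. big (e n)" and e_Suc: "\<And>n. e n o\<^sub>L e (Suc n) = e (Suc n)"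
    and e_min: "\<And>n g. big g \<Longrightarrow> e n o\<^sub>L g = g \<Longrightarrow> ?w (e (Suc n)) \<le> ?w g + 1 / Suc n"
    by blast
  have le: "e m o\<^sub>L e n = e n" if "m \<le> n" for m n
    using that
  proof (induction n rule: dec_induct)
    case base
    show ?case by (rule projectionD(2)[OF bigD(2)[OF big_e]])
  next
    case (step n)
    show ?case
    proof (rule blinfun_eqI)
      fix x
      have 1: "e n (e (Suc n) x) = e (Suc n) x" using arg_cong[OF e_Suc[of n], of "\<lambda>a. a x"] by simp
      have "e m (e n (e (Suc n) x)) = e n (e (Suc n) x)"
        using arg_cong[OF step.IH, of "\<lambda>a. a (e (Suc n) x)"] by simp
      then show "(e m o\<^sub>L e (Suc n)) x = e (Suc n) x" unfolding 1 by simp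
    qed
  qed
  obtain \<phi> p where \<phi>: "strict_mono (\<phi> :: nat \<Rightarrow> nat)" and p: "multiplier_proj p"
    and ep: "\<And>n. e n o\<^sub>L p = p" and lim: "wconv (\<lambda>n. e (\<phi> n)) p"
    using decreasing_multiplier_limit[of e, OF bigD(1)[OF big_e] le] by blast
  have md: "multiplier_proj (e n - p)" for n
    by (rule multiplier_proj_diff[OF bigD(1)[OF big_e] p ep])
  \<comment> \<open>The differences are projections, so convergence of their quadratic forms is
    already strong convergence.\<close>
  have "sconv (\<lambda>n. e (\<phi> n) - p) 0"
    unfolding sconv_def
  proof
    fix x
    have "(\<lambda>n. inner ((e (\<phi> n) - p) x) x) \<longlonglongrightarrow> 0"
      using wconvD[OF wconv_diff[OF lim wconv_const[of p]], of x x] by simp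
    then have "(\<lambda>n. (norm ((e (\<phi> n) - p) x))\<^sup>2) \<longlonglongrightarrow> 0"
      by (simp only: projection_norm_square[OF multiplier_projD(1)[OF md]])
    then show "(\<lambda>n. (e (\<phi> n) - p) x) \<longlonglongrightarrow> blinfun_apply 0 x"
      by (simp add: tendsto_norm_zero_iff)
  qed
  then obtain k where k: "sot_compact (corner (e (\<phi> k) - p) N)"
    using small[of "\<lambda>n. e (\<phi> n) - p"] md by blast
  \<comment> \<open>Otherwise \<open>e (\<phi> k)\<close> would be a sum of two projections with
    compact corners.\<close>
  have "\<not> sot_compact (corner p N)"
    using sot_compact_corner_add[OF md k p] big_e by (auto simp: big_def)
  then obtain g where g: "multiplier_proj g" "p o\<^sub>L g = g" "g \<noteq> p" "\<not> sot_compact (corner g N)"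
    by (rule split_big_corner[OF p])
  have "e n o\<^sub>L g = g" for n
  proof (rule blinfun_eqI)
    fix x
    have "e n (p (g x)) = p (g x)" using arg_cong[OF ep, of "\<lambda>a. a (g x)"] by simp
    moreover have "p (g x) = g x" using arg_cong[OF g(2), of "\<lambda>a. a x"] by simp
    ultimately show "(e n o\<^sub>L g) x = g x" by simp
  qed
  \<comment> \<open>\<open>g\<close> lies below every \<open>e n\<close> and so competes in every
    minimisation. Its weight is therefore at least that of \<open>p\<close>, and
    \<open>p - g\<close> has weight 0.\<close>
  then have "?w (e (Suc n)) \<le> ?w g + 1 / Suc n" for n
    using e_min g by (simp add: big_def)
  moreover have "?w p \<le> ?w (e (Suc n))" for n
    using proj_weight_diff[of "e (Suc n)" p v, OF bigD(2)[OF big_e] multiplier_projD(1)[OF p] ep v(1)]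
      proj_weight_nonneg[of "e (Suc n) - p" v, OF multiplier_projD(1)[OF md] v(1)] by linarith
  ultimately have "?w p \<le> ?w g + inverse (real (Suc n))" for n
    by (metis inverse_eq_divide order_trans)
  then have "?w p \<le> ?w g"
    by (intro LIMSEQ_le_const[OF LIMSEQ_inverse_real_of_nat_add]) blast
  moreover have "multiplier_proj (p - g)" by (rule multiplier_proj_diff[OF p g(1,2)])
  ultimately have "p - g = 0"
    using proj_weight_diff[of p g v, OF multiplier_projD(1)[OF p] multiplier_projD(1)[OF g(1)] g(2) v(1)]
    by (intro proj_weight_eq_0[of "p - g" v, OF multiplier_projD(1) v(1) _ v(2)]) auto
  with g(3) show False by simp
qed

end

section \<open>A Baire category argument\<close>

lemma tendsto_fun_iff:
  fixes f :: "'c \<Rightarrow> 'i \<Rightarrow> 'b::topological_space"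
  shows "(f \<longlongrightarrow> l) F \<longleftrightarrow> (\<forall>i. ((\<lambda>c. f c i) \<longlongrightarrow> l i) F)"
  using limitin_componentwise[of "\<lambda>_::'i. euclidean :: 'b topology" UNIV f l F]
  by (simp add: euclidean_product_topology)

text \<open>Countably many matrix coefficients embed \<open>K\<close> as a compact subset of a
  product of lines, where the category theorem holds. The conclusion is the sequential form of
  \<open>a\<close> being interior to \<open>Q n\<close>: sequences in \<open>K\<close> tending
  weakly to \<open>a\<close> meet \<open>Q n\<close>.\<close>

lemma baire_wconv:
  fixes v :: "nat \<Rightarrow> 'h::real_inner" and K :: "('h \<Rightarrow>\<^sub>L 'h) set" and Q :: "nat \<Rightarrow> ('h \<Rightarrow>\<^sub>L 'h) set"
  assumes "K \<noteq> {}"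
    and compact: "\<And>s. (\<And>n. s n \<in> K) \<Longrightarrow> \<exists>\<phi> a. strict_mono (\<phi> :: nat \<Rightarrow> nat) \<and> a \<in> K \<and> wconv (\<lambda>n. s (\<phi> n)) a"
    and sep: "\<And>a b. a \<in> K \<Longrightarrow> b \<in> K \<Longrightarrow> (\<And>i j. inner (a (v i)) (v j) = inner (b (v i)) (v j)) \<Longrightarrow> a = b"
    and closed: "\<And>n s a. (\<And>k. s k \<in> Q n) \<Longrightarrow> (\<And>k. s k \<in> K) \<Longrightarrow> a \<in> K \<Longrightarrow> wconv s a \<Longrightarrow> a \<in> Q n"
    and cover: "K \<subseteq> (\<Union>n. Q n)"
  obtains a n where "a \<in> K" "\<And>s. (\<And>k. s k \<in> K) \<Longrightarrow> wconv s a \<Longrightarrow> \<exists>k. s k \<in> Q n"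
proof -
  define \<Psi> :: "('h \<Rightarrow>\<^sub>L 'h) \<Rightarrow> nat \<Rightarrow> real"
    where "\<Psi> a = (\<lambda>p. inner (a (v (fst (prod_decode p)))) (v (snd (prod_decode p))))" for a
  have inj: "inj_on \<Psi> K"
  proof (rule inj_onI)
    fix a b assume ab: "a \<in> K" "b \<in> K" "\<Psi> a = \<Psi> b"
    show "a = b"
    proof (rule sep[OF ab(1,2)])
      show "inner (a (v i)) (v j) = inner (b (v i)) (v j)" for i j
        using fun_cong[OF ab(3), of "prod_encode (i, j)"] by (simp add: \<Psi>_def)
    qed
  qed
  have cont: "(\<lambda>n. \<Psi> (s n)) \<longlonglongrightarrow> \<Psi> a" if "wconv s a" for s a
    unfolding tendsto_fun_iff \<Psi>_def using wconvD[OF that] by blast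
  have comp: "compact (\<Psi> ` A)"
    if A: "A \<subseteq> K" "\<And>s a. (\<And>k. s k \<in> A) \<Longrightarrow> a \<in> K \<Longrightarrow> wconv s a \<Longrightarrow> a \<in> A" for A
    unfolding compact_eq_seq_compact_metric seq_compact_def
  proof (intro allI impI)
    fix f :: "nat \<Rightarrow> nat \<Rightarrow> real" assume "\<forall>n. f n \<in> \<Psi> ` A"
    then have "\<forall>n. \<exists>a. a \<in> A \<and> f n = \<Psi> a" by blast
    from choice[OF this] obtain s where s: "\<And>n. s n \<in> A" "\<And>n. f n = \<Psi> (s n)" by blast
    obtain \<phi> a where \<phi>: "strict_mono (\<phi> :: nat \<Rightarrow> nat)" "a \<in> K" "wconv (\<lambda>n. s (\<phi> n)) a"
      using compact[of s] s A by blast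
    have "a \<in> A" by (rule A(2)[OF _ \<phi>(2,3)]) (rule s)
    moreover have "(f \<circ> \<phi>) \<longlonglongrightarrow> \<Psi> a" using cont[OF \<phi>(3)] by (simp add: comp_def s)
    ultimately show "\<exists>l\<in>\<Psi> ` A. \<exists>r. strict_mono r \<and> (f \<circ> r) \<longlonglongrightarrow> l" using \<phi>(1) by blast
  qed
  define S where "S = \<Psi> ` K"
  define T where "T n = \<Psi> ` (K \<inter> Q n)" for n
  have cS: "compact S" unfolding S_def by (rule comp) auto
  have cT: "compact (T n)" for n
    unfolding T_def by (rule comp) (use closed in blast)+
  let ?X = "top_of_set S"
  have "completely_metrizable_space ?X \<or> locally_compact_space ?X \<and> regular_space ?X"
    using cS by (intro disjI2 conjI compact_imp_locally_compact_space metrizable_imp_regular_space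
        metrizable_space_subtopology metrizable_space_euclidean)
      (simp add: compact_space_subtopology)
  note baire = Baire_category_alt[OF this, of "range T"]
  have "\<exists>n. ?X interior_of (T n) \<noteq> {}"
  proof (rule ccontr)
    assume "\<not> ?thesis"
    moreover have "closedin ?X (T n)" for n
      by (rule closed_subset[OF _ compact_imp_closed[OF cT]]) (auto simp: T_def S_def)
    ultimately have "?X interior_of (\<Union> (range T)) = {}" by (intro baire) auto
    moreover have "\<Union> (range T) = S" unfolding T_def S_def using cover by blast
    moreover have "?X interior_of S = S" by (metis interior_of_topspace topspace_euclidean_subtopology)
    ultimately show False using assms(1) by (simp add: S_def)
  qed
  then obtain n x where x: "x \<in> ?X interior_of (T n)" by blast
  then obtain U where U: "open U" "x \<in> U" "S \<inter> U \<subseteq> T n" and xS: "x \<in> S"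
    by (auto simp: interior_of_def openin_open)
  then obtain a where a: "a \<in> K" "x = \<Psi> a" by (auto simp: S_def)
  show thesis
  proof (rule that[OF a(1)])
    fix s assume s: "\<And>k. s k \<in> K" "wconv s a"
    have "\<forall>\<^sub>F k in sequentially. \<Psi> (s k) \<in> U"
      using topological_tendstoD[OF cont[OF s(2)] U(1)] U(2) a(2) by simp
    then obtain k where "\<Psi> (s k) \<in> U" by (metis eventually_happens sequentially_bot)
    then have "\<Psi> (s k) \<in> T n" using U(3) s(1) by (auto simp: S_def)
    then obtain b where "b \<in> K" "b \<in> Q n" "\<Psi> (s k) = \<Psi> b" by (auto simp: T_def)
    then have "s k \<in> Q n" using inj s(1) by (metis inj_onD)
    then show "\<exists>k. s k \<in> Q n" ..
  qed
qed

section \<open>Uniformity from a countable cover\<close>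

context vn_algebra
begin

text \<open>Totality means trivial orthogonal complement, so each \<open>c (v i)\<close> is 0. Then
  the range of the adjoint is orthogonal to all \<open>v i\<close>, so the adjoint vanishes and
  \<open>c\<close> with it.\<close>

lemma vectors_separate:
  fixes v :: "nat \<Rightarrow> 'h"
  assumes total: "\<And>x. (\<And>i. inner x (v i) = 0) \<Longrightarrow> x = 0"
    and c: "adjoint_pair c c'" "\<And>i j. inner (c (v i)) (v j) = 0"
  shows "c = 0"
proof -
  have cv: "c (v i) = 0" for i by (rule total) (rule c(2))
  have "inner (c' y) (v i) = 0" for y i
    using adjoint_pairD[OF adjoint_pair_sym[OF c(1)], of y "v i"] by (simp add: cv)
  then have c'0: "c' y = 0" for y by (rule total)
  have "c x = 0" for x
    using adjoint_pairD[OF c(1), of x "c x"] by (simp add: c'0)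
  then show ?thesis by (intro blinfun_eqI) simp
qed

text \<open>Perturbing the point \<open>a\<close> supplied by Baire's theorem to \<open>(1 - e) a (1 - e) + c\<close> with \<open>c\<close> in
  the corner of a small projection \<open>e\<close> stays within the unit ball.\<close>

lemma small_corners_in_differences:
  fixes v :: "nat \<Rightarrow> 'h" and Q :: "nat \<Rightarrow> ('h \<Rightarrow>\<^sub>L 'h) set"
  assumes total: "\<And>x. (\<And>i. inner x (v i) = 0) \<Longrightarrow> x = 0"
    and closed: "\<And>n s a. (\<And>k. s k \<in> Q n) \<Longrightarrow> wconv s a \<Longrightarrow> a \<in> Q n"
    and cover: "\<And>a. a \<in> N \<Longrightarrow> norm a \<le> 1 \<Longrightarrow> \<exists>n. a \<in> Q n"
  obtains n where "\<And>e. (\<And>k. multiplier_proj (e k)) \<Longrightarrow> sconv e 0 \<Longrightarrow>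
    \<exists>k. \<forall>c\<in>corner (e k) N. norm c \<le> 1 \<longrightarrow> (\<exists>a\<in>Q n. \<exists>b\<in>Q n. c = a - b)"
proof -
  let ?K = "{a \<in> N. norm a \<le> 1}"
  obtain a0 n where a0: "a0 \<in> ?K"
    and n: "\<And>s. (\<And>k. s k \<in> ?K) \<Longrightarrow> wconv s a0 \<Longrightarrow> \<exists>k. s k \<in> Q n"
  proof (rule baire_wconv[of ?K v Q])
    show "?K \<noteq> {}" using zero_mem by auto
    show "\<exists>\<phi> a. strict_mono (\<phi> :: nat \<Rightarrow> nat) \<and> a \<in> ?K \<and> wconv (\<lambda>n. s (\<phi> n)) a"
      if "\<And>n. s n \<in> ?K" for s
    proof -
      have sN: "s n \<in> N" "norm (s n) \<le> 1" for n using that by auto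
      obtain \<phi> a where "strict_mono (\<phi> :: nat \<Rightarrow> nat)" "a \<in> N" and lim: "wconv (\<lambda>n. s (\<phi> n)) a"
        using compactness[of s 1] sN by blast
      moreover have "norm a \<le> 1" by (rule wconv_norm_le[OF lim sN(2)])
      ultimately show ?thesis by blast
    qed
    show "a = b" if "a \<in> ?K" "b \<in> ?K" "\<And>i j. inner (a (v i)) (v j) = inner (b (v i)) (v j)" for a b
    proof -
      have "a - b \<in> N" using that by (intro diff_mem) auto
      then obtain c' where "adjoint_pair (a - b) c'" using adjoint_mem by blast
      then have "a - b = 0"
        by (rule vectors_separate[OF total, rotated]) (use that(3) in \<open>simp_all add: op_simps\<close>)
      then show ?thesis by simp
    qed
    show "a \<in> Q n" if "\<And>k. s k \<in> Q n" "wconv s a" for n s a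
      by (rule closed[OF that])
    show "?K \<subseteq> (\<Union>n. Q n)" using cover by blast
  qed blast
  show thesis
  proof (rule that[of n])
    fix e assume e: "\<And>k. multiplier_proj (e k)" and e0: "sconv e 0"
    have pe: "projection (e k)" for k by (rule multiplier_projD(1)[OF e])
    define b where "b k c = ((id_blinfun - e k) o\<^sub>L (a0 o\<^sub>L (id_blinfun - e k))) + c" for k c
    have bK: "b k c \<in> ?K" if c: "c \<in> corner (e k) N" "norm c \<le> 1" for k c
    proof -
      have "b k c = a0 - (e k o\<^sub>L a0) - (a0 o\<^sub>L e k) + (e k o\<^sub>L (a0 o\<^sub>L e k)) + c"
        by (intro blinfun_eqI) (simp add: b_def op_simps)
      then have "b k c \<in> N"
        using a0 c cornerD(1) multiplier_projD(2,3)[OF e] by (auto intro!: add_mem diff_mem)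
      moreover have "norm (b k c) \<le> 1"
      proof (rule norm_blinfun_bound)
        fix x
        let ?f = "id_blinfun - e k"
        have pf: "projection ?f" by (rule projection_compl[OF pe])
        have "c x = e k (c (e k x))" using cornerD(4,5)[OF c(1)] by simp
        then have cx: "b k c x = ?f (a0 (?f x)) + e k (c (e k x))" by (simp add: b_def blinfun.add_left)
        have "inner (?f y) (e k z) = 0" for y z
          using adjoint_pairD[OF projectionD(1)[OF pe[of k]], of "?f y" z]
          by (simp add: op_simps projectionD(3)[OF pe])
        \<comment> \<open>The two blocks act between orthogonal subspaces, so Pythagoras keeps the
          norm of their sum at most 1.\<close>
        then have "(norm (b k c x))\<^sup>2 = (norm (?f (a0 (?f x))))\<^sup>2 + (norm (e k (c (e k x))))\<^sup>2"
          unfolding cx by (intro norm_add_Pythagorean) (simp add: orthogonal_def)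
        also have "\<dots> \<le> (norm (?f x))\<^sup>2 + (norm (e k x))\<^sup>2"
          using a0 c by (intro add_mono power_mono order_trans[OF contraction_le[OF projection_norm_le[OF pf]]]
              order_trans[OF contraction_le[OF projection_norm_le[OF pe]]] contraction_le) auto
        also have "\<dots> = (norm x)\<^sup>2"
          unfolding projection_norm_square[OF pf] projection_norm_square[OF pe]
          by (simp add: op_simps power2_norm_eq_inner)
        finally show "norm (b k c x) \<le> 1 * norm x"
          unfolding mult_1 by (rule power2_le_imp_le) simp
      qed simp
      ultimately show ?thesis by simp
    qed
    have "\<exists>k. \<forall>c\<in>corner (e k) N. norm c \<le> 1 \<longrightarrow> b k c \<in> Q n"
    proof (rule ccontr)
      assume "\<not> ?thesis"
      then have "\<forall>k. \<exists>c. c \<in> corner (e k) N \<and> norm c \<le> 1 \<and> b k c \<notin> Q n" by blast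
      from choice[OF this] obtain c where c: "\<And>k. c k \<in> corner (e k) N" "\<And>k. norm (c k) \<le> 1"
        "\<And>k. b k (c k) \<notin> Q n" by blast
      \<comment> \<open>\<open>c k\<close> factors through \<open>e k\<close>, and the
        \<open>e k\<close> tend strongly to 0; so do contractions in their corners, however they are
        chosen.\<close>
      have "sconv c 0"
        unfolding sconv_def
      proof
        fix x
        have "(\<lambda>k. c k (e k x)) \<longlonglongrightarrow> 0"
          using bounded_apply_tendsto_0[OF c(2), of "\<lambda>k. e k x"] sconvD[OF e0, of x] by simp
        then show "(\<lambda>k. c k x) \<longlonglongrightarrow> blinfun_apply 0 x" by (simp add: cornerD(5)[OF c(1)])
      qed
      moreover have f: "sconv (\<lambda>k. id_blinfun - e k) id_blinfun"
        using sconv_diff[OF sconv_const e0, of id_blinfun] by simp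
      moreover have "norm (id_blinfun - e k) \<le> 1" for k
        by (rule projection_norm_le[OF projection_compl[OF pe]])
      ultimately have "sconv (\<lambda>k. b k (c k)) ((id_blinfun o\<^sub>L (a0 o\<^sub>L id_blinfun)) + 0)"
        unfolding b_def by (intro sconv_add sconv_compose[where C=1] sconv_compose_left)
      moreover have "(id_blinfun o\<^sub>L (a0 o\<^sub>L id_blinfun)) + 0 = a0" by (intro blinfun_eqI) simp
      ultimately have "wconv (\<lambda>k. b k (c k)) a0" using sconv_imp_wconv by metis
      then obtain k where "b k (c k) \<in> Q n" using n[of "\<lambda>k. b k (c k)"] bK c by blast
      with c show False by blast
    qed
    then obtain k where k: "\<And>c. c \<in> corner (e k) N \<Longrightarrow> norm c \<le> 1 \<Longrightarrow> b k c \<in> Q n" by blast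
    have "\<exists>a\<in>Q n. \<exists>b\<in>Q n. c = a - b" if c: "c \<in> corner (e k) N" "norm c \<le> 1" for c
    proof (intro bexI)
      show "c = b k c - b k 0" by (simp add: b_def)
      have "0 \<in> corner (e k) N" by (simp add: corner_def zero_mem)
      then show "b k 0 \<in> Q n" by (intro k) auto
    qed (rule k[OF c])
    then show "\<exists>k. \<forall>c\<in>corner (e k) N. norm c \<le> 1 \<longrightarrow> (\<exists>a\<in>Q n. \<exists>b\<in>Q n. c = a - b)" by blast
  qed
qed

text \<open>Compactness makes weak limits strong, both for the unitaries and for their inverses.
  Strong limits respect products, so the limit is again unitary.\<close>

lemma unitaries_compact:
  assumes N: "sot_compact N" and s: "\<And>n. s n \<in> unitaries"
  shows "\<exists>\<phi> a. strict_mono (\<phi> :: nat \<Rightarrow> nat) \<and> a \<in> unitaries \<and> wconv (\<lambda>n. s (\<phi> n)) a"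
proof -
  have "\<forall>n. \<exists>t. t \<in> unitaries \<and> adjoint_pair (s n) t \<and> s n o\<^sub>L t = id_blinfun \<and> t o\<^sub>L s n = id_blinfun"
  proof
    fix n
    obtain t where "t \<in> unitaries" "adjoint_pair (s n) t" "\<And>x. s n (t x) = x" "\<And>x. t (s n x) = x"
      by (rule unitaries_adjoint[OF s[of n]]) blast
    then show "\<exists>t. t \<in> unitaries \<and> adjoint_pair (s n) t \<and> s n o\<^sub>L t = id_blinfun \<and> t o\<^sub>L s n = id_blinfun"
      by (intro exI[of _ t]) (auto intro!: blinfun_eqI)
  qed
  from choice[OF this] obtain t where t: "\<And>n. t n \<in> unitaries" "\<And>n. adjoint_pair (s n) (t n)"
    "\<And>n. s n o\<^sub>L t n = id_blinfun" "\<And>n. t n o\<^sub>L s n = id_blinfun" by blast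
  obtain \<phi> a where \<phi>: "strict_mono (\<phi> :: nat \<Rightarrow> nat)" and a: "a - id_blinfun \<in> N"
    and lim: "wconv (\<lambda>n. s (\<phi> n)) a"
    using one_plus_compactness[of s] s unitaries_norm_le unfolding unitaries_def by auto
  obtain b where b: "b - id_blinfun \<in> N" "adjoint_pair a b" by (rule one_plus_adjoint[OF a])
  have lim': "wconv (\<lambda>n. t (\<phi> n)) b" by (rule wconv_adjoint[OF lim t(2) b(2)])
  have strong: "sconv r c" if r: "\<And>n. r n \<in> unitaries" "wconv r c" for r c
  proof -
    have "sconv (\<lambda>n. r n - id_blinfun) (c - id_blinfun)"
    proof (rule sot_compact_sconv[OF N])
      show "r n - id_blinfun \<in> N" for n using r(1) by (simp add: unitaries_def)
      show "norm (r n - id_blinfun) \<le> 2" for n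
        using norm_triangle_ineq4[of "r n" id_blinfun] unitaries_norm_le[OF r(1), of n]
          norm_blinfun_id_le[where 'a='h] by linarith
      show "wconv (\<lambda>n. r n - id_blinfun) (c - id_blinfun)" by (intro wconv_diff wconv_const r)
    qed
    from sconv_add[OF this sconv_const[of id_blinfun]] show ?thesis by simp
  qed
  have "sconv (\<lambda>n. s (\<phi> n) o\<^sub>L t (\<phi> n)) (a o\<^sub>L b)" "sconv (\<lambda>n. t (\<phi> n) o\<^sub>L s (\<phi> n)) (b o\<^sub>L a)"
    by (intro sconv_compose[where C=1] strong lim lim' unitaries_norm_le s t)+
  then have "a o\<^sub>L b = id_blinfun" "b o\<^sub>L a = id_blinfun"
    unfolding t(3,4) using wconv_unique[OF sconv_imp_wconv wconv_const] by blast+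
  then have "a \<in> unitaries" using a b unfolding unitaries_def by blast
  with \<phi> lim show ?thesis by blast
qed

text \<open>\<open>R\<close> is the closed condition given to Baire's theorem, \<open>R'\<close> its
  relaxation after a product, with a worse constant. One product suffices for every unitary, so the
  loss does not accumulate.\<close>

lemma unitaries_uniform:
  fixes v :: "nat \<Rightarrow> 'h" and R R' :: "nat \<Rightarrow> ('h \<Rightarrow>\<^sub>L 'h) \<Rightarrow> bool"
  assumes N: "sot_compact N" and total: "\<And>x. (\<And>i. inner x (v i) = 0) \<Longrightarrow> x = 0"
    and cover: "\<And>u. u \<in> unitaries \<Longrightarrow> \<exists>n. R n u"
    and closed: "\<And>n s a. (\<And>k. R n (s k)) \<Longrightarrow> (\<And>k. norm (s k) \<le> 1) \<Longrightarrow> wconv s a \<Longrightarrow> R n a"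
    and mono: "\<And>m n a. R' m a \<Longrightarrow> m \<le> n \<Longrightarrow> R' n a"
    and comp: "\<And>m n a b. R m a \<Longrightarrow> R n b \<Longrightarrow> norm a \<le> 1 \<Longrightarrow> norm b \<le> 1 \<Longrightarrow> R' (m + n) (a o\<^sub>L b)"
  obtains n where "\<And>u. u \<in> unitaries \<Longrightarrow> R' n u"
proof -
  obtain u0 m where u0: "u0 \<in> unitaries"
    and m: "\<And>s. (\<And>k. s k \<in> unitaries) \<Longrightarrow> wconv s u0 \<Longrightarrow> \<exists>k. s k \<in> {a. R m a \<and> norm a \<le> 1}"
  proof (rule baire_wconv[of unitaries v "\<lambda>n. {a. R n a \<and> norm a \<le> 1}"])
    show "unitaries \<noteq> {}" using id_unitary by blast
    show "\<exists>\<phi> a. strict_mono (\<phi> :: nat \<Rightarrow> nat) \<and> a \<in> unitaries \<and> wconv (\<lambda>n. s (\<phi> n)) a"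
      if "\<And>n. s n \<in> unitaries" for s by (rule unitaries_compact[OF N that])
    show "a = b" if ab: "a \<in> unitaries" "b \<in> unitaries"
      "\<And>i j. inner (a (v i)) (v j) = inner (b (v i)) (v j)" for a b
    proof -
      obtain a' where a': "adjoint_pair a a'" by (rule unitaries_adjoint[OF ab(1)]) blast
      obtain b' where b': "adjoint_pair b b'" by (rule unitaries_adjoint[OF ab(2)]) blast
      have "a - b = 0"
        by (rule vectors_separate[OF total adjoint_pair_diff[OF a' b']])
          (use ab(3) in \<open>simp_all add: op_simps\<close>)
      then show ?thesis by simp
    qed
    show "unitaries \<subseteq> (\<Union>n. {a. R n a \<and> norm a \<le> 1})" using cover unitaries_norm_le by blast
    show "a \<in> {a. R n a \<and> norm a \<le> 1}"
      if "\<And>k. s k \<in> {a. R n a \<and> norm a \<le> 1}" "\<And>k. s k \<in> unitaries" "a \<in> unitaries" "wconv s a"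
      for n s a using closed[of n s a] that unitaries_norm_le by blast
  qed blast
  obtain w0 where w0: "w0 \<in> unitaries" "adjoint_pair u0 w0" "\<And>x. u0 (w0 x) = x" "\<And>x. w0 (u0 x) = x"
    by (rule unitaries_adjoint[OF u0]) blast
  show thesis
  proof (rule ccontr)
    assume "\<not> thesis"
    then have "\<forall>n. \<exists>u. u \<in> unitaries \<and> \<not> R' n u" using that by blast
    from choice[OF this] obtain s where s: "\<And>n. s n \<in> unitaries" "\<And>n. \<not> R' n (s n)" by blast
    obtain \<phi> u where \<phi>: "strict_mono (\<phi> :: nat \<Rightarrow> nat)" and u: "u \<in> unitaries"
      and lim: "wconv (\<lambda>n. s (\<phi> n)) u"
      using unitaries_compact[of s, OF N s(1)] by blast
    obtain w where w: "w \<in> unitaries" "adjoint_pair u w" "\<And>x. u (w x) = x" "\<And>x. w (u x) = x"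
      by (rule unitaries_adjoint[OF u]) blast
    obtain r where r: "R r (u o\<^sub>L w0)" using cover unitaries_compose u w0(1) by blast
    \<comment> \<open>Translates the bad sequence to one converging to the Baire point
      \<open>u0\<close>. The shift makes the index of the bad unitary at least \<open>r + m\<close>,
      the index that its factorisation delivers.\<close>
    define t where "t n = (u0 o\<^sub>L w) o\<^sub>L s (\<phi> (n + (r + m)))" for n
    have tu: "t n \<in> unitaries" for n unfolding t_def by (intro unitaries_compose u0 w s)
    have "wconv (\<lambda>n. s (\<phi> (n + (r + m)))) u"
      using wconv_subseq[OF lim, of "\<lambda>n. n + (r + m)"] by (simp add: strict_mono_def)
    then have "wconv t ((u0 o\<^sub>L w) o\<^sub>L u)"
      unfolding t_def by (rule wconv_compose_left[OF adjoint_pair_compose[OF w0(2) adjoint_pair_sym[OF w(2)]]])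
    moreover have "(u0 o\<^sub>L w) o\<^sub>L u = u0" by (intro blinfun_eqI) (simp add: w)
    ultimately obtain k where k: "R m (t k)" using m[of t, OF tu] by auto
    have "R' (r + m) ((u o\<^sub>L w0) o\<^sub>L t k)"
      by (intro comp r k unitaries_norm_le unitaries_compose u w0 tu)
    moreover have "(u o\<^sub>L w0) o\<^sub>L t k = s (\<phi> (k + (r + m)))"
      by (intro blinfun_eqI) (simp add: t_def w w0)
    moreover have "r + m \<le> \<phi> (k + (r + m))"
      using seq_suble[OF \<phi>, of "k + (r + m)"] by simp
    ultimately have "R' (\<phi> (k + (r + m))) (s (\<phi> (k + (r + m))))" using mono by metis
    with s(2) show False by blast
  qed
qed

text \<open>The real part is -J/2 times a difference of unitaries; in the imaginary part the factor
  \<open>J\<close> is already present, which leaves a plain half difference.\<close>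

lemma four_unitaries:
  assumes "a \<in> N" "norm a \<le> 1"
  obtains u v u' v' where "u \<in> unitaries" "v \<in> unitaries" "u' \<in> unitaries" "v' \<in> unitaries"
    "a = (-1/2) *\<^sub>R (J o\<^sub>L (u - v)) + (1/2) *\<^sub>R (u' - v')"
proof -
  obtain b where b: "b \<in> N" "adjoint_pair a b" using adjoint_mem assms by blast
  define r where "r = (1/2) *\<^sub>R (a + b)"
  define i where "i = (-1/2) *\<^sub>R (J o\<^sub>L (a - b))"
  note cart = cartesian_decomposition[OF assms b, folded r_def i_def]
  obtain u v where uv: "u \<in> unitaries" "v \<in> unitaries" "u - v = 2 *\<^sub>R (J o\<^sub>L r)"
    by (rule unitary_of_self_adjoint[OF cart(1-3)])
  obtain u' v' where uv': "u' \<in> unitaries" "v' \<in> unitaries" "u' - v' = 2 *\<^sub>R (J o\<^sub>L i)"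
    by (rule unitary_of_self_adjoint[OF cart(4-6)])
  have "(-1/2) *\<^sub>R (J o\<^sub>L (u - v)) = r" "(1/2) *\<^sub>R (u' - v') = (J o\<^sub>L i)"
    unfolding uv uv' by (intro blinfun_eqI, simp add: op_simps J_square)+
  then have "a = (-1/2) *\<^sub>R (J o\<^sub>L (u - v)) + (1/2) *\<^sub>R (u' - v')" using cart(7) by simp
  with uv uv' that show ?thesis by blast
qed

end

section \<open>The space of square-summable functions\<close>

lemma cmod_ell2_apply_le: "cmod (ell2_apply f x) \<le> norm f"
proof -
  have "(cmod (ell2_apply f x))\<^sup>2 = (\<Sum>\<^sub>\<infinity>y\<in>{x}. (cmod (ell2_apply f y))\<^sup>2)" by simp
  also have "\<dots> \<le> (\<Sum>\<^sub>\<infinity>y. (cmod (ell2_apply f y))\<^sup>2)"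
    by (rule infsum_mono_neutral) (auto simp: ell2_summable)
  also have "\<dots> = (norm f)\<^sup>2" by (simp add: power2_norm_eq_inner inner_ell2_self)
  finally show ?thesis by (rule power2_le_imp_le) simp
qed

lemma inner_delta: "inner f (delta x) = Re (ell2_apply f x)"
  and inner_i_delta: "inner f (cscale \<i> (delta x)) = Im (ell2_apply f x)"
proof -
  have "cinner f (cscale c (delta x)) = ell2_apply f x * cnj c" for c
  proof -
    have "cinner f (cscale c (delta x)) = (\<Sum>\<^sub>\<infinity>y\<in>{x}. ell2_apply f y * cnj c)"
      unfolding cinner_def by (rule infsum_cong_neutral) (auto simp: cscale.rep_eq delta.rep_eq)
    then show ?thesis by simp
  qed
  note c = this
  have "cscale 1 (delta x) = delta x" by (intro ell2_eqI) (simp add: cscale.rep_eq)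
  then show "inner f (delta x) = Re (ell2_apply f x)"
    using c[of 1] by (simp add: inner_ell2_def)
  show "inner f (cscale \<i> (delta x)) = Im (ell2_apply f x)"
    using c[of \<i>] by (simp add: inner_ell2_def)
qed

lemma cinner_delta: "cinner f (delta x) = ell2_apply f x"
proof -
  have "cinner f (delta x) = (\<Sum>\<^sub>\<infinity>y\<in>{x}. ell2_apply f y)"
    unfolding cinner_def by (rule infsum_cong_neutral) (auto simp: delta.rep_eq)
  then show ?thesis by simp
qed

text \<open>Weak convergence tested with real parts alone therefore controls all complex matrix
  coefficients.\<close>

lemma cinner_eq_inner: "cinner f g = Complex (inner f g) (inner f (cscale \<i> g))"
proof -
  have "cinner f (cscale \<i> g) = - \<i> * cinner f g"
    unfolding cinner_def by (simp add: cscale.rep_eq infsum_cmult_right'[symmetric] mult_ac)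
  then show ?thesis by (simp add: inner_ell2_def complex_eq_iff)
qed

lemma norm_delta: "norm (delta x) = 1"
  by (simp add: norm_eq_sqrt_inner inner_delta delta.rep_eq)

lemma norm_cscale: "norm (cscale c f) = cmod c * norm f"
proof -
  have "inner (cscale c f) (cscale c f) = (cmod c)\<^sup>2 * inner f f"
    by (simp add: inner_ell2_self cscale.rep_eq norm_mult power_mult_distrib infsum_cmult_right')
  then show ?thesis by (simp add: norm_eq_sqrt_inner real_sqrt_mult)
qed

lemma ell2_apply_sum: "ell2_apply (\<Sum>x\<in>A. f x) y = (\<Sum>x\<in>A. ell2_apply (f x) y)"
  by (induction A rule: infinite_finite_induct) (auto simp: zero_ell2.rep_eq plus_ell2.rep_eq)

lemma restrict_ell2_finite:
  "finite A \<Longrightarrow> restrict_ell2 A f = (\<Sum>x\<in>A. cscale (ell2_apply f x) (delta x))"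
  by (rule ell2_eqI)
    (simp add: ell2_apply_sum restrict_ell2.rep_eq cscale.rep_eq delta.rep_eq if_distrib cong: if_cong)

lemma norm_square_restrict_finite:
  assumes "finite A"
  shows "(norm (restrict_ell2 A f))\<^sup>2 = (\<Sum>x\<in>A. (cmod (ell2_apply f x))\<^sup>2)"
proof -
  have "(norm (restrict_ell2 A f))\<^sup>2 = (\<Sum>\<^sub>\<infinity>x. (cmod (ell2_apply (restrict_ell2 A f) x))\<^sup>2)"
    by (simp add: power2_norm_eq_inner inner_ell2_self)
  also have "\<dots> = (\<Sum>\<^sub>\<infinity>x\<in>A. (cmod (ell2_apply f x))\<^sup>2)"
    by (rule infsum_cong_neutral) (auto simp: restrict_ell2.rep_eq)
  finally show ?thesis using assms by simp
qed

lemma finite_support_approx: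
  assumes "e > 0"
  obtains A where "finite A" "norm (f - restrict_ell2 A f) \<le> e"
proof -
  let ?s = "\<lambda>x. (cmod (ell2_apply f x))\<^sup>2"
  have "(?s has_sum (norm f)\<^sup>2) UNIV"
    using has_sum_infsum[OF ell2_summable, of f] by (simp add: power2_norm_eq_inner inner_ell2_self)
  then have "((sum ?s) \<longlongrightarrow> (norm f)\<^sup>2) (finite_subsets_at_top UNIV)" by (simp add: has_sum_def)
  then have "\<forall>\<^sub>F A in finite_subsets_at_top UNIV. dist (sum ?s A) ((norm f)\<^sup>2) < e\<^sup>2"
    using assms by (intro tendstoD) auto
  then obtain A where A: "finite A" "dist (sum ?s A) ((norm f)\<^sup>2) < e\<^sup>2"
    by (auto simp: eventually_finite_subsets_at_top)
  have "(norm (f - restrict_ell2 A f))\<^sup>2 = (norm f)\<^sup>2 - (norm (restrict_ell2 A f))\<^sup>2"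
  proof -
    have "f = (f - restrict_ell2 A f) + restrict_ell2 A f" by simp
    moreover have "inner (f - restrict_ell2 A f) (restrict_ell2 A f) = 0"
    proof -
      have "cinner (f - restrict_ell2 A f) (restrict_ell2 A f) = 0"
        unfolding cinner_def by (rule infsum_0) (auto simp: restrict_ell2.rep_eq minus_ell2.rep_eq)
      then show ?thesis by (simp add: inner_ell2_def)
    qed
    ultimately show ?thesis
      using norm_add_Pythagorean[of "f - restrict_ell2 A f" "restrict_ell2 A f"]
      by (simp add: orthogonal_def)
  qed
  also have "\<dots> \<le> e\<^sup>2"
    using A by (simp add: norm_square_restrict_finite dist_real_def)
  finally show ?thesis using that[OF A(1)] power2_le_imp_le assms by fastforce
qed

lemma bounded_op_sum:
  assumes "a \<in> bounded_ops"
  shows "a (\<Sum>x\<in>A. cscale (c x) (f x)) = (\<Sum>x\<in>A. cscale (c x) (a (f x)))"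
  using assms by (simp add: blinfun.sum_right bounded_ops_def)

lemma bounded_op_eq_0:
  assumes a: "a \<in> bounded_ops" and zero: "\<And>x. a (delta x) = 0"
  shows "a = 0"
proof (rule blinfun_eqI)
  fix f
  have "norm (a f) \<le> e" if e: "e > 0" for e
  proof -
    have "e / (norm a + 1) > 0" using e norm_ge_zero[of a] by (intro divide_pos_pos) linarith+
    then obtain A where A: "finite A" "norm (f - restrict_ell2 A f) \<le> e / (norm a + 1)"
      using finite_support_approx by blast
    have "a (restrict_ell2 A f) = (\<Sum>x\<in>A. cscale (ell2_apply f x) 0)"
      by (simp only: restrict_ell2_finite[OF A(1)] bounded_op_sum[OF a] zero)
    also have "\<dots> = 0"
      by (rule ell2_eqI) (simp add: ell2_apply_sum cscale.rep_eq zero_ell2.rep_eq)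
    finally have "a (restrict_ell2 A f) = 0" .
    then have "norm (a f) = norm (a (f - restrict_ell2 A f))" by (simp add: blinfun.diff_right)
    also have "\<dots> \<le> (norm a + 1) * (e / (norm a + 1))"
      by (intro order_trans[OF norm_blinfun] mult_mono A) auto
    also have "\<dots> = e" using norm_ge_zero[of a] by (simp add: add_nonneg_eq_0_iff)
    finally show ?thesis .
  qed
  then have "norm (a f) \<le> 0" by (rule field_le_epsilon) simp
  then show "a f = blinfun_apply 0 f" by simp
qed

section \<open>Weak sequential compactness of bounded sets of operators\<close>

lemma ell2_weak_convergence:
  assumes lim: "\<And>y. (\<lambda>n. ell2_apply (f n) y) \<longlonglongrightarrow> ell2_apply g y"
    and bd: "\<And>n. norm (f n) \<le> C" "norm g \<le> C"
  shows "(\<lambda>n. inner (f n) h) \<longlonglongrightarrow> inner g h"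
proof (rule tendstoI)
  fix e :: real assume e: "e > 0"
  have C: "C \<ge> 0" using bd(2) norm_ge_zero order_trans by blast
  \<comment> \<open>Each of the two tails then costs at most e/4, which leaves e/2 for the finite
    part; \<open>C + 1\<close> keeps the denominator positive.\<close>
  have "e / (4 * (C + 1)) > 0" using e C by simp
  then obtain A where A: "finite A" "norm (h - restrict_ell2 A h) \<le> e / (4 * (C + 1))"
    using finite_support_approx by blast
  let ?k = "restrict_ell2 A h"
  have tail: "\<bar>inner u (h - ?k)\<bar> \<le> e / 4" if "norm u \<le> C" for u
  proof -
    have "\<bar>inner u (h - ?k)\<bar> \<le> norm u * norm (h - ?k)" by (rule Cauchy_Schwarz_ineq2)
    also have "\<dots> \<le> (C + 1) * (e / (4 * (C + 1)))" using that C by (intro mult_mono A) auto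
    also have "\<dots> = e / 4" using C by (simp add: field_simps)
    finally show ?thesis .
  qed
  have "inner u ?k = (\<Sum>x\<in>A. Re (ell2_apply u x * cnj (ell2_apply h x)))" for u
  proof -
    have "cinner u ?k = (\<Sum>\<^sub>\<infinity>x\<in>A. ell2_apply u x * cnj (ell2_apply h x))"
      unfolding cinner_def by (rule infsum_cong_neutral) (auto simp: restrict_ell2.rep_eq)
    then show ?thesis using A(1) by (simp add: inner_ell2_def)
  qed
  moreover have "(\<lambda>n. \<Sum>x\<in>A. Re (ell2_apply (f n) x * cnj (ell2_apply h x)))
      \<longlonglongrightarrow> (\<Sum>x\<in>A. Re (ell2_apply g x * cnj (ell2_apply h x)))"
    by (intro tendsto_intros lim)
  ultimately have "(\<lambda>n. inner (f n) ?k) \<longlonglongrightarrow> inner g ?k" by simp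
  then have "\<forall>\<^sub>F n in sequentially. dist (inner (f n) ?k) (inner g ?k) < e / 2"
    using e by (intro tendstoD) auto
  then show "\<forall>\<^sub>F n in sequentially. dist (inner (f n) h) (inner g h) < e"
  proof eventually_elim
    case (elim n)
    have "inner (f n) h - inner g h = (inner (f n) ?k - inner g ?k)
        + inner (f n) (h - ?k) - inner g (h - ?k)" by (simp add: inner_diff_right)
    then show ?case using elim tail[OF bd(1), of n] tail[OF bd(2)] unfolding dist_real_def by linarith
  qed
qed

text \<open>Fatou's lemma for counting measure: the bound on finite partial sums of squares passes
  to the limit.\<close>

lemma ell2_pointwise_limit:
  assumes lim: "\<And>y. (\<lambda>n. ell2_apply (f n) y) \<longlonglongrightarrow> g y" and bd: "\<And>n. norm (f n) \<le> C"
  obtains h where "ell2_apply h = g" "norm h \<le> C"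
proof -
  have C: "C \<ge> 0" using bd[of 0] norm_ge_zero order_trans by blast
  have fin: "(\<Sum>y\<in>A. (cmod (g y))\<^sup>2) \<le> C\<^sup>2" if A: "finite A" for A
  proof (rule LIMSEQ_le_const2)
    show "(\<lambda>n. \<Sum>y\<in>A. (cmod (ell2_apply (f n) y))\<^sup>2) \<longlonglongrightarrow> (\<Sum>y\<in>A. (cmod (g y))\<^sup>2)"
      by (intro tendsto_intros lim)
    have "(\<Sum>y\<in>A. (cmod (ell2_apply (f n) y))\<^sup>2) \<le> C\<^sup>2" for n
    proof -
      have "(norm (restrict_ell2 A (f n)))\<^sup>2 \<le> C\<^sup>2"
      proof (rule power_mono)
        have "norm (restrict_ell2 A (f n)) \<le> norm (f n)"
        proof (rule power2_le_imp_le)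
          show "(norm (restrict_ell2 A (f n)))\<^sup>2 \<le> (norm (f n))\<^sup>2"
            unfolding power2_norm_eq_inner[of "restrict_ell2 A (f n)"] power2_norm_eq_inner[of "f n"] inner_ell2_self
            by (rule infsum_mono[OF ell2_summable ell2_summable]) (simp add: restrict_ell2.rep_eq)
        qed simp
        then show "norm (restrict_ell2 A (f n)) \<le> C" using bd[of n] by linarith
      qed simp
      then show ?thesis by (simp add: norm_square_restrict_finite[OF A])
    qed
    then show "\<exists>N. \<forall>n\<ge>N. (\<Sum>y\<in>A. (cmod (ell2_apply (f n) y))\<^sup>2) \<le> C\<^sup>2" by blast
  qed
  have s: "(\<lambda>y. (cmod (g y))\<^sup>2) summable_on UNIV"
    by (rule nonneg_bounded_partial_sums_imp_summable_on[of _ _ "C\<^sup>2"]) (auto intro!: always_eventually fin eventually_finite_subsets_at_top_weakI)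
  define h where "h = Abs_ell2 g"
  have h: "ell2_apply h = g" using s by (simp add: h_def Abs_ell2_inverse)
  have "(norm h)\<^sup>2 \<le> C\<^sup>2"
    unfolding power2_norm_eq_inner[of h] inner_ell2_self h
    by (rule infsum_le_finite_sums[OF s]) (auto intro: fin)
  then have "norm h \<le> C" using C by (rule power2_le_imp_le)
  with h that show ?thesis by blast
qed

text \<open>Entries on the basis give convergence of coordinates on finitely supported vectors, and
  the uniform bound extends it to all vectors.\<close>

lemma bounded_ops_compactness_aux:
  fixes s :: "nat \<Rightarrow> 'a ell2 \<Rightarrow>\<^sub>L 'a ell2"
  assumes s: "\<And>n. s n \<in> bounded_ops" "\<And>n. norm (s n) \<le> C"
    and conv: "\<And>x y. convergent (\<lambda>n. ell2_apply (s n (delta x)) y)"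
  obtains a where "a \<in> bounded_ops" "wconv s a"
proof -
  have C: "C \<ge> 0" using s(2)[of 0] norm_ge_zero order_trans by blast
  have nb: "norm (s n f) \<le> C * norm f" for n f
    by (intro order_trans[OF norm_blinfun] mult_right_mono s) auto
  have "convergent (\<lambda>n. ell2_apply (s n f) y)" for f y
  proof (rule Cauchy_convergent, rule CauchyI)
    fix e :: real assume e: "e > 0"
    have "e / (4 * (C + 1)) > 0" using e C by simp
    then obtain A where A: "finite A" "norm (f - restrict_ell2 A f) \<le> e / (4 * (C + 1))"
      using finite_support_approx by blast
    let ?g = "restrict_ell2 A f"
    have tail: "cmod (ell2_apply (s n f) y - ell2_apply (s n ?g) y) \<le> e / 4" for n
    proof -
      have "ell2_apply (s n f) y - ell2_apply (s n ?g) y = ell2_apply (s n (f - ?g)) y"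
        by (simp add: blinfun.diff_right minus_ell2.rep_eq)
      also have "cmod \<dots> \<le> C * norm (f - ?g)" by (rule order_trans[OF cmod_ell2_apply_le nb])
      also have "\<dots> \<le> (C + 1) * (e / (4 * (C + 1)))" using C by (intro mult_mono A) auto
      also have "\<dots> = e / 4" using C by (simp add: field_simps)
      finally show ?thesis .
    qed
    have "ell2_apply (s n ?g) y = (\<Sum>x\<in>A. ell2_apply f x * ell2_apply (s n (delta x)) y)" for n
      by (simp add: restrict_ell2_finite[OF A(1)] bounded_op_sum[OF s(1)] ell2_apply_sum cscale.rep_eq)
    moreover have "convergent (\<lambda>n. \<Sum>x\<in>A. ell2_apply f x * ell2_apply (s n (delta x)) y)"
      by (intro convergent_sum convergent_mult convergent_const conv)
    ultimately have "Cauchy (\<lambda>n. ell2_apply (s n ?g) y)" by (simp add: convergent_Cauchy)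
    then obtain M where M: "\<And>m n. m \<ge> M \<Longrightarrow> n \<ge> M \<Longrightarrow>
        cmod (ell2_apply (s m ?g) y - ell2_apply (s n ?g) y) < e / 2"
      using CauchyD[of _ "e / 2"] e by fastforce
    show "\<exists>M. \<forall>m\<ge>M. \<forall>n\<ge>M. norm (ell2_apply (s m f) y - ell2_apply (s n f) y) < e"
    proof (intro exI[of _ M] allI impI)
      fix m n assume mn: "m \<ge> M" "n \<ge> M"
      let ?a = "ell2_apply (s m f) y - ell2_apply (s m ?g) y"
      let ?b = "ell2_apply (s m ?g) y - ell2_apply (s n ?g) y"
      let ?c = "ell2_apply (s n f) y - ell2_apply (s n ?g) y"
      have "ell2_apply (s m f) y - ell2_apply (s n f) y = (?a + ?b) - ?c" by simp
      then have "cmod (ell2_apply (s m f) y - ell2_apply (s n f) y) \<le> cmod ?a + cmod ?b + cmod ?c"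
        using norm_triangle_ineq4[of "?a + ?b" ?c] norm_triangle_ineq[of ?a ?b] by simp
      then show "norm (ell2_apply (s m f) y - ell2_apply (s n f) y) < e"
        using M[OF mn] tail[of m] tail[of n] e by linarith
    qed
  qed
  then have lim: "(\<lambda>n. ell2_apply (s n f) y) \<longlonglongrightarrow> lim (\<lambda>n. ell2_apply (s n f) y)" for f y
    by (simp add: convergent_LIMSEQ_iff)
  have "\<forall>f. \<exists>h. ell2_apply h = (\<lambda>y. lim (\<lambda>n. ell2_apply (s n f) y)) \<and> norm h \<le> C * norm f"
    using ell2_pointwise_limit[OF lim nb] by metis
  from choice[OF this] obtain T where T: "\<And>f. ell2_apply (T f) = (\<lambda>y. lim (\<lambda>n. ell2_apply (s n f) y))"
    and nT: "\<And>f. norm (T f) \<le> C * norm f" by blast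
  have limT: "(\<lambda>n. ell2_apply (s n f) y) \<longlonglongrightarrow> ell2_apply (T f) y" for f y
    unfolding T by (rule lim)
  have eqT: "T f = g" if "\<And>y. (\<lambda>n. ell2_apply (s n f) y) \<longlonglongrightarrow> ell2_apply g y" for f g
    by (rule ell2_eqI) (rule LIMSEQ_unique[OF limT that])
  have "bounded_linear T"
  proof (rule bounded_linear_intro)
    fix f g :: "'a ell2" and r :: real
    show "T (f + g) = T f + T g"
      by (rule eqT) (auto simp: blinfun.add_right plus_ell2.rep_eq intro!: tendsto_add limT)
    show "T (r *\<^sub>R f) = r *\<^sub>R T f"
      by (rule eqT) (auto simp: blinfun.scaleR_right scaleR_ell2.rep_eq intro!: tendsto_mult limT)
    show "norm (T f) \<le> norm f * C" using nT[of f] by (simp add: mult.commute)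
  qed
  then have T': "blinfun_apply (Blinfun T) = T" by (rule bounded_linear_Blinfun_apply)
  have "T (cscale c f) = cscale c (T f)" for c f
  proof (rule eqT)
    have "s n (cscale c f) = cscale c (s n f)" for n using s(1) by (simp add: bounded_ops_def)
    then show "(\<lambda>n. ell2_apply (s n (cscale c f)) y) \<longlonglongrightarrow> ell2_apply (cscale c (T f)) y" for y
      by (auto simp: cscale.rep_eq intro!: tendsto_mult limT)
  qed
  then have "Blinfun T \<in> bounded_ops" by (simp add: bounded_ops_def T')
  moreover have "wconv s (Blinfun T)"
    unfolding wconv_def T' by (intro allI ell2_weak_convergence[OF limT nb nT])
  ultimately show ?thesis using that by blast
qed

text \<open>Tychonoff's theorem for the matrix entries: there are countably many, all in the disc of
  radius \<open>C\<close>, and such a product is sequentially compact.\<close>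

lemma bounded_ops_compactness:
  fixes s :: "nat \<Rightarrow> 'a ell2 \<Rightarrow>\<^sub>L 'a ell2"
  assumes X: "countable (UNIV :: 'a set)"
    and s: "\<And>n. s n \<in> bounded_ops" "\<And>n. norm (s n) \<le> C"
  obtains \<phi> a where "strict_mono (\<phi> :: nat \<Rightarrow> nat)" "a \<in> bounded_ops" "wconv (\<lambda>n. s (\<phi> n)) a"
proof -
  define e :: "nat \<Rightarrow> 'a" where "e = from_nat_into UNIV"
  have e: "\<exists>i. e i = x" for x unfolding e_def using from_nat_into_surj[OF X] by blast
  define F :: "nat \<Rightarrow> nat \<Rightarrow> complex" where
    "F n p = ell2_apply (s n (delta (e (fst (prod_decode p))))) (e (snd (prod_decode p)))" for n p
  have FC: "F n p \<in> cball 0 C" for n p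
  proof -
    have "cmod (F n p) \<le> norm (s n) * norm (delta (e (fst (prod_decode p))))"
      unfolding F_def by (rule order_trans[OF cmod_ell2_apply_le norm_blinfun])
    then show ?thesis using s(2)[of n] by (simp add: norm_delta)
  qed
  have "compactin (product_topology (\<lambda>_::nat. euclidean :: complex topology) UNIV) (PiE UNIV (\<lambda>_. cball 0 C))"
    by (simp add: compactin_PiE)
  then have "compact (PiE UNIV (\<lambda>_::nat. cball (0::complex) C))"
    by (simp add: euclidean_product_topology)
  then have "seq_compact (PiE UNIV (\<lambda>_::nat. cball (0::complex) C))"
    by (rule compact_imp_seq_compact)
  moreover have "\<forall>n. F n \<in> PiE UNIV (\<lambda>_. cball 0 C)" using FC by blast
  ultimately obtain l \<phi> where \<phi>: "strict_mono (\<phi> :: nat \<Rightarrow> nat)" and l: "(F \<circ> \<phi>) \<longlonglongrightarrow> l"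
    unfolding seq_compact_def by blast
  have "convergent (\<lambda>n. ell2_apply (s (\<phi> n) (delta x)) y)" for x y
  proof -
    obtain i j where "e i = x" "e j = y" using e by blast
    then have "(\<lambda>n. ell2_apply (s (\<phi> n) (delta x)) y) \<longlonglongrightarrow> l (prod_encode (i, j))"
      using l[unfolded tendsto_fun_iff, rule_format, of "prod_encode (i, j)"] by (simp add: F_def comp_def)
    then show ?thesis by (rule convergentI)
  qed
  then obtain a where "a \<in> bounded_ops" "wconv (\<lambda>n. s (\<phi> n)) a"
    using bounded_ops_compactness_aux[of "\<lambda>n. s (\<phi> n)" C] s by blast
  with \<phi> that show ?thesis by blast
qed

section \<open>Weakly closed algebras of operators on \<open>\<ell>\<^sub>2(X)\<close>\<close>

lemma cinner_cscale_left: "cinner (cscale c f) g = c * cinner f g"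
  unfolding cinner_def by (simp add: cscale.rep_eq mult.assoc infsum_cmult_right')

lemma scalar_op_apply: "scalar_op c f = cscale c f"
  by (simp add: scalar_op.rep_eq)

lemma cscale_of_real: "cscale (complex_of_real r) f = r *\<^sub>R f"
  by (rule ell2_eqI) (simp add: cscale.rep_eq scaleR_ell2.rep_eq)

lemma cscale_i_i: "cscale \<i> (cscale \<i> f) = - f"
  by (rule ell2_eqI) (simp add: cscale.rep_eq uminus_ell2.rep_eq flip: mult.assoc)

lemma i_skew: "adjoint_pair (scalar_op \<i>) (- scalar_op \<i>)"
  unfolding adjoint_pair_def
proof (intro allI)
  fix f g :: "'a ell2"
  have "inner f (cscale \<i> g) = Im (cinner f g)" by (simp add: cinner_eq_inner)
  then show "inner (scalar_op \<i> f) g = inner f ((- scalar_op \<i>) g)"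
    by (simp add: scalar_op_apply blinfun.minus_left inner_ell2_def[of "cscale \<i> f"] cinner_cscale_left)
qed

lemma is_adjoint_imp_adjoint_pair: "is_adjoint a b \<Longrightarrow> adjoint_pair a b"
  by (simp add: is_adjoint_def adjoint_pair_def inner_ell2_def)

lemma wot_closed_sequentially:
  assumes M: "closedin weak_operator_topology M" and s: "\<And>n. s n \<in> M"
    and a: "a \<in> bounded_ops" "wconv s a"
  shows "a \<in> M"
proof (rule ccontr)
  assume nM: "a \<notin> M"
  let ?f = "\<lambda>a :: 'a ell2 \<Rightarrow>\<^sub>L 'a ell2. \<lambda>(\<xi>, \<eta>). cinner (a \<xi>) \<eta>"
  have top: "topspace weak_operator_topology = (bounded_ops :: ('a ell2 \<Rightarrow>\<^sub>L 'a ell2) set)"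
    by (simp add: weak_operator_topology_def topspace_pullback_topology)
  obtain U where U: "open U" "bounded_ops - M = ?f -` U \<inter> bounded_ops"
    using M unfolding closedin_def top
    by (auto simp: weak_operator_topology_def openin_pullback_topology)
  have "(\<lambda>n. ?f (s n)) \<longlonglongrightarrow> ?f a"
    unfolding tendsto_fun_iff
  proof
    fix p :: "'a ell2 \<times> 'a ell2"
    obtain \<xi> \<eta> where p: "p = (\<xi>, \<eta>)" by (cases p)
    have "(\<lambda>n. cinner (s n \<xi>) \<eta>) \<longlonglongrightarrow> cinner (a \<xi>) \<eta>"
      unfolding cinner_eq_inner by (intro tendsto_Complex wconvD a)
    then show "(\<lambda>n. ?f (s n) p) \<longlonglongrightarrow> ?f a p" by (simp add: p)
  qed
  moreover have "?f a \<in> U" using U(2) a(1) nM by blast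
  ultimately have "\<forall>\<^sub>F n in sequentially. ?f (s n) \<in> U" by (rule topological_tendstoD[OF _ U(1)])
  from eventually_happens'[OF sequentially_bot this] obtain n where "?f (s n) \<in> U" by blast
  moreover have "s n \<in> bounded_ops" using M s[of n] unfolding closedin_def top by blast
  ultimately have "s n \<in> bounded_ops - M" unfolding U(2) by blast
  with s[of n] show False by blast
qed

lemma vn_algebra_ell2:
  fixes M :: "('a ell2 \<Rightarrow>\<^sub>L 'a ell2) set"
  assumes X: "countable (UNIV :: 'a set)"
    and M: "cstar_subalgebra M" "closedin weak_operator_topology M"
  shows "vn_algebra M (scalar_op \<i>)"
proof
  have bM: "M \<subseteq> bounded_ops" using M(1) by (simp add: cstar_subalgebra_def)
  show "0 \<in> M" using M(1) by (simp add: cstar_subalgebra_def)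
  fix a b assume ab: "a \<in> M" "b \<in> M"
  show "a + b \<in> M" "a o\<^sub>L b \<in> M" using M(1) ab by (auto simp: cstar_subalgebra_def)
next
  fix a assume a: "a \<in> M"
  have sc: "scalar_op c o\<^sub>L a \<in> M" for c using M(1) a by (auto simp: cstar_subalgebra_def)
  show "scalar_op \<i> o\<^sub>L a \<in> M" by (rule sc)
  fix r :: real
  have "r *\<^sub>R a = scalar_op (complex_of_real r) o\<^sub>L a"
    by (intro blinfun_eqI) (simp add: scalar_op_apply cscale_of_real blinfun.scaleR_left)
  then show "r *\<^sub>R a \<in> M" using sc by metis
next
  fix a :: "'a ell2 \<Rightarrow>\<^sub>L 'a ell2" and f assume "a \<in> M"
  then have "a \<in> bounded_ops" using M(1) by (auto simp: cstar_subalgebra_def)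
  then show "a (scalar_op \<i> f) = scalar_op \<i> (a f)"
    by (simp add: scalar_op_apply bounded_ops_def)
next
  fix a assume "a \<in> M"
  then show "\<exists>b\<in>M. adjoint_pair a b"
    using M(1) is_adjoint_imp_adjoint_pair unfolding cstar_subalgebra_def by blast
next
  fix s :: "nat \<Rightarrow> 'a ell2 \<Rightarrow>\<^sub>L 'a ell2" and C
  assume s: "\<And>n. s n \<in> M" "\<And>n. norm (s n) \<le> C"
  then have "s n \<in> bounded_ops" for n using M(1) by (auto simp: cstar_subalgebra_def)
  then obtain \<phi> a where \<phi>: "strict_mono (\<phi> :: nat \<Rightarrow> nat)" "a \<in> bounded_ops" "wconv (\<lambda>n. s (\<phi> n)) a"
    by (rule bounded_ops_compactness[OF X _ s(2)])
  have "a \<in> M" by (rule wot_closed_sequentially[OF M(2) s(1) \<phi>(2,3)])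
  with \<phi> show "\<exists>\<phi> a. strict_mono (\<phi> :: nat \<Rightarrow> nat) \<and> a \<in> M \<and> wconv (\<lambda>n. s (\<phi> n)) a" by blast
qed (auto simp: scalar_op_apply cscale_i_i i_skew)

lemma ell2_total_sequence:
  assumes X: "countable (UNIV :: 'a set)"
  obtains v :: "nat \<Rightarrow> 'a ell2" where "\<And>i. norm (v i) \<le> 1" "\<And>x. (\<And>i. inner x (v i) = 0) \<Longrightarrow> x = 0"
proof -
  define e :: "nat \<Rightarrow> 'a" where "e = from_nat_into UNIV"
  have e: "\<exists>i. e i = x" for x unfolding e_def using from_nat_into_surj[OF X] by blast
  \<comment> \<open>The basis vectors alone are not total for the real inner product, which sees
    only real parts; the odd terms test imaginary parts.\<close>
  define v where "v i = (if even i then delta (e (i div 2)) else cscale \<i> (delta (e (i div 2))))" for i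
  have "norm (v i) \<le> 1" for i by (simp add: v_def norm_cscale norm_delta)
  moreover have "f = 0" if f: "\<And>i. inner f (v i) = 0" for f
  proof (rule ell2_eqI)
    fix x
    obtain i where i: "e i = x" using e by blast
    show "ell2_apply f x = ell2_apply 0 x"
      using f[of "2 * i"] f[of "Suc (2 * i)"] i
      by (simp add: v_def inner_delta inner_i_delta zero_ell2.rep_eq complex_eq_iff)
  qed
  ultimately show ?thesis using that by blast
qed

lemma ulf_finite_cball:
  assumes "uniformly_locally_finite (UNIV :: 'a::metric_space set)"
  shows "finite (cball (x :: 'a) r)"
proof -
  \<comment> \<open>Uniform local finiteness speaks of positive radii only, hence
    \<open>max r 1\<close>.\<close>
  have "finite (cball x (max r 1) \<inter> UNIV)"
    using assms unfolding uniformly_locally_finite_def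
    by (metis UNIV_I less_max_iff_disj zero_less_one)
  then show ?thesis by (rule finite_subset[rotated]) auto
qed

lemma ulf_countable:
  assumes "uniformly_locally_finite (UNIV :: 'a::metric_space set)"
  shows "countable (UNIV :: 'a set)"
proof -
  have "(UNIV :: 'a set) = (\<Union>n. cball (undefined :: 'a) (real n))"
    using real_arch_simple[of "dist (undefined :: 'a) _"] by (auto simp: set_eq_iff)
  also have "countable \<dots>"
    by (rule countable_UN) (auto intro: countable_finite ulf_finite_cball[OF assms])
  finally show ?thesis .
qed

section \<open>Quasi-local operators\<close>

lemma chi_apply: "ell2_apply (chi A f) x = (if x \<in> A then ell2_apply f x else 0)"
  by (simp add: chi.rep_eq restrict_ell2.rep_eq)

lemma projection_chi: "projection (chi A)"
proof -
  have "cinner (chi A f) g = cinner f (chi A g)" for f g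
    unfolding cinner_def by (rule infsum_cong) (simp add: chi_apply)
  moreover have "chi A o\<^sub>L chi A = chi A"
    by (intro blinfun_eqI ell2_eqI) (simp add: chi_apply)
  ultimately show ?thesis by (simp add: projection_def adjoint_pair_def inner_ell2_def)
qed

lemma norm_chi_le: "norm (chi A) \<le> 1"
  by (rule projection_norm_le[OF projection_chi])

lemma chi_compl: "chi A f + chi (- A) f = f"
  by (intro ell2_eqI) (simp add: chi_apply plus_ell2.rep_eq)

lemma chi_empty: "chi {} = 0"
  by (intro blinfun_eqI ell2_eqI) (simp add: chi_apply zero_ell2.rep_eq)

lemma chi_disjoint: "A \<inter> B = {} \<Longrightarrow> chi A o\<^sub>L chi B = 0"
  by (intro blinfun_eqI ell2_eqI) (auto simp: chi_apply zero_ell2.rep_eq)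

lemma setdist_pos_disjoint: "setdist A B > 0 \<Longrightarrow> A \<inter> B = {}"
  by (metis disjoint_iff less_irrefl setdist_eq_0I)

lemma quasi_localD: "quasi_local \<epsilon> r a \<Longrightarrow> setdist A B > r \<Longrightarrow> norm (chi A o\<^sub>L a o\<^sub>L chi B) \<le> \<epsilon>"
  by (simp add: quasi_local_def)

lemma quasi_local_mono: "quasi_local \<epsilon> r a \<Longrightarrow> \<epsilon> \<le> \<delta> \<Longrightarrow> r \<le> s \<Longrightarrow> quasi_local \<delta> s a"
  by (meson quasi_local_def order_le_less_trans order_trans)

lemma quasi_local_diff:
  assumes "quasi_local \<epsilon> r a" "quasi_local \<delta> r b"
  shows "quasi_local (\<epsilon> + \<delta>) r (a - b)"
  unfolding quasi_local_def
proof (intro allI impI)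
  fix A B :: "'a set" assume AB: "setdist A B > r"
  have "chi A o\<^sub>L (a - b) o\<^sub>L chi B = (chi A o\<^sub>L a o\<^sub>L chi B) - (chi A o\<^sub>L b o\<^sub>L chi B)"
    by (intro blinfun_eqI) (simp add: blinfun.diff_left blinfun.diff_right)
  then show "norm (chi A o\<^sub>L (a - b) o\<^sub>L chi B) \<le> \<epsilon> + \<delta>"
    using norm_triangle_ineq4[of "chi A o\<^sub>L a o\<^sub>L chi B" "chi A o\<^sub>L b o\<^sub>L chi B"]
      quasi_localD[OF assms(1) AB] quasi_localD[OF assms(2) AB] by simp
qed

lemma quasi_local_scaleR:
  assumes "quasi_local \<epsilon> r a"
  shows "quasi_local (\<bar>c\<bar> * \<epsilon>) r (c *\<^sub>R a)"
  unfolding quasi_local_def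
proof (intro allI impI)
  fix A B :: "'a set" assume "setdist A B > r"
  then have "\<bar>c\<bar> * norm (chi A o\<^sub>L a o\<^sub>L chi B) \<le> \<bar>c\<bar> * \<epsilon>"
    by (intro mult_left_mono quasi_localD[OF assms]) auto
  moreover have "chi A o\<^sub>L (c *\<^sub>R a) o\<^sub>L chi B = c *\<^sub>R (chi A o\<^sub>L a o\<^sub>L chi B)"
    by (intro blinfun_eqI) (simp add: blinfun.scaleR_left blinfun.scaleR_right)
  ultimately show "norm (chi A o\<^sub>L (c *\<^sub>R a) o\<^sub>L chi B) \<le> \<bar>c\<bar> * \<epsilon>" by simp
qed

lemma norm_scalar_op_le: "norm (scalar_op c) \<le> cmod c"
  by (rule norm_blinfun_bound) (auto simp: scalar_op_apply norm_cscale)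

lemma quasi_local_i:
  assumes "quasi_local \<epsilon> r a"
  shows "quasi_local \<epsilon> r (scalar_op \<i> o\<^sub>L a)"
  unfolding quasi_local_def
proof (intro allI impI)
  fix A B :: "'a set" assume AB: "setdist A B > r"
  have "chi A o\<^sub>L (scalar_op \<i> o\<^sub>L a) o\<^sub>L chi B = scalar_op \<i> o\<^sub>L (chi A o\<^sub>L a o\<^sub>L chi B)"
    by (intro blinfun_eqI ell2_eqI) (simp add: chi_apply scalar_op_apply cscale.rep_eq)
  also have "norm \<dots> \<le> norm (scalar_op \<i> :: 'a ell2 \<Rightarrow>\<^sub>L 'a ell2) * norm (chi A o\<^sub>L a o\<^sub>L chi B)"
    by (rule norm_blinfun_compose)
  also have "\<dots> \<le> 1 * \<epsilon>"
    using norm_scalar_op_le[of \<i>] by (intro mult_mono quasi_localD[OF assms AB]) auto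
  finally show "norm (chi A o\<^sub>L (scalar_op \<i> o\<^sub>L a) o\<^sub>L chi B) \<le> \<epsilon>" by simp
qed

lemma quasi_local_closed:
  assumes "\<And>k. quasi_local \<epsilon> r (s k)" "wconv s a"
  shows "quasi_local \<epsilon> r a"
  unfolding quasi_local_def
proof (intro allI impI)
  fix A B :: "'a set" assume "setdist A B > r"
  then show "norm (chi A o\<^sub>L a o\<^sub>L chi B) \<le> \<epsilon>"
    by (intro wconv_norm_le[OF wconv_compose_right[OF wconv_compose_left[OF
          projectionD(1)[OF projection_chi] assms(2)]]] quasi_localD[OF assms(1)])
qed

text \<open>Sets at distance more than \<open>r \<ge> 0\<close> are disjoint, and the identity has
  no entries between disjoint sets.\<close>

lemma quasi_local_one_plus:
  assumes "quasi_local \<epsilon> r (u - id_blinfun)" "r \<ge> 0"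
  shows "quasi_local \<epsilon> r u"
  unfolding quasi_local_def
proof (intro allI impI)
  fix A B :: "'a set" assume AB: "setdist A B > r"
  have "chi A o\<^sub>L u o\<^sub>L chi B = (chi A o\<^sub>L (u - id_blinfun) o\<^sub>L chi B) + (chi A o\<^sub>L chi B)"
    by (intro blinfun_eqI) (simp add: blinfun.diff_left blinfun.diff_right blinfun.add_left)
  moreover have "chi A o\<^sub>L chi B = 0"
    by (rule chi_disjoint[OF setdist_pos_disjoint]) (use AB assms(2) in linarith)
  ultimately show "norm (chi A o\<^sub>L u o\<^sub>L chi B) \<le> \<epsilon>"
    using quasi_localD[OF assms(1) AB] by simp
qed

lemma setdist_neighbourhood_compl:
  fixes A :: "'a::metric_space set"
  assumes "A \<noteq> {}" "- {z. \<exists>x\<in>A. dist x z \<le> t} \<noteq> {}"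
  shows "setdist A (- {z. \<exists>x\<in>A. dist x z \<le> t}) \<ge> t"
  by (rule le_setdistI[OF assms]) (auto simp: not_le less_imp_le)

text \<open>Insert the \<open>t\<close>-neighbourhood \<open>D\<close> of \<open>A\<close> between
  the factors: \<open>A\<close> is far from the complement of \<open>D\<close>, and \<open>D\<close>
  is far from \<open>B\<close>. Each of the two terms costs \<open>\<epsilon>\<close>.\<close>

lemma quasi_local_compose:
  fixes a b :: "'a::metric_space ell2 \<Rightarrow>\<^sub>L 'a ell2"
  assumes a: "quasi_local \<epsilon> r a" "norm a \<le> 1" and b: "quasi_local \<epsilon> s b" "norm b \<le> 1"
    and nn: "\<epsilon> \<ge> 0" "r \<ge> 0" "s \<ge> 0"
  shows "quasi_local (2 * \<epsilon>) (r + s) (a o\<^sub>L b)"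
  unfolding quasi_local_def
proof (intro allI impI)
  fix A B :: "'a set" assume AB: "setdist A B > r + s"
  have ne: "A \<noteq> {}" "B \<noteq> {}" using AB nn by (auto simp: setdist_def)
  \<comment> \<open>The midpoint of \<open>r\<close> and \<open>setdist A B - s\<close>, so that
    both distances are strictly large enough.\<close>
  define t where "t = (setdist A B + r - s) / 2"
  define D where "D = {z. \<exists>x\<in>A. dist x z \<le> t}"
  have t: "r < t" "s < setdist A B - t" using AB by (auto simp: t_def field_simps)
  \<comment> \<open>The empty case is separate because \<open>setdist\<close> to the empty set is
    0.\<close>
  have 1: "norm (chi A o\<^sub>L a o\<^sub>L chi (- D)) \<le> \<epsilon>"
  proof (cases "- D = {}")
    case True
    then show ?thesis using nn by (simp only: chi_empty) simp
  next
    case False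
    have "setdist A (- D) \<ge> t"
      using setdist_neighbourhood_compl[OF ne(1)] False unfolding D_def by blast
    then show ?thesis using t by (intro quasi_localD[OF a(1)]) linarith
  qed
  have 2: "norm (chi D o\<^sub>L b o\<^sub>L chi B) \<le> \<epsilon>"
  proof (rule quasi_localD[OF b(1)])
    obtain x where "x \<in> A" using ne(1) by blast
    then have "x \<in> D" using t nn by (auto simp: D_def intro!: bexI[of _ x])
    then have "D \<noteq> {}" by blast
    then have "setdist A B - t \<le> setdist D B"
    proof (rule le_setdistI[OF _ ne(2)])
      fix z y assume "z \<in> D" "y \<in> B"
      then obtain x where x: "x \<in> A" "dist x z \<le> t" by (auto simp: D_def)
      have "setdist A B \<le> dist x y" using setdist_le_dist x \<open>y \<in> B\<close> by blast
      also have "\<dots> \<le> dist x z + dist z y" by (rule dist_triangle)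
      finally show "setdist A B - t \<le> dist z y" using x by linarith
    qed
    then show "setdist D B > s" using t by linarith
  qed
  have "chi A o\<^sub>L (a o\<^sub>L b) o\<^sub>L chi B
      = ((chi A o\<^sub>L a o\<^sub>L chi (- D)) o\<^sub>L (b o\<^sub>L chi B)) + ((chi A o\<^sub>L a) o\<^sub>L (chi D o\<^sub>L b o\<^sub>L chi B))"
  proof (intro blinfun_eqI)
    fix f
    have "chi A (a (b (chi B f))) = chi A (a (chi D (b (chi B f)) + chi (- D) (b (chi B f))))"
      by (simp only: chi_compl)
    then show "(chi A o\<^sub>L (a o\<^sub>L b) o\<^sub>L chi B) f
      = (((chi A o\<^sub>L a o\<^sub>L chi (- D)) o\<^sub>L (b o\<^sub>L chi B)) + ((chi A o\<^sub>L a) o\<^sub>L (chi D o\<^sub>L b o\<^sub>L chi B))) f"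
      by (simp add: blinfun.add_right blinfun.add_left)
  qed
  also have "norm \<dots> \<le> norm ((chi A o\<^sub>L a o\<^sub>L chi (- D)) o\<^sub>L (b o\<^sub>L chi B))
      + norm ((chi A o\<^sub>L a) o\<^sub>L (chi D o\<^sub>L b o\<^sub>L chi B))"
    by (rule norm_triangle_ineq)
  also have "\<dots> \<le> \<epsilon> * 1 + 1 * \<epsilon>"
    by (intro add_mono order_trans[OF norm_blinfun_compose] mult_mono 1 2
        norm_compose_le_1[OF b(2) norm_chi_le] norm_compose_le_1[OF norm_chi_le a(2)] nn) auto
  finally show "norm (chi A o\<^sub>L (a o\<^sub>L b) o\<^sub>L chi B) \<le> 2 * \<epsilon>" by simp
qed

section \<open>Compactness of weakly closed algebras of quasi-local operators\<close>

text \<open>Compression to finitely many points has finite rank, so it turns weak into norm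
  convergence. It serves as \<open>P\<close> in \<open>sot_compact_of_tight\<close>.\<close>

lemma chi_finite_weakly_continuous:
  assumes B: "finite B" and s: "wconv s a"
  shows "(\<lambda>n. chi B (s n f)) \<longlonglongrightarrow> chi B (a f)"
proof -
  have chi_sum: "chi B g = (\<Sum>x\<in>B. cscale (ell2_apply g x) (delta x))" for g
    by (simp add: chi.rep_eq restrict_ell2_finite[OF B])
  have diff: "norm (cscale c (delta x) - cscale d (delta x)) = cmod (c - d)" for c d and x :: 'a
  proof -
    have "cscale c (delta x) - cscale d (delta x) = cscale (c - d) (delta x)"
      by (intro ell2_eqI) (simp add: cscale.rep_eq minus_ell2.rep_eq left_diff_distrib)
    then show ?thesis by (simp add: norm_cscale norm_delta)
  qed
  have "(\<lambda>n. cscale (ell2_apply (s n f) x) (delta x)) \<longlonglongrightarrow> cscale (ell2_apply (a f) x) (delta x)" for x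
  proof -
    have "(\<lambda>n. ell2_apply (s n f) x) \<longlonglongrightarrow> ell2_apply (a f) x"
      unfolding cinner_delta[symmetric] cinner_eq_inner by (intro tendsto_Complex wconvD s)
    then have "(\<lambda>n. cmod (ell2_apply (s n f) x - ell2_apply (a f) x)) \<longlonglongrightarrow> 0"
      by (intro tendsto_norm_zero LIM_zero)
    then have "(\<lambda>n. norm (cscale (ell2_apply (s n f) x) (delta x) - cscale (ell2_apply (a f) x) (delta x))) \<longlonglongrightarrow> 0"
      by (simp only: diff)
    then show ?thesis by (rule LIM_zero_cancel[OF tendsto_norm_zero_cancel])
  qed
  then show ?thesis unfolding chi_sum by (intro tendsto_sum)
qed

text \<open>One finite set \<open>B\<close> holds at least half the norm of \<open>u f\<close> for
  all unitaries \<open>u\<close> at once. The losses are norm f / 8 from cutting \<open>f\<close> to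
  a finite set, and norm f / 8 from quasi-locality, as u - 1 is twice a contraction.\<close>

lemma sot_compact_of_quasi_local:
  fixes N :: "('a::metric_space ell2 \<Rightarrow>\<^sub>L 'a ell2) set"
  assumes inf: "infinite (UNIV :: 'a set)" and ulf: "uniformly_locally_finite (UNIV :: 'a set)"
    and N: "vn_algebra N J" and r: "r \<ge> 0"
    and ql: "\<And>c. c \<in> N \<Longrightarrow> norm c \<le> 1 \<Longrightarrow> quasi_local (1/16) r c"
  shows "sot_compact N"
proof (rule vn_algebra.sot_compact_of_tight[OF N])
  interpret vn_algebra N J by (rule N)
  fix f :: "'a ell2" assume f: "f \<noteq> 0"
  then have "norm f / 8 > 0" by simp
  then obtain A where A: "finite A" "norm (f - restrict_ell2 A f) \<le> norm f / 8"
    using finite_support_approx by blast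
  have ne: "A \<noteq> {}"
  proof
    assume "A = {}"
    then have "restrict_ell2 A f = 0" by (simp add: restrict_ell2_finite)
    then show False using A(2) f by simp
  qed
  \<comment> \<open>The extra 1 makes the distance from \<open>A\<close> to the complement strictly
    larger than \<open>r\<close>.\<close>
  define B where "B = {z. \<exists>x\<in>A. dist x z \<le> r + 1}"
  have "B = (\<Union>x\<in>A. cball x (r + 1))" by (auto simp: B_def)
  then have finB: "finite B" using A(1) ulf_finite_cball[OF ulf] by simp
  \<comment> \<open>Infinitude of the space enters here: with a nonempty complement,
    \<open>setdist\<close> is a genuine distance.\<close>
  then have "- B \<noteq> {}" using inf by (metis Compl_empty_eq double_complement)
  then have "setdist A (- B) \<ge> r + 1" unfolding B_def by (rule setdist_neighbourhood_compl[OF ne])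
  then have sd: "setdist (- B) A > r" by (simp add: setdist_sym)
  let ?g = "chi A f"
  have g: "norm (f - ?g) \<le> norm f / 8" using A(2) by (simp add: chi.rep_eq)
  have "norm f / 2 \<le> norm (chi B (u f))" if u: "u \<in> unitaries" for u
  proof -
    define c where "c = (1/2) *\<^sub>R (u - id_blinfun)"
    have "c \<in> N" using u unfolding c_def by (intro scaleR_mem) (simp add: unitaries_def)
    moreover have "norm c \<le> 1"
      using norm_triangle_ineq4[of u id_blinfun] unitaries_norm_le[OF u]
        norm_blinfun_id_le[where 'a="'a ell2"] by (simp add: c_def)
    ultimately have "quasi_local (1/16) r c" by (rule ql)
    from quasi_local_scaleR[OF this, of 2] have "quasi_local (1/8) r (u - id_blinfun)"
      by (simp add: c_def)
    then have "quasi_local (1/8) r u" using r by (rule quasi_local_one_plus)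
    then have "norm (chi (- B) o\<^sub>L u o\<^sub>L chi A) \<le> 1/8" using sd by (rule quasi_localD)
    then have "norm ((chi (- B) o\<^sub>L u o\<^sub>L chi A) f) \<le> (1/8) * norm f"
      by (intro order_trans[OF norm_blinfun] mult_right_mono) auto
    then have "norm (chi (- B) (u ?g)) \<le> (1/8) * norm f" by simp
    moreover have "norm (chi (- B) (u (f - ?g))) \<le> norm f / 8"
      using contraction_le[OF norm_chi_le, of "- B" "u (f - ?g)"] unitaries_norm[OF u, of "f - ?g"] g
      by linarith
    moreover have "u f = chi B (u f) + (chi (- B) (u ?g) + chi (- B) (u (f - ?g)))"
      by (simp add: chi_compl flip: blinfun.add_right)
    then have "norm (u f) \<le> norm (chi B (u f)) + (norm (chi (- B) (u ?g)) + norm (chi (- B) (u (f - ?g))))"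
      by (metis norm_triangle_ineq norm_triangle_mono order_refl)
    ultimately show ?thesis using unitaries_norm[OF u, of f] norm_ge_zero[of f] by linarith
  qed
  then show "\<exists>P :: 'a ell2 \<Rightarrow>\<^sub>L 'a ell2. (\<forall>s a. wconv s a \<longrightarrow> (\<lambda>n. P (s n f)) \<longlonglongrightarrow> P (a f)) \<and>
      (\<exists>c>0. \<forall>u\<in>unitaries. c \<le> norm (P (u f)))"
    using chi_finite_weakly_continuous[OF finB] f
    by (intro exI[of _ "chi B"] conjI allI impI exI[of _ "norm f / 2"]) auto
qed

lemma sot_compact_quasi_local_algebra:
  fixes M :: "('a::metric_space ell2 \<Rightarrow>\<^sub>L 'a ell2) set"
  assumes inf: "infinite (UNIV :: 'a set)" and ulf: "uniformly_locally_finite (UNIV :: 'a set)"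
    and M: "vn_algebra M J" and ql: "M \<subseteq> quasi_local_algebra"
  shows "sot_compact M"
proof -
  interpret vn_algebra M J by (rule M)
  obtain v :: "nat \<Rightarrow> 'a ell2" where v: "\<And>i. norm (v i) \<le> 1" "\<And>x. (\<And>i. inner x (v i) = 0) \<Longrightarrow> x = 0"
    using ell2_total_sequence[OF ulf_countable[OF ulf]] by blast
  \<comment> \<open>The constant 1/32 doubles to 1/16 for differences, as
    \<open>sot_compact_of_quasi_local\<close> requires. The same \<open>n\<close> serves all
    sequences of projections.\<close>
  obtain n where n: "\<And>e. (\<And>k. multiplier_proj (e k)) \<Longrightarrow> sconv e 0 \<Longrightarrow>
      \<exists>k. \<forall>c\<in>corner (e k) M. norm c \<le> 1 \<longrightarrow>
        (\<exists>a\<in>{a. quasi_local (1/32) (real n) a}. \<exists>b\<in>{a. quasi_local (1/32) (real n) a}. c = a - b)"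
  proof (rule small_corners_in_differences[of v "\<lambda>n. {a. quasi_local (1/32) (real n) a}"])
    show "a \<in> {a. quasi_local (1/32) (real n) a}"
      if "\<And>k. s k \<in> {a. quasi_local (1/32) (real n) a}" "wconv s a" for n s a
      using quasi_local_closed that by blast
    show "\<exists>n. a \<in> {a. quasi_local (1/32) (real n) a}" if a: "a \<in> M" for a
    proof -
      have "a \<in> quasi_local_algebra" using ql a by blast
      then have "\<exists>r>0. quasi_local (1/32) r a" by (simp add: quasi_local_algebra_def)
      then obtain r where r: "quasi_local (1/32) r a" by blast
      obtain n where "r \<le> real n" using real_arch_simple by blast
      then have "quasi_local (1/32) (real n) a" by (intro quasi_local_mono[OF r]) auto
      then show ?thesis by blast
    qed
  qed (use v in blast)+
  show ?thesis
  proof (rule sot_compact_of_small_corners[of v])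
    fix e assume e: "\<And>k. multiplier_proj (e k)" "sconv e 0"
    obtain k where k: "\<And>c. c \<in> corner (e k) M \<Longrightarrow> norm c \<le> 1 \<Longrightarrow>
        \<exists>a b. quasi_local (1/32) (real n) a \<and> quasi_local (1/32) (real n) b \<and> c = a - b"
      using n[OF e] by blast
    have "sot_compact (corner (e k) M)"
    proof (rule sot_compact_of_quasi_local[OF inf ulf vn_algebra_corner[OF e(1)]])
      fix c assume "c \<in> corner (e k) M" "norm c \<le> 1"
      then obtain a b where "quasi_local (1/32) (real n) a" "quasi_local (1/32) (real n) b" "c = a - b"
        using k by blast
      then show "quasi_local (1/16) (real n) c" using quasi_local_diff by fastforce
    qed simp
    then show "\<exists>k. sot_compact (corner (e k) M)" ..
  qed (use v in blast)+
qed

section \<open>Approximable operators\<close>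

lemma propagation_le_iff:
  assumes "r \<ge> 0"
  shows "propagation a \<le> ennreal r \<longleftrightarrow> (\<forall>x z. ell2_apply (a (delta x)) z \<noteq> 0 \<longrightarrow> dist x z \<le> r)"
  unfolding propagation_def cinner_delta SUP_le_iff using assms by (auto simp: ennreal_le_iff)

lemma propagation_add_le:
  assumes "r \<ge> 0" "propagation a \<le> ennreal r" "propagation b \<le> ennreal r"
  shows "propagation (a + b) \<le> ennreal r"
  using assms unfolding propagation_le_iff[OF assms(1)]
  by (metis add.right_neutral blinfun.add_left plus_ell2.rep_eq)

lemma propagation_scale_le:
  assumes "r \<ge> 0" "propagation a \<le> ennreal r"
  shows "propagation (scalar_op c o\<^sub>L a) \<le> ennreal r"
  using assms unfolding propagation_le_iff[OF assms(1)]
  by (auto simp: scalar_op_apply cscale.rep_eq)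

text \<open>Finite balls make \<open>b (delta x)\<close> a finite combination of basis vectors;
  complex linearity of \<open>a\<close> then exhibits an intermediate point \<open>y\<close> at
  which both entries are nonzero.\<close>

lemma propagation_compose_le:
  fixes a b :: "'a::metric_space ell2 \<Rightarrow>\<^sub>L 'a ell2"
  assumes ulf: "uniformly_locally_finite (UNIV :: 'a set)"
    and a: "a \<in> bounded_ops" "propagation a \<le> ennreal r"
    and b: "propagation b \<le> ennreal s" and nn: "r \<ge> 0" "s \<ge> 0"
  shows "propagation (a o\<^sub>L b) \<le> ennreal (r + s)"
proof -
  have "dist x z \<le> r + s" if nz: "ell2_apply (a (b (delta x))) z \<noteq> 0" for x z
  proof -
    let ?S = "cball x s"
    have "b (delta x) = restrict_ell2 ?S (b (delta x))"
      using b unfolding propagation_le_iff[OF nn(2)]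
      by (intro ell2_eqI) (auto simp: restrict_ell2.rep_eq)
    also have "\<dots> = (\<Sum>y\<in>?S. cscale (ell2_apply (b (delta x)) y) (delta y))"
      by (rule restrict_ell2_finite[OF ulf_finite_cball[OF ulf]])
    finally have "a (b (delta x)) = (\<Sum>y\<in>?S. cscale (ell2_apply (b (delta x)) y) (a (delta y)))"
      using bounded_op_sum[OF a(1), of "\<lambda>y. ell2_apply (b (delta x)) y" delta ?S] by metis
    then have "(\<Sum>y\<in>?S. ell2_apply (b (delta x)) y * ell2_apply (a (delta y)) z) \<noteq> 0"
      using nz by (simp add: ell2_apply_sum cscale.rep_eq)
    then obtain y where "y \<in> ?S" "ell2_apply (b (delta x)) y * ell2_apply (a (delta y)) z \<noteq> 0"
      by (rule sum.not_neutral_contains_not_neutral)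
    then have y: "y \<in> ?S" "ell2_apply (a (delta y)) z \<noteq> 0" by simp_all
    have "dist x z \<le> dist x y + dist y z" by (rule dist_triangle)
    also have "\<dots> \<le> s + r"
      using y a(2) unfolding propagation_le_iff[OF nn(1)] by (intro add_mono) auto
    finally show ?thesis by simp
  qed
  then show ?thesis using nn by (subst propagation_le_iff) auto
qed

section \<open>Complex-linear operators and stability of approximability\<close>

lemma bounded_ops_add: "a \<in> bounded_ops \<Longrightarrow> b \<in> bounded_ops \<Longrightarrow> a + b \<in> bounded_ops"
proof -
  have "cscale c (f + g) = cscale c f + cscale c g" for c and f g :: "'a ell2"
    by (rule ell2_eqI) (simp add: cscale.rep_eq plus_ell2.rep_eq distrib_left)
  then show "a \<in> bounded_ops \<Longrightarrow> b \<in> bounded_ops \<Longrightarrow> a + b \<in> bounded_ops"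
    by (simp add: bounded_ops_def blinfun.add_left)
qed

lemma bounded_ops_compose: "a \<in> bounded_ops \<Longrightarrow> b \<in> bounded_ops \<Longrightarrow> a o\<^sub>L b \<in> bounded_ops"
  by (simp add: bounded_ops_def)

lemma bounded_ops_scalar: "scalar_op c \<in> bounded_ops"
  by (auto simp: bounded_ops_def scalar_op_apply cscale.rep_eq intro!: ell2_eqI)

lemma bounded_ops_id: "id_blinfun \<in> bounded_ops"
  by (simp add: bounded_ops_def)

lemma bounded_ops_chi: "chi A \<in> bounded_ops"
  by (auto simp: bounded_ops_def chi_apply cscale.rep_eq intro!: ell2_eqI)

lemma approximableE:
  assumes "approximable \<epsilon> r a"
  obtains b where "b \<in> bounded_ops" "propagation b \<le> ennreal r" "norm (a - b) \<le> \<epsilon>"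
  using assms unfolding approximable_def by blast

lemma approximable_mono: "approximable \<epsilon> r a \<Longrightarrow> \<epsilon> \<le> \<delta> \<Longrightarrow> r \<le> s \<Longrightarrow> approximable \<delta> s a"
  unfolding approximable_def by (meson ennreal_leI order_trans)

lemma approximable_add:
  assumes "approximable \<epsilon> r a" "approximable \<delta> r b" "r \<ge> 0"
  shows "approximable (\<epsilon> + \<delta>) r (a + b)"
proof -
  obtain a' where a': "a' \<in> bounded_ops" "propagation a' \<le> ennreal r" "norm (a - a') \<le> \<epsilon>"
    by (rule approximableE[OF assms(1)])
  obtain b' where b': "b' \<in> bounded_ops" "propagation b' \<le> ennreal r" "norm (b - b') \<le> \<delta>"
    by (rule approximableE[OF assms(2)])
  have eq: "(a + b) - (a' + b') = (a - a') + (b - b')" by simp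
  have "norm ((a + b) - (a' + b')) \<le> \<epsilon> + \<delta>"
    unfolding eq using norm_triangle_ineq[of "a - a'" "b - b'"] a'(3) b'(3) by linarith
  then show ?thesis
    unfolding approximable_def
    using bounded_ops_add[OF a'(1) b'(1)] propagation_add_le[OF assms(3) a'(2) b'(2)] by blast
qed

lemma approximable_scale:
  assumes "approximable \<epsilon> r a" "r \<ge> 0"
  shows "approximable (cmod c * \<epsilon>) r (scalar_op c o\<^sub>L a)"
proof -
  obtain b where b: "b \<in> bounded_ops" "propagation b \<le> ennreal r" "norm (a - b) \<le> \<epsilon>"
    by (rule approximableE[OF assms(1)])
  have "(scalar_op c o\<^sub>L a) - (scalar_op c o\<^sub>L b) = scalar_op c o\<^sub>L (a - b)"
    by (intro blinfun_eqI) (simp add: blinfun.diff_left blinfun.diff_right)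
  also have "norm \<dots> \<le> norm (scalar_op c :: 'a ell2 \<Rightarrow>\<^sub>L 'a ell2) * norm (a - b)"
    by (rule norm_blinfun_compose)
  also have "\<dots> \<le> cmod c * \<epsilon>" by (intro mult_mono norm_scalar_op_le b) auto
  finally show ?thesis
    unfolding approximable_def
    using bounded_ops_compose[OF bounded_ops_scalar b(1)] propagation_scale_le[OF assms(2) b(2)]
    by blast
qed

text \<open>The approximants are bounded by 1 + \<epsilon>, so a subsequence has a weak limit.
  Propagation at most \<open>r\<close> is a vanishing condition on matrix entries, which weak limits
  preserve.\<close>

lemma approximable_closed:
  fixes a :: "'a::metric_space ell2 \<Rightarrow>\<^sub>L 'a ell2"
  assumes X: "countable (UNIV :: 'a set)" and r: "r \<ge> 0"
    and s: "\<And>k. approximable \<epsilon> r (s k)" "\<And>k. norm (s k) \<le> 1" "wconv s a"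
  shows "approximable \<epsilon> r a"
proof -
  have "\<forall>k. \<exists>b. b \<in> bounded_ops \<and> propagation b \<le> ennreal r \<and> norm (s k - b) \<le> \<epsilon>"
    using s(1) unfolding approximable_def by blast
  from choice[OF this] obtain t where t: "\<And>k. t k \<in> bounded_ops" "\<And>k. propagation (t k) \<le> ennreal r"
    "\<And>k. norm (s k - t k) \<le> \<epsilon>" by blast
  have nt: "norm (t k) \<le> 1 + \<epsilon>" for k
    using norm_triangle_ineq2[of "t k" "s k"] s(2)[of k] t(3)[of k] by (simp add: norm_minus_commute)
  obtain \<phi> b where \<phi>: "strict_mono (\<phi> :: nat \<Rightarrow> nat)" and b: "b \<in> bounded_ops"
    and lim: "wconv (\<lambda>n. t (\<phi> n)) b"
    by (rule bounded_ops_compactness[of t, OF X t(1) nt])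
  have "propagation b \<le> ennreal r"
    unfolding propagation_le_iff[OF r]
  proof (intro allI impI, rule ccontr)
    fix x z assume nz: "ell2_apply (b (delta x)) z \<noteq> 0" and "\<not> dist x z \<le> r"
    then have "ell2_apply (t k (delta x)) z = 0" for k
      using t(2)[of k] unfolding propagation_le_iff[OF r] by blast
    moreover have "(\<lambda>n. ell2_apply (t (\<phi> n) (delta x)) z) \<longlonglongrightarrow> ell2_apply (b (delta x)) z"
      unfolding cinner_delta[symmetric] cinner_eq_inner by (intro tendsto_Complex wconvD lim)
    ultimately show False using nz by (simp add: LIMSEQ_const_iff)
  qed
  moreover have "norm (a - b) \<le> \<epsilon>"
    by (rule wconv_norm_le[OF wconv_diff[OF wconv_subseq[OF s(3) \<phi>] lim] t(3)])
  ultimately show ?thesis using b unfolding approximable_def by blast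
qed

text \<open>Replacing the right factor costs \<open>\<epsilon>\<close>, replacing the left one
  \<open>2 * \<epsilon>\<close>, as the approximant of \<open>b\<close> has norm at most 2 for
  \<open>\<epsilon> \<le> 1\<close>.\<close>

lemma approximable_compose:
  fixes a b :: "'a::metric_space ell2 \<Rightarrow>\<^sub>L 'a ell2"
  assumes ulf: "uniformly_locally_finite (UNIV :: 'a set)"
    and a: "approximable \<epsilon> r a" "norm a \<le> 1" and b: "approximable \<epsilon> s b" "norm b \<le> 1"
    and nn: "r \<ge> 0" "s \<ge> 0" "0 \<le> \<epsilon>" "\<epsilon> \<le> 1"
  shows "approximable (3 * \<epsilon>) (r + s) (a o\<^sub>L b)"
proof -
  obtain a' where a': "a' \<in> bounded_ops" "propagation a' \<le> ennreal r" "norm (a - a') \<le> \<epsilon>"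
    by (rule approximableE[OF a(1)])
  obtain b' where b': "b' \<in> bounded_ops" "propagation b' \<le> ennreal s" "norm (b - b') \<le> \<epsilon>"
    by (rule approximableE[OF b(1)])
  have nb: "norm b' \<le> 2"
    using norm_triangle_ineq2[of b' b] b(2) b'(3) nn by (simp add: norm_minus_commute)
  have "(a o\<^sub>L b) - (a' o\<^sub>L b') = (a o\<^sub>L (b - b')) + ((a - a') o\<^sub>L b')"
    by (intro blinfun_eqI) (simp add: blinfun.diff_left blinfun.diff_right blinfun.add_left)
  also have "norm \<dots> \<le> norm (a o\<^sub>L (b - b')) + norm ((a - a') o\<^sub>L b')" by (rule norm_triangle_ineq)
  also have "\<dots> \<le> 1 * \<epsilon> + \<epsilon> * 2"
    by (intro add_mono order_trans[OF norm_blinfun_compose] mult_mono a a' b' nb nn) auto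
  finally have "norm ((a o\<^sub>L b) - (a' o\<^sub>L b')) \<le> 3 * \<epsilon>" by simp
  then show ?thesis
    unfolding approximable_def
    using bounded_ops_compose[OF a'(1) b'(1)]
      propagation_compose_le[OF ulf a'(1,2) b'(2) nn(1,2)] by blast
qed

text \<open>Cutting down to \<open>A\<close> and \<open>B\<close> annihilates an approximant of
  propagation at most \<open>r\<close>, so only the approximation error remains.\<close>

lemma approximable_imp_quasi_local:
  assumes "approximable \<epsilon> r a" "r \<ge> 0"
  shows "quasi_local \<epsilon> r a"
  unfolding quasi_local_def
proof (intro allI impI)
  fix A B :: "'a set" assume AB: "setdist A B > r"
  obtain b where b: "b \<in> bounded_ops" "propagation b \<le> ennreal r" "norm (a - b) \<le> \<epsilon>"
    by (rule approximableE[OF assms(1)])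
  have b0: "chi A o\<^sub>L b o\<^sub>L chi B = 0"
  proof (rule bounded_op_eq_0)
    show "chi A o\<^sub>L b o\<^sub>L chi B \<in> bounded_ops" by (intro bounded_ops_compose bounded_ops_chi b)
    fix x
    show "(chi A o\<^sub>L b o\<^sub>L chi B) (delta x) = 0"
    proof (cases "x \<in> B")
      case True
      then have "chi B (delta x) = delta x" by (intro ell2_eqI) (auto simp: chi_apply delta.rep_eq)
      moreover have "ell2_apply (b (delta x)) z = 0" if "z \<in> A" for z
      proof -
        have "setdist A B \<le> dist z x" using setdist_le_dist that True by blast
        then have "\<not> dist x z \<le> r" using AB by (simp add: dist_commute)
        then show ?thesis using b(2) unfolding propagation_le_iff[OF assms(2)] by blast
      qed
      ultimately show ?thesis by (intro ell2_eqI) (simp add: chi_apply zero_ell2.rep_eq)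
    next
      case False
      then have "chi B (delta x) = 0"
        by (intro ell2_eqI) (auto simp: chi_apply delta.rep_eq zero_ell2.rep_eq)
      then show ?thesis by (simp add: blinfun.zero_right)
    qed
  qed
  have "chi A (b (chi B f)) = 0" for f using arg_cong[OF b0, of "\<lambda>c. c f"] by simp
  then have "chi A o\<^sub>L a o\<^sub>L chi B = chi A o\<^sub>L (a - b) o\<^sub>L chi B"
    by (intro blinfun_eqI) (simp add: blinfun.diff_left blinfun.diff_right)
  also have "norm \<dots> \<le> norm (chi A o\<^sub>L (a - b)) * norm (chi B)" by (rule norm_blinfun_compose)
  also have "\<dots> \<le> norm (chi A o\<^sub>L (a - b)) * 1" by (intro mult_left_mono norm_chi_le) auto
  also have "\<dots> \<le> norm (chi A) * norm (a - b)" using norm_blinfun_compose[of "chi A" "a - b"] by simp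
  also have "\<dots> \<le> 1 * \<epsilon>" by (intro mult_mono norm_chi_le b) auto
  finally show "norm (chi A o\<^sub>L a o\<^sub>L chi B) \<le> \<epsilon>" by simp
qed

lemma uniform_roe_approximable:
  assumes a: "a \<in> uniform_roe_algebra" and e: "\<epsilon> > 0"
  obtains n where "approximable \<epsilon> (real n) a"
proof -
  obtain b where b: "b \<in> bounded_ops" "propagation b < \<infinity>" "dist b a < \<epsilon>"
    using a e unfolding uniform_roe_algebra_def closure_approachable by blast
  obtain r where r: "r \<ge> 0" "propagation b = ennreal r" using b(2) by (cases "propagation b") auto
  obtain n where "r \<le> real n" using real_arch_simple by blast
  then have "propagation b \<le> ennreal (real n)" using r by (simp add: ennreal_leI)
  moreover have "norm (a - b) \<le> \<epsilon>" using b(3) by (simp add: dist_norm norm_minus_commute)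
  ultimately have "approximable \<epsilon> (real n) a" using b(1) unfolding approximable_def by blast
  with that show ?thesis by blast
qed

lemma approximable_one_plus:
  assumes "approximable \<epsilon> r (u - id_blinfun)" "r \<ge> 0"
  shows "approximable \<epsilon> r u"
proof -
  have "propagation (id_blinfun :: 'a ell2 \<Rightarrow>\<^sub>L 'a ell2) \<le> ennreal r"
    unfolding propagation_le_iff[OF assms(2)] using assms(2) by (auto simp: delta.rep_eq)
  then have "approximable 0 r (id_blinfun :: 'a ell2 \<Rightarrow>\<^sub>L 'a ell2)"
    unfolding approximable_def using bounded_ops_id by (intro bexI[of _ id_blinfun]) auto
  from approximable_add[OF assms(1) this assms(2)] show ?thesis by simp
qed

section \<open>Uniformity on the unit ball\<close>

lemma equi_quasi_local_unit_ball:
  fixes M :: "('a::metric_space ell2 \<Rightarrow>\<^sub>L 'a ell2) set"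
  assumes inf: "infinite (UNIV :: 'a set)" and ulf: "uniformly_locally_finite (UNIV :: 'a set)"
    and M: "vn_algebra M (scalar_op \<i>)" and ql: "M \<subseteq> quasi_local_algebra"
  shows "equi_quasi_local {a \<in> M. norm a \<le> 1}"
  unfolding equi_quasi_local_def
proof (intro allI impI)
  fix \<epsilon> :: real assume e: "\<epsilon> > 0"
  interpret vn_algebra M "scalar_op \<i>" by (rule M)
  obtain v :: "nat \<Rightarrow> 'a ell2" where v: "\<And>x. (\<And>i. inner x (v i) = 0) \<Longrightarrow> x = 0"
    using ell2_total_sequence[OF ulf_countable[OF ulf]] by blast
  \<comment> \<open>Each unitary gets the constant 2 \<delta>, half a difference of two again 2
    \<delta>, and the sum of two such halves 4 \<delta>.\<close>
  define \<delta> where "\<delta> = \<epsilon> / 4"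
  have d: "\<delta> > 0" using e by (simp add: \<delta>_def)
  obtain n where n: "\<And>u. u \<in> unitaries \<Longrightarrow> quasi_local (2 * \<delta>) (real n) u"
  proof (rule unitaries_uniform[of v "\<lambda>n. quasi_local \<delta> (real n)" "\<lambda>n. quasi_local (2 * \<delta>) (real n)"])
    show "sot_compact M" by (rule sot_compact_quasi_local_algebra[OF inf ulf M ql])
    show "\<exists>n. quasi_local \<delta> (real n) u" if "u \<in> unitaries" for u
    proof -
      have "u - id_blinfun \<in> quasi_local_algebra" using that ql by (auto simp: unitaries_def)
      then obtain r where r: "quasi_local \<delta> r (u - id_blinfun)"
        using d unfolding quasi_local_algebra_def by blast
      obtain n where "r \<le> real n" using real_arch_simple by blast
      then have "quasi_local \<delta> (real n) (u - id_blinfun)" using quasi_local_mono[OF r] by blast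
      then show ?thesis using quasi_local_one_plus by fastforce
    qed
    show "quasi_local \<delta> (real n) a"
      if "\<And>k. quasi_local \<delta> (real n) (s k)" "wconv s a" for n s a
      by (rule quasi_local_closed[OF that])
    show "quasi_local (2 * \<delta>) (real n) a" if "quasi_local (2 * \<delta>) (real m) a" "m \<le> n" for m n a
      by (rule quasi_local_mono[OF that(1)]) (use that in auto)
    show "quasi_local (2 * \<delta>) (real (m + n)) (a o\<^sub>L b)"
      if "quasi_local \<delta> (real m) a" "quasi_local \<delta> (real n) b" "norm a \<le> 1" "norm b \<le> 1" for m n a b
      unfolding of_nat_add by (rule quasi_local_compose[OF that(1,3,2,4)]) (use d in auto)
  qed (use v in blast)+
  show "\<exists>r>0. \<forall>a\<in>{a \<in> M. norm a \<le> 1}. norm a \<le> 1 \<longrightarrow> quasi_local \<epsilon> r a"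
  \<comment> \<open>\<open>n\<close> may be 0, whereas the radius must be positive.\<close>
  proof (intro exI[of _ "real (Suc n)"] conjI ballI impI)
    fix a assume "a \<in> {a \<in> M. norm a \<le> 1}"
    then have a: "a \<in> M" "norm a \<le> 1" by auto
    obtain u v u' v' where u: "u \<in> unitaries" "v \<in> unitaries" "u' \<in> unitaries" "v' \<in> unitaries"
      and eq: "a = (-1/2) *\<^sub>R (scalar_op \<i> o\<^sub>L (u - v)) + (1/2) *\<^sub>R (u' - v')"
      by (rule four_unitaries[OF a])
    have "quasi_local (\<bar>-1/2\<bar> * (2 * \<delta> + 2 * \<delta>)) (real n) ((-1/2) *\<^sub>R (scalar_op \<i> o\<^sub>L (u - v)))"
      by (intro quasi_local_scaleR quasi_local_i quasi_local_diff n u)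
    \<comment> \<open>The sign is flipped so that \<open>a\<close> becomes a difference, the form
      covered by \<open>quasi_local_diff\<close>.\<close>
    moreover have "quasi_local (\<bar>-1/2\<bar> * (2 * \<delta> + 2 * \<delta>)) (real n) ((-1/2) *\<^sub>R (u' - v'))"
      by (intro quasi_local_scaleR quasi_local_diff n u)
    ultimately have "quasi_local (\<bar>-1/2\<bar> * (2 * \<delta> + 2 * \<delta>) + \<bar>-1/2\<bar> * (2 * \<delta> + 2 * \<delta>)) (real n) a"
      using quasi_local_diff eq by fastforce
    then show "quasi_local \<epsilon> (real (Suc n)) a"
      by (rule quasi_local_mono) (simp_all add: \<delta>_def)
  qed simp
qed

lemma equi_approximable_unit_ball:
  fixes M :: "('a::metric_space ell2 \<Rightarrow>\<^sub>L 'a ell2) set"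
  assumes inf: "infinite (UNIV :: 'a set)" and ulf: "uniformly_locally_finite (UNIV :: 'a set)"
    and M: "vn_algebra M (scalar_op \<i>)" and bM: "M \<subseteq> bounded_ops" and ur: "M \<subseteq> uniform_roe_algebra"
  shows "equi_approximable {a \<in> M. norm a \<le> 1}"
  unfolding equi_approximable_def
proof (intro allI impI)
  fix \<epsilon> :: real assume e: "\<epsilon> > 0"
  interpret vn_algebra M "scalar_op \<i>" by (rule M)
  note X = ulf_countable[OF ulf]
  obtain v :: "nat \<Rightarrow> 'a ell2" where v: "\<And>x. (\<And>i. inner x (v i) = 0) \<Longrightarrow> x = 0"
    using ell2_total_sequence[OF X] by blast
  \<comment> \<open>Approximable operators are quasi-local, so compactness comes from the
    quasi-local case; only the uniformity argument is repeated.\<close>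
  have "M \<subseteq> quasi_local_algebra"
  proof
    fix a assume a: "a \<in> M"
    have "\<exists>r>0. quasi_local \<epsilon> r a" if e: "\<epsilon> > 0" for \<epsilon>
    proof -
      obtain n where "approximable \<epsilon> (real n) a"
        using uniform_roe_approximable[OF _ e, of a] ur a by blast
      then have "quasi_local \<epsilon> (real n) a" by (rule approximable_imp_quasi_local) simp
      then have "quasi_local \<epsilon> (real (Suc n)) a" by (rule quasi_local_mono) auto
      then show ?thesis by (intro exI[of _ "real (Suc n)"]) auto
    qed
    then show "a \<in> quasi_local_algebra" using a bM by (auto simp: quasi_local_algebra_def)
  qed
  note compact = sot_compact_quasi_local_algebra[OF inf ulf M this]
  \<comment> \<open>Four unitaries, each with constant 3 \<delta> and a coefficient of modulus 1/2,
    add up to 6 \<delta>. The cap 1 is what \<open>approximable_compose\<close> asks for.\<close>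
  define \<delta> where "\<delta> = min 1 (\<epsilon> / 6)"
  have d: "0 < \<delta>" "\<delta> \<le> 1" "6 * \<delta> \<le> \<epsilon>" using e by (auto simp: \<delta>_def)
  obtain n where n: "\<And>u. u \<in> unitaries \<Longrightarrow> approximable (3 * \<delta>) (real n) u"
  proof (rule unitaries_uniform[of v "\<lambda>n. approximable \<delta> (real n)" "\<lambda>n. approximable (3 * \<delta>) (real n)"])
    show "sot_compact M" by (rule compact)
    show "\<exists>n. approximable \<delta> (real n) u" if "u \<in> unitaries" for u
    proof -
      have "u - id_blinfun \<in> uniform_roe_algebra" using that ur by (auto simp: unitaries_def)
      then obtain n where "approximable \<delta> (real n) (u - id_blinfun)"
        by (rule uniform_roe_approximable[OF _ d(1)])
      then show ?thesis using approximable_one_plus by fastforce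
    qed
    show "approximable \<delta> (real n) a"
      if "\<And>k. approximable \<delta> (real n) (s k)" "\<And>k. norm (s k) \<le> 1" "wconv s a"
      for n and s :: "nat \<Rightarrow> 'a ell2 \<Rightarrow>\<^sub>L 'a ell2" and a
      by (rule approximable_closed[OF X of_nat_0_le_iff that])
    show "approximable (3 * \<delta>) (real n) a" if "approximable (3 * \<delta>) (real m) a" "m \<le> n" for m n a
      by (rule approximable_mono[OF that(1)]) (use that in auto)
    show "approximable (3 * \<delta>) (real (m + n)) (a o\<^sub>L b)"
      if "approximable \<delta> (real m) a" "approximable \<delta> (real n) b" "norm a \<le> 1" "norm b \<le> 1"
      for m n and a b :: "'a ell2 \<Rightarrow>\<^sub>L 'a ell2"
      unfolding of_nat_add by (rule approximable_compose[OF ulf that(1,3,2,4)]) (use d in auto)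
  qed (use v in blast)+
  show "\<exists>r>0. \<forall>a\<in>{a \<in> M. norm a \<le> 1}. norm a \<le> 1 \<longrightarrow> approximable \<epsilon> r a"
  proof (intro exI[of _ "real (Suc n)"] conjI ballI impI)
    fix a assume "a \<in> {a \<in> M. norm a \<le> 1}"
    then have a: "a \<in> M" "norm a \<le> 1" by auto
    obtain u v u' v' where u: "u \<in> unitaries" "v \<in> unitaries" "u' \<in> unitaries" "v' \<in> unitaries"
      and eq: "a = (-1/2) *\<^sub>R (scalar_op \<i> o\<^sub>L (u - v)) + (1/2) *\<^sub>R (u' - v')"
      by (rule four_unitaries[OF a])
    have half: "approximable (3 / 2 * \<delta>) (real n) (scalar_op c o\<^sub>L w)"
      if "w \<in> unitaries" "cmod c = 1/2" for w c
      using approximable_scale[OF n[OF that(1)], of c] that(2) by simp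
    have "approximable ((3 / 2 * \<delta> + 3 / 2 * \<delta>) + (3 / 2 * \<delta> + 3 / 2 * \<delta>)) (real n)
      (((scalar_op (- \<i> / 2) o\<^sub>L u) + (scalar_op (\<i> / 2) o\<^sub>L v))
        + ((scalar_op (1 / 2) o\<^sub>L u') + (scalar_op (- 1 / 2) o\<^sub>L v')))"
      by (intro approximable_add half u) (auto simp: norm_divide)
    moreover have "((scalar_op (- \<i> / 2) o\<^sub>L u) + (scalar_op (\<i> / 2) o\<^sub>L v))
        + ((scalar_op (1 / 2) o\<^sub>L u') + (scalar_op (- 1 / 2) o\<^sub>L v')) = a"
      unfolding eq
      by (intro blinfun_eqI ell2_eqI)
        (simp add: blinfun.bilinear_simps scalar_op_apply cscale.rep_eq plus_ell2.rep_eq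
          minus_ell2.rep_eq scaleR_ell2.rep_eq uminus_ell2.rep_eq algebra_simps)
    ultimately have "approximable ((3 / 2 * \<delta> + 3 / 2 * \<delta>) + (3 / 2 * \<delta> + 3 / 2 * \<delta>)) (real n) a"
      by (simp only:)
    then show "approximable \<epsilon> (real (Suc n)) a"
      by (rule approximable_mono) (use d(3) in simp_all)
  qed simp
qed

theorem theorem1p12:
  fixes M :: "('a::metric_space ell2 \<Rightarrow>\<^sub>L 'a ell2) set"
  assumes "infinite (UNIV :: 'a set)"
    and "uniformly_locally_finite (UNIV :: 'a set)"
    and "cstar_subalgebra M"
    and "closedin weak_operator_topology M"
  shows "(M \<subseteq> quasi_local_algebra \<longrightarrow> equi_quasi_local {a \<in> M. norm a \<le> 1}) \<and>
    (M \<subseteq> uniform_roe_algebra \<longrightarrow> equi_approximable {a \<in> M. norm a \<le> 1})"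
proof -
  have M: "vn_algebra M (scalar_op \<i>)"
    by (rule vn_algebra_ell2[OF ulf_countable[OF assms(2)] assms(3,4)])
  have "M \<subseteq> bounded_ops" using assms(3) by (simp add: cstar_subalgebra_def)
  then show ?thesis
    using equi_quasi_local_unit_ball[OF assms(1,2) M] equi_approximable_unit_ball[OF assms(1,2) M]
    by blast
qed

end
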